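(* Let $A$ be a $\sigma$-unital C*-algebra such that for every separable C*-subalgebra $B$ of $M(A)$ there is an approximate unit for $A$ consisting of projections which is $B$-quasicentral. Then the corona $C(A)=M(A)/A$ is countably quantifier-free saturated.
   Context: $M(A)$ is the multiplier algebra of $A$. An approximate unit $(e_n)$ of $A$ is $B$-quasicentral if $\lim_n\|e_nb-be_n\|=0$ for all $b\in B$. For $F\subseteq\mathbb R$, $\varepsilon>0$, $F_\varepsilon=\{x:\operatorname{dist}(x,F)\le\varepsilon\}$. A C*-algebra $M$ is countably quantifier-free saturated if for every sequence $P_n(\bar x)$ ($n\in\mathbb N$) of *-polynomials (arbitrary degree) with coefficients in $M$ in variables $x_k$ ($k\in\mathbb N$) and every sequence of compact $K_n\subseteq\mathbb R$, the following are equivalent: (i) there are $b_k$ in the unit ball of $M$ with $\|P_n(\bar b)\|\in K_n$ for all $n$; (ii) for every $m$ there are $b_k$ in the unit ball of $M$ with $\|P_n(\bar b)\|\in(K_n)_{1/m}$ for all $n\le m$. *)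

theory Defs
  imports Complex_Main "HOL-Library.FuncSet" "HOL-Library.Countable_Set"
begin

record 'a cstar =
  cs_carrier :: "'a set"
  cs_zero :: 'a
  cs_add :: "'a \<Rightarrow> 'a \<Rightarrow> 'a"
  cs_smult :: "complex \<Rightarrow> 'a \<Rightarrow> 'a"
  cs_mult :: "'a \<Rightarrow> 'a \<Rightarrow> 'a"
  cs_star :: "'a \<Rightarrow> 'a"
  cs_nrm :: "'a \<Rightarrow> real"

definition cs_minus :: "'a cstar \<Rightarrow> 'a \<Rightarrow> 'a \<Rightarrow> 'a" where
  "cs_minus S x y = cs_add S x (cs_smult S (-1) y)"

definition is_cstar :: "'a cstar \<Rightarrow> bool" where
  "is_cstar S \<longleftrightarrow>
    (let C = cs_carrier S; z = cs_zero S; ad = cs_add S; sm = cs_smult S;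
         mu = cs_mult S; st = cs_star S; n = cs_nrm S in
     z \<in> C \<and>
     (\<forall>x\<in>C. \<forall>y\<in>C. ad x y \<in> C \<and> mu x y \<in> C) \<and>
     (\<forall>c. \<forall>x\<in>C. sm c x \<in> C) \<and> (\<forall>x\<in>C. st x \<in> C) \<and>
     \<comment> \<open>complex vector space\<close>
     (\<forall>x\<in>C. \<forall>y\<in>C. \<forall>w\<in>C. ad (ad x y) w = ad x (ad y w)) \<and>
     (\<forall>x\<in>C. \<forall>y\<in>C. ad x y = ad y x) \<and>
     (\<forall>x\<in>C. ad z x = x) \<and>
     (\<forall>x\<in>C. ad x (sm (-1) x) = z) \<and>
     (\<forall>c. \<forall>x\<in>C. \<forall>y\<in>C. sm c (ad x y) = ad (sm c x) (sm c y)) \<and>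
     (\<forall>c d. \<forall>x\<in>C. sm (c + d) x = ad (sm c x) (sm d x)) \<and>
     (\<forall>c d. \<forall>x\<in>C. sm c (sm d x) = sm (c * d) x) \<and>
     (\<forall>x\<in>C. sm 1 x = x) \<and>
     \<comment> \<open>associative algebra\<close>
     (\<forall>x\<in>C. \<forall>y\<in>C. \<forall>w\<in>C. mu (mu x y) w = mu x (mu y w)) \<and>
     (\<forall>x\<in>C. \<forall>y\<in>C. \<forall>w\<in>C. mu x (ad y w) = ad (mu x y) (mu x w)) \<and>
     (\<forall>x\<in>C. \<forall>y\<in>C. \<forall>w\<in>C. mu (ad x y) w = ad (mu x w) (mu y w)) \<and>
     (\<forall>c. \<forall>x\<in>C. \<forall>y\<in>C. sm c (mu x y) = mu (sm c x) y \<and> sm c (mu x y) = mu x (sm c y)) \<and>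
     \<comment> \<open>involution\<close>
     (\<forall>x\<in>C. st (st x) = x) \<and>
     (\<forall>x\<in>C. \<forall>y\<in>C. st (ad x y) = ad (st x) (st y)) \<and>
     (\<forall>c. \<forall>x\<in>C. st (sm c x) = sm (cnj c) (st x)) \<and>
     (\<forall>x\<in>C. \<forall>y\<in>C. st (mu x y) = mu (st y) (st x)) \<and>
     \<comment> \<open>norm, submultiplicativity, C*-identity\<close>
     (\<forall>x\<in>C. n x \<ge> 0 \<and> (n x = 0 \<longleftrightarrow> x = z)) \<and>
     (\<forall>x\<in>C. \<forall>y\<in>C. n (ad x y) \<le> n x + n y) \<and>
     (\<forall>c. \<forall>x\<in>C. n (sm c x) = cmod c * n x) \<and>
     (\<forall>x\<in>C. \<forall>y\<in>C. n (mu x y) \<le> n x * n y) \<and>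
     (\<forall>x\<in>C. n (mu (st x) x) = (n x)\<^sup>2) \<and>
     \<comment> \<open>completeness\<close>
     (\<forall>X. (\<forall>k. X k \<in> C) \<and>
          (\<forall>e>0. \<exists>N. \<forall>p\<ge>N. \<forall>q\<ge>N. n (cs_minus S (X p) (X q)) < e) \<longrightarrow>
          (\<exists>l\<in>C. (\<lambda>k. n (cs_minus S (X k) l)) \<longlonglongrightarrow> 0)))"

definition cs_positive :: "'a cstar \<Rightarrow> 'a \<Rightarrow> bool" where
  "cs_positive S x \<longleftrightarrow> x \<in> cs_carrier S \<and> (\<exists>y\<in>cs_carrier S. x = cs_mult S (cs_star S y) y)"

definition cs_le :: "'a cstar \<Rightarrow> 'a \<Rightarrow> 'a \<Rightarrow> bool" where
  "cs_le S x y \<longleftrightarrow> cs_positive S (cs_minus S y x)"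

definition cs_projection :: "'a cstar \<Rightarrow> 'a \<Rightarrow> bool" where
  "cs_projection S p \<longleftrightarrow> p \<in> cs_carrier S \<and> p = cs_star S p \<and> p = cs_mult S p p"

definition approx_unit :: "'a cstar \<Rightarrow> (nat \<Rightarrow> 'a) \<Rightarrow> bool" where
  "approx_unit S e \<longleftrightarrow>
     (\<forall>k. cs_positive S (e k) \<and> cs_nrm S (e k) \<le> 1 \<and> cs_le S (e k) (e (Suc k))) \<and>
     (\<forall>a\<in>cs_carrier S. (\<lambda>k. cs_nrm S (cs_minus S (cs_mult S (e k) a) a)) \<longlonglongrightarrow> 0 \<and>
                         (\<lambda>k. cs_nrm S (cs_minus S (cs_mult S a (e k)) a)) \<longlonglongrightarrow> 0)"

definition sigma_unital :: "'a cstar \<Rightarrow> bool" where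
  "sigma_unital S \<longleftrightarrow> (\<exists>e. approx_unit S e)"

definition separable_subalg :: "'a cstar \<Rightarrow> 'a set \<Rightarrow> bool" where
  "separable_subalg S B \<longleftrightarrow>
     B \<subseteq> cs_carrier S \<and> cs_zero S \<in> B \<and>
     (\<forall>x\<in>B. \<forall>y\<in>B. cs_add S x y \<in> B \<and> cs_mult S x y \<in> B) \<and>
     (\<forall>c. \<forall>x\<in>B. cs_smult S c x \<in> B) \<and> (\<forall>x\<in>B. cs_star S x \<in> B) \<and>
     (\<forall>X l. (\<forall>k. X k \<in> B) \<and> l \<in> cs_carrier S \<and>
            (\<lambda>k. cs_nrm S (cs_minus S (X k) l)) \<longlonglongrightarrow> 0 \<longrightarrow> l \<in> B) \<and>
     (\<exists>D. countable D \<and> D \<subseteq> B \<and> (\<forall>b\<in>B. \<forall>e>0. \<exists>d\<in>D. cs_nrm S (cs_minus S b d) < e))"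

type_synonym 'a mult = "('a \<Rightarrow> 'a) \<times> ('a \<Rightarrow> 'a)"

definition bdd_linear_on :: "'a cstar \<Rightarrow> ('a \<Rightarrow> 'a) \<Rightarrow> bool" where
  "bdd_linear_on A T \<longleftrightarrow> T \<in> extensional (cs_carrier A) \<and> T \<in> cs_carrier A \<rightarrow> cs_carrier A \<and>
     (\<forall>x\<in>cs_carrier A. \<forall>y\<in>cs_carrier A. T (cs_add A x y) = cs_add A (T x) (T y)) \<and>
     (\<forall>c. \<forall>x\<in>cs_carrier A. T (cs_smult A c x) = cs_smult A c (T x)) \<and>
     (\<exists>K. \<forall>x\<in>cs_carrier A. cs_nrm A (T x) \<le> K * cs_nrm A x)"

definition double_centralizer :: "'a cstar \<Rightarrow> 'a mult \<Rightarrow> bool" where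
  "double_centralizer A m \<longleftrightarrow> bdd_linear_on A (fst m) \<and> bdd_linear_on A (snd m) \<and>
     (\<forall>x\<in>cs_carrier A. \<forall>y\<in>cs_carrier A. cs_mult A x (fst m y) = cs_mult A (snd m x) y)"

definition mult_alg :: "'a cstar \<Rightarrow> 'a mult cstar" where
  "mult_alg A = (let C = cs_carrier A in
    \<lparr> cs_carrier = {m. double_centralizer A m},
      cs_zero = (restrict (\<lambda>_. cs_zero A) C, restrict (\<lambda>_. cs_zero A) C),
      cs_add = (\<lambda>m1 m2. (restrict (\<lambda>x. cs_add A (fst m1 x) (fst m2 x)) C,
                         restrict (\<lambda>x. cs_add A (snd m1 x) (snd m2 x)) C)),
      cs_smult = (\<lambda>c m. (restrict (\<lambda>x. cs_smult A c (fst m x)) C,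
                         restrict (\<lambda>x. cs_smult A c (snd m x)) C)),
      cs_mult = (\<lambda>m1 m2. (restrict (\<lambda>x. fst m1 (fst m2 x)) C,
                          restrict (\<lambda>x. snd m2 (snd m1 x)) C)),
      cs_star = (\<lambda>m. (restrict (\<lambda>x. cs_star A (snd m (cs_star A x))) C,
                      restrict (\<lambda>x. cs_star A (fst m (cs_star A x))) C)),
      cs_nrm = (\<lambda>m. Sup {cs_nrm A (fst m x) | x. x \<in> C \<and> cs_nrm A x \<le> 1}) \<rparr>)"

definition mult_emb :: "'a cstar \<Rightarrow> 'a \<Rightarrow> 'a mult" where
  "mult_emb A a = (restrict (\<lambda>x. cs_mult A a x) (cs_carrier A),
                   restrict (\<lambda>x. cs_mult A x a) (cs_carrier A))"

definition corona_nrm :: "'a cstar \<Rightarrow> 'a mult \<Rightarrow> real" where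
  "corona_nrm A m = Inf {cs_nrm (mult_alg A) (cs_minus (mult_alg A) m (mult_emb A a)) | a. a \<in> cs_carrier A}"

datatype 'c spoly = PVar nat | PConst 'c | PAdd "'c spoly" "'c spoly" | PMult "'c spoly" "'c spoly"
  | PScal complex "'c spoly" | PStar "'c spoly"

primrec spoly_consts :: "'c spoly \<Rightarrow> 'c set" where
  "spoly_consts (PVar k) = {}"
| "spoly_consts (PConst c) = {c}"
| "spoly_consts (PAdd p q) = spoly_consts p \<union> spoly_consts q"
| "spoly_consts (PMult p q) = spoly_consts p \<union> spoly_consts q"
| "spoly_consts (PScal z p) = spoly_consts p"
| "spoly_consts (PStar p) = spoly_consts p"

primrec spoly_eval :: "'a cstar \<Rightarrow> (nat \<Rightarrow> 'a) \<Rightarrow> 'a spoly \<Rightarrow> 'a" where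
  "spoly_eval S b (PVar k) = b k"
| "spoly_eval S b (PConst c) = c"
| "spoly_eval S b (PAdd p q) = cs_add S (spoly_eval S b p) (spoly_eval S b q)"
| "spoly_eval S b (PMult p q) = cs_mult S (spoly_eval S b p) (spoly_eval S b q)"
| "spoly_eval S b (PScal z p) = cs_smult S z (spoly_eval S b p)"
| "spoly_eval S b (PStar p) = cs_star S (spoly_eval S b p)"

text \<open>F_eps = {x. dist(x,F) \<le> eps}; for compact F this is the following (empty if F is empty).\<close>
definition thicken :: "real set \<Rightarrow> real \<Rightarrow> real set" where
  "thicken F e = {x. \<exists>y\<in>F. \<bar>x - y\<bar> \<le> e}"

text \<open>Elements of C(A) are represented by multipliers; the unit ball of C(A) consists of the
  classes of multipliers of quotient norm \<le> 1; coefficients in C(A) are represented by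
  multipliers; evaluation is compatible with the quotient map since A is an ideal.\<close>
definition corona_ctbl_qf_saturated :: "'a cstar \<Rightarrow> bool" where
  "corona_ctbl_qf_saturated A \<longleftrightarrow>
    (\<forall>(P :: nat \<Rightarrow> 'a mult spoly) (K :: nat \<Rightarrow> real set).
       (\<forall>n. spoly_consts (P n) \<subseteq> cs_carrier (mult_alg A)) \<and> (\<forall>n. compact (K n)) \<longrightarrow>
       ((\<exists>b. (\<forall>k. b k \<in> cs_carrier (mult_alg A) \<and> corona_nrm A (b k) \<le> 1) \<and>
             (\<forall>n. corona_nrm A (spoly_eval (mult_alg A) b (P n)) \<in> K n))
        \<longleftrightarrow>
        (\<forall>m::nat. m \<ge> 1 \<longrightarrow>
           (\<exists>b. (\<forall>k. b k \<in> cs_carrier (mult_alg A) \<and> corona_nrm A (b k) \<le> 1) \<and>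
                (\<forall>n\<le>m. corona_nrm A (spoly_eval (mult_alg A) b (P n)) \<in> thicken (K n) (1 / real m))))))"

end

theory Submission
  imports Defs "HOL-Analysis.Topology_Euclidean_Space"
begin

text \<open>
  Lift approximate solutions \<open>b\<^sup>m\<close> to multipliers of norm at most \<open>2\<close> and let \<open>(e\<^sub>k)\<close> be an
  approximate unit of projections that is quasicentral for these lifts and the coefficients.
  Along a sparse subsequence \<open>\<kappa>\<close> the differences \<open>p\<^sub>m\<close> of consecutive projections are orthogonal
  projections which almost commute with the data of stage \<open>m\<close> and satisfy
  \<open>\<parallel>p\<^sub>m x p\<^sub>m\<parallel> \<approx> \<parallel>\<pi>(x)\<parallel>\<close> for the relevant \<open>x\<close>, where \<open>\<pi>\<close> is the quotient map. The block diagonal elements \<open>b = \<Sum> p\<^sub>m b\<^sup>m p\<^sub>m\<close> converge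
  strictly, \<open>P(b)\<close> agrees on the \<open>m\<close>-th block with \<open>P(b\<^sup>m)\<close> up to a summable error, and hence
  \<open>\<parallel>\<pi>(P(b))\<parallel>\<close> is a limit point of \<open>\<parallel>\<pi>(P(b\<^sup>m))\<parallel>\<close>, which lies in the closed set \<open>K\<close>.

  Orthogonality of the \<open>p\<^sub>m\<close> needs that \<open>q - p = y\<^sup>*y\<close> forces \<open>q p = p\<close> for projections. This is
  a case of the positivity of \<open>y\<^sup>*y\<close> and is obtained here from norm estimates for
  \<open>1 + t x\<close> with small \<open>t\<close> instead of the functional calculus.
\<close>

lemma le_if_linear_power_growth:
  fixes x c \<alpha> \<beta> :: real
  assumes "0 \<le> x" "0 \<le> c"
    and growth: "\<And>k::nat. x ^ (2^k) \<le> (\<alpha> + \<beta> * 2^k) * c ^ (2^k)"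
  shows "x \<le> c"
proof (rule ccontr)
  assume "\<not> x \<le> c"
  then have "c < x" by simp
  with growth[of 0] assms(1,2) have "0 < c" by (cases "c = 0") auto
  define r where "r = c / x"
  have r: "0 < r" "r < 1" using \<open>0 < c\<close> \<open>c < x\<close> by (simp_all add: r_def)
  have "(\<lambda>N. \<alpha> * r ^ N + \<beta> * (real N * r ^ N)) \<longlonglongrightarrow> \<alpha> * 0 + \<beta> * 0"
    using r by (intro tendsto_intros LIMSEQ_power_zero powser_times_n_limit_0) simp_all
  then have "(\<lambda>k. \<alpha> * r ^ (2^k) + \<beta> * (real (2^k) * r ^ (2^k))) \<longlonglongrightarrow> \<alpha> * 0 + \<beta> * 0"
    by (rule filterlim_compose) (simp add: filterlim_subseq strict_mono_def)
  moreover have "1 \<le> \<alpha> * r ^ (2^k) + \<beta> * (real (2^k) * r ^ (2^k))" for k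
    using growth[of k] \<open>0 < c\<close> \<open>c < x\<close> by (simp add: r_def power_divide field_simps)
  ultimately have "1 \<le> \<alpha> * 0 + \<beta> * 0"
    by (intro LIMSEQ_le_const) auto
  then show False by simp
qed

lemma sum_mult_orthogonal:
  fixes x :: "'i \<Rightarrow> 'a::semiring_0"
  assumes "finite I" "j \<in> I" "\<And>i. i \<in> I \<Longrightarrow> i \<noteq> j \<Longrightarrow> x i * y = 0"
  shows "(\<Sum>i\<in>I. x i) * y = x j * y"
proof -
  have "(\<Sum>i\<in>I. x i * y) = (\<Sum>i\<in>I. if i = j then x j * y else 0)"
    using assms(3) by (intro sum.cong) auto
  then show ?thesis using assms(1,2) by (simp add: sum_distrib_right)
qed

lemma mult_sum_orthogonal:
  fixes x :: "'i \<Rightarrow> 'a::semiring_0"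
  assumes "finite I" "j \<in> I" "\<And>i. i \<in> I \<Longrightarrow> i \<noteq> j \<Longrightarrow> y * x i = 0"
  shows "y * (\<Sum>i\<in>I. x i) = y * x j"
proof -
  have "(\<Sum>i\<in>I. y * x i) = (\<Sum>i\<in>I. if i = j then y * x j else 0)"
    using assms(3) by (intro sum.cong) auto
  then show ?thesis using assms(1,2) by (simp add: sum_distrib_left)
qed

locale cstar_seminorm =
  fixes star :: "'b::{real_algebra,monoid_mult} \<Rightarrow> 'b" ("_\<^sup>\<star>" [1000] 1000)
    and scaleC :: "complex \<Rightarrow> 'b \<Rightarrow> 'b" (infixr "*\<^sub>C" 75)
    and nrm :: "'b \<Rightarrow> real" ("\<parallel>_\<parallel>")
  assumes star_star [simp]: "x\<^sup>\<star>\<^sup>\<star> = x"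
    and star_add [simp]: "(x + y)\<^sup>\<star> = x\<^sup>\<star> + y\<^sup>\<star>"
    and star_mult [simp]: "(x * y)\<^sup>\<star> = y\<^sup>\<star> * x\<^sup>\<star>"
    and star_scaleC [simp]: "(c *\<^sub>C x)\<^sup>\<star> = cnj c *\<^sub>C x\<^sup>\<star>"
    and scaleC_add_right: "c *\<^sub>C (x + y) = c *\<^sub>C x + c *\<^sub>C y"
    and scaleC_scaleC: "c *\<^sub>C d *\<^sub>C x = (c * d) *\<^sub>C x"
    and scaleR_scaleC: "t *\<^sub>R x = complex_of_real t *\<^sub>C x"
    and mult_scaleC_left [simp]: "(c *\<^sub>C x) * y = c *\<^sub>C (x * y)"
    and mult_scaleC_right [simp]: "x * (c *\<^sub>C y) = c *\<^sub>C (x * y)"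
    and nrm_triangle_ineq: "\<parallel>x + y\<parallel> \<le> \<parallel>x\<parallel> + \<parallel>y\<parallel>"
    and nrm_mult_ineq: "\<parallel>x * y\<parallel> \<le> \<parallel>x\<parallel> * \<parallel>y\<parallel>"
    and nrm_scaleC [simp]: "\<parallel>c *\<^sub>C x\<parallel> = cmod c * \<parallel>x\<parallel>"
    and nrm_star_mult: "\<parallel>x\<^sup>\<star> * x\<parallel> = \<parallel>x\<parallel>\<^sup>2"
begin

lemma star_scaleR [simp]: "(t *\<^sub>R x)\<^sup>\<star> = t *\<^sub>R x\<^sup>\<star>"
  by (simp add: scaleR_scaleC)

lemma star_0 [simp]: "0\<^sup>\<star> = 0"
  using star_add[of 0 0] by simp

lemma star_minus [simp]: "(- x)\<^sup>\<star> = - x\<^sup>\<star>"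
  using star_scaleR[of "- 1" x] by simp

lemma star_diff [simp]: "(x - y)\<^sup>\<star> = x\<^sup>\<star> - y\<^sup>\<star>"
  using star_add[of x "- y"] by simp

lemma star_1 [simp]: "1\<^sup>\<star> = 1"
  using star_mult[of "1\<^sup>\<star>" 1] by simp

lemma star_power [simp]: "(x ^ k)\<^sup>\<star> = x\<^sup>\<star> ^ k"
  by (induction k) (simp_all add: power_commutes)

lemma star_sum [simp]: "(\<Sum>i\<in>I. x i)\<^sup>\<star> = (\<Sum>i\<in>I. (x i)\<^sup>\<star>)"
  by (induction I rule: infinite_finite_induct) simp_all

lemma nrm_scaleR [simp]: "\<parallel>t *\<^sub>R x\<parallel> = \<bar>t\<bar> * \<parallel>x\<parallel>"
  by (simp add: scaleR_scaleC)

lemma nrm_0 [simp]: "\<parallel>0\<parallel> = 0"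
  using nrm_scaleR[of 0 0] by simp

lemma nrm_minus [simp]: "\<parallel>- x\<parallel> = \<parallel>x\<parallel>"
  using nrm_scaleR[of "- 1" x] by simp

lemma nrm_nonneg [simp]: "0 \<le> \<parallel>x\<parallel>"
  using nrm_triangle_ineq[of x "- x"] by simp

lemma nrm_triangle_ineq4: "\<parallel>x - y\<parallel> \<le> \<parallel>x\<parallel> + \<parallel>y\<parallel>"
  using nrm_triangle_ineq[of x "- y"] by simp

lemma nrm_triangle_ineq2: "\<parallel>x\<parallel> - \<parallel>y\<parallel> \<le> \<parallel>x - y\<parallel>"
  using nrm_triangle_ineq[of "x - y" y] by simp

lemma nrm_minus_commute: "\<parallel>x - y\<parallel> = \<parallel>y - x\<parallel>"
  using nrm_minus[of "x - y"] by simp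

lemma nrm_star [simp]: "\<parallel>x\<^sup>\<star>\<parallel> = \<parallel>x\<parallel>"
proof -
  have le: "\<parallel>x\<parallel> \<le> \<parallel>x\<^sup>\<star>\<parallel>" for x
  proof (cases "\<parallel>x\<parallel> = 0")
    case True
    then show ?thesis using nrm_nonneg[of "x\<^sup>\<star>"] by linarith
  next
    case False
    then have "0 < \<parallel>x\<parallel>" using nrm_nonneg[of x] by linarith
    moreover have "\<parallel>x\<parallel> * \<parallel>x\<parallel> \<le> \<parallel>x\<^sup>\<star>\<parallel> * \<parallel>x\<parallel>"
      using nrm_star_mult[of x] nrm_mult_ineq[of "x\<^sup>\<star>" x] by (simp add: power2_eq_square)
    ultimately show ?thesis by simp
  qed
  show ?thesis using le[of x] le[of "x\<^sup>\<star>"] by simp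
qed

lemma nrm_mult_mono: "\<parallel>x\<parallel> \<le> a \<Longrightarrow> \<parallel>y\<parallel> \<le> b \<Longrightarrow> \<parallel>x * y\<parallel> \<le> a * b"
  by (meson mult_mono nrm_mult_ineq nrm_nonneg order_trans)

lemma nrm_le_1_if_star_mult_self:
  assumes "x\<^sup>\<star> * x = x"
  shows "\<parallel>x\<parallel> \<le> 1"
proof -
  have "\<parallel>x\<parallel> * \<parallel>x\<parallel> = \<parallel>x\<parallel>"
    using nrm_star_mult[of x] assms by (simp add: power2_eq_square)
  then show ?thesis by auto
qed

lemma nrm_1: "\<parallel>1\<parallel> \<le> 1"
  by (rule nrm_le_1_if_star_mult_self) simp

lemma nrm_power_ineq: "\<parallel>x ^ k\<parallel> \<le> \<parallel>x\<parallel> ^ k"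
proof (induction k)
  case (Suc k)
  show ?case using nrm_mult_mono[OF order_refl[of "\<parallel>x\<parallel>"] Suc] by simp
qed (simp add: nrm_1)

lemma nrm_sum: "\<parallel>\<Sum>i\<in>I. x i\<parallel> \<le> (\<Sum>i\<in>I. \<parallel>x i\<parallel>)"
  by (induction I rule: infinite_finite_induct) (auto intro: order_trans[OF nrm_triangle_ineq])

lemma nrm_selfadjoint_power:
  assumes "x\<^sup>\<star> = x"
  shows "\<parallel>x ^ (2^k)\<parallel> = \<parallel>x\<parallel> ^ (2^k)"
proof (induction k)
  case (Suc k)
  have "\<parallel>x ^ (2 ^ Suc k)\<parallel> = \<parallel>(x ^ (2^k))\<^sup>\<star> * x ^ (2^k)\<parallel>"
    by (simp add: assms power_add[symmetric] mult_2)
  also have "\<dots> = \<parallel>x\<parallel> ^ (2 ^ Suc k)"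
    by (simp only: nrm_star_mult Suc power_mult[symmetric] power_Suc2)
  finally show ?case .
qed simp

lemma nrm_selfadjoint_le_if_power_growth:
  assumes "x\<^sup>\<star> = x" "0 \<le> c" and growth: "\<And>N. 0 < N \<Longrightarrow> \<parallel>x ^ N\<parallel> \<le> (\<alpha> + \<beta> * real N) * c ^ N"
  shows "\<parallel>x\<parallel> \<le> c"
proof (rule le_if_linear_power_growth)
  show "\<parallel>x\<parallel> ^ (2^k) \<le> (\<alpha> + \<beta> * 2^k) * c ^ (2^k)" for k :: nat
    using growth[of "2^k"] by (simp add: nrm_selfadjoint_power[OF assms(1)])
qed (simp_all add: assms(2))

lemma nrm_add_orthogonal:
  assumes orth: "a\<^sup>\<star> * b = 0" "a * b\<^sup>\<star> = 0" and le: "\<parallel>a\<parallel> \<le> c" "\<parallel>b\<parallel> \<le> c"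
  shows "\<parallel>a + b\<parallel> \<le> c"
proof -
  have orth': "b\<^sup>\<star> * a = 0" "b * a\<^sup>\<star> = 0"
    using star_mult[of "a\<^sup>\<star>" b] star_mult[of a "b\<^sup>\<star>"] orth by simp_all
  define x y where "x = a\<^sup>\<star> * a" and "y = b\<^sup>\<star> * b"
  have xy: "x * (y * z) = 0" "y * (x * z) = 0" for z
    unfolding x_def y_def by (metis mult.assoc orth(2) orth'(2) mult_zero_left mult_zero_right)+
  have power: "(x + y) ^ Suc k = x ^ Suc k + y ^ Suc k" for k
    by (induction k) (use xy[of 1] in \<open>simp_all add: algebra_simps xy\<close>)
  have nrm_xy: "\<parallel>x\<parallel> \<le> c\<^sup>2" "\<parallel>y\<parallel> \<le> c\<^sup>2"
    unfolding x_def y_def nrm_star_mult using le by (simp_all add: power_mono)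
  have "\<parallel>x + y\<parallel> \<le> c\<^sup>2"
  proof (rule nrm_selfadjoint_le_if_power_growth)
    fix N :: nat assume "0 < N"
    then have "(x + y) ^ N = x ^ N + y ^ N" using power[of "N - 1"] by simp
    then have "\<parallel>(x + y) ^ N\<parallel> \<le> \<parallel>x\<parallel> ^ N + \<parallel>y\<parallel> ^ N"
      by (metis nrm_triangle_ineq nrm_power_ineq add_mono order_trans)
    also have "\<dots> \<le> (c\<^sup>2) ^ N + (c\<^sup>2) ^ N"
      by (intro add_mono power_mono nrm_xy) auto
    finally show "\<parallel>(x + y) ^ N\<parallel> \<le> (2 + 0 * real N) * (c\<^sup>2) ^ N" by simp
  qed (simp_all add: x_def y_def)
  moreover have "(a + b)\<^sup>\<star> * (a + b) = x + y"
    by (simp add: x_def y_def algebra_simps orth orth')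
  ultimately have "\<parallel>a + b\<parallel>\<^sup>2 \<le> c\<^sup>2" by (metis nrm_star_mult)
  moreover have "0 \<le> c" using le(1) nrm_nonneg order_trans by blast
  ultimately show ?thesis by (rule power2_le_imp_le)
qed

section \<open>Positivity without functional calculus\<close>

lemma scaleC_minus_left: "(- c) *\<^sub>C x = - (c *\<^sub>C x)"
  using scaleC_scaleC[of "- 1" c x] scaleR_scaleC[of "- 1" "c *\<^sub>C x"] by simp

lemma scaleC_diff_right: "c *\<^sub>C (x - y) = c *\<^sub>C x - c *\<^sub>C y"
  using scaleC_add_right[of c "x - y" y] by simp

lemma i_scaleC_i_scaleC [simp]: "\<i> *\<^sub>C \<i> *\<^sub>C x = - x"
  using scaleR_scaleC[of "- 1" x] by (simp add: scaleC_scaleC)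

lemmas scaleC_algebra_simps = scaleC_minus_left scaleC_add_right scaleC_diff_right

lemma nrm_square_le_commuting:
  assumes sa: "x\<^sup>\<star> = x" "z\<^sup>\<star> = z" and comm: "x * z = z * x"
  shows "\<parallel>x\<parallel>\<^sup>2 \<le> \<parallel>x * x + z * z\<parallel>"
proof -
  define y where "y = x + \<i> *\<^sub>C z"
  have star_y: "y\<^sup>\<star> = x - \<i> *\<^sub>C z" by (simp add: y_def sa scaleC_minus_left)
  have "y\<^sup>\<star> * y = x * x + z * z"
    unfolding star_y unfolding y_def by (simp add: algebra_simps scaleC_algebra_simps comm)
  then have "\<parallel>y\<parallel>\<^sup>2 = \<parallel>x * x + z * z\<parallel>" by (simp flip: nrm_star_mult)
  moreover have "x = (1/2) *\<^sub>R (y + y\<^sup>\<star>)"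
    unfolding star_y unfolding y_def by (simp flip: scaleR_2)
  then have "\<parallel>x\<parallel> \<le> \<parallel>y\<parallel>"
    using nrm_triangle_ineq[of y "y\<^sup>\<star>"] nrm_scaleR[of "1/2" "y + y\<^sup>\<star>"] by simp
  ultimately show ?thesis by (simp add: power_mono flip: \<open>\<parallel>y\<parallel>\<^sup>2 = _\<close>)
qed

lemma nrm_one_minus_scaled_square:
  assumes "a\<^sup>\<star> = a" "0 \<le> t"
  shows "\<parallel>1 - t *\<^sub>R (a * a)\<parallel> \<le> 1 + \<parallel>a\<parallel> ^ 4 * t\<^sup>2"
proof -
  let ?x = "1 - t *\<^sub>R (a * a)" and ?z = "sqrt (2 * t) *\<^sub>R a"
  have "\<parallel>?x\<parallel>\<^sup>2 \<le> \<parallel>?x * ?x + ?z * ?z\<parallel>"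
    using assms by (intro nrm_square_le_commuting) (simp_all add: algebra_simps)
  also have "?x * ?x + ?z * ?z = 1 + (t * t) *\<^sub>R ((a * a) * (a * a))"
    using assms(2) by (simp add: algebra_simps flip: scaleR_2)
  also have "\<parallel>\<dots>\<parallel> \<le> 1 + t * t * (\<parallel>a\<parallel> * \<parallel>a\<parallel> * (\<parallel>a\<parallel> * \<parallel>a\<parallel>))"
    by (rule order_trans[OF nrm_triangle_ineq add_mono[OF nrm_1]])
      (simp add: mult_left_mono nrm_mult_mono nrm_mult_ineq)
  also have "\<dots> = 1 + \<parallel>a\<parallel> ^ 4 * t\<^sup>2" by (simp add: power2_eq_square power4_eq_xxxx)
  finally have "\<parallel>?x\<parallel>\<^sup>2 \<le> 1 + \<parallel>a\<parallel> ^ 4 * t\<^sup>2" .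
  also have "\<dots> \<le> (1 + \<parallel>a\<parallel> ^ 4 * t\<^sup>2)\<^sup>2" by (rule self_le_power) simp_all
  finally show ?thesis by (rule power2_le_imp_le) simp
qed

text \<open>In a C*-algebra a selfadjoint element is positive iff it satisfies this first-order
  condition, which is stable under sums by convexity of the seminorm.\<close>

definition infinitesimally_positive :: "'b \<Rightarrow> bool" where
  "infinitesimally_positive x \<longleftrightarrow> (\<exists>C\<ge>0. \<forall>t\<ge>0. \<parallel>1 - t *\<^sub>R x\<parallel> \<le> 1 + C * t\<^sup>2)"

lemma infinitesimally_positiveE:
  assumes "infinitesimally_positive x"
  obtains C where "0 \<le> C" "\<And>t. 0 \<le> t \<Longrightarrow> \<parallel>1 - t *\<^sub>R x\<parallel> \<le> 1 + C * t\<^sup>2"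
  using assms unfolding infinitesimally_positive_def by blast

lemma infinitesimally_positive_square: "a\<^sup>\<star> = a \<Longrightarrow> infinitesimally_positive (a * a)"
  unfolding infinitesimally_positive_def
  using nrm_one_minus_scaled_square by (intro exI[of _ "\<parallel>a\<parallel> ^ 4"]) simp

lemma infinitesimally_positive_add:
  assumes "infinitesimally_positive x" "infinitesimally_positive y"
  shows "infinitesimally_positive (x + y)"
proof -
  obtain C D where "0 \<le> C" and C: "\<And>t. 0 \<le> t \<Longrightarrow> \<parallel>1 - t *\<^sub>R x\<parallel> \<le> 1 + C * t\<^sup>2"
    and "0 \<le> D" and D: "\<And>t. 0 \<le> t \<Longrightarrow> \<parallel>1 - t *\<^sub>R y\<parallel> \<le> 1 + D * t\<^sup>2"
    using assms by (meson infinitesimally_positiveE)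
  have "\<parallel>1 - t *\<^sub>R (x + y)\<parallel> \<le> 1 + (2 * C + 2 * D) * t\<^sup>2" if "0 \<le> t" for t
  proof -
    let ?x = "1 - (2 * t) *\<^sub>R x" and ?y = "1 - (2 * t) *\<^sub>R y"
    have "1 - t *\<^sub>R (x + y) = (1/2) *\<^sub>R (?x + ?y)" by (simp add: algebra_simps flip: scaleR_2)
    then have "\<parallel>1 - t *\<^sub>R (x + y)\<parallel> \<le> 1/2 * (\<parallel>?x\<parallel> + \<parallel>?y\<parallel>)"
      using nrm_triangle_ineq[of ?x ?y] nrm_scaleR[of "1/2" "?x + ?y"] by simp
    also have "\<dots> \<le> 1/2 * ((1 + C * (2 * t)\<^sup>2) + (1 + D * (2 * t)\<^sup>2))"
      using that by (intro mult_left_mono add_mono C D) simp_all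
    finally show ?thesis by (simp add: power2_eq_square algebra_simps)
  qed
  then show ?thesis
    unfolding infinitesimally_positive_def using \<open>0 \<le> C\<close> \<open>0 \<le> D\<close>
    by (intro exI[of _ "2 * C + 2 * D"]) simp
qed

lemma nrm_one_plus_mult_star_le:
  assumes "\<parallel>1 + t *\<^sub>R (x\<^sup>\<star> * x)\<parallel> \<le> r" "1 \<le> r"
  shows "\<parallel>1 + t *\<^sub>R (x * x\<^sup>\<star>)\<parallel> \<le> r"
proof (rule nrm_selfadjoint_le_if_power_growth)
  let ?X = "1 + t *\<^sub>R (x * x\<^sup>\<star>)" and ?Y = "1 + t *\<^sub>R (x\<^sup>\<star> * x)"
  have intertwine: "?X ^ N * x = x * ?Y ^ N" for N
  proof (induction N)
    case (Suc N)
    have "?X ^ Suc N * x = ?X ^ N * (?X * x)" by (simp add: power_Suc2 mult.assoc del: power_Suc)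
    also have "?X * x = x * ?Y" by (simp add: algebra_simps)
    finally show ?case by (simp add: Suc mult.assoc[symmetric] power_Suc2 del: power_Suc)
  qed simp
  fix N :: nat
  show "\<parallel>?X ^ N\<parallel> \<le> (1 + \<bar>t\<bar> * \<parallel>x\<parallel>\<^sup>2 * real N) * r ^ N"
  proof (induction N)
    case (Suc N)
    have "?X ^ Suc N = ?X ^ N + t *\<^sub>R (x * ?Y ^ N * x\<^sup>\<star>)"
      by (simp only: power_Suc2 distrib_left intertwine[symmetric]) (simp add: mult.assoc)
    then have "\<parallel>?X ^ Suc N\<parallel> \<le> \<parallel>?X ^ N\<parallel> + \<bar>t\<bar> * \<parallel>x * ?Y ^ N * x\<^sup>\<star>\<parallel>"
      using nrm_triangle_ineq by (metis nrm_scaleR)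
    also have "\<parallel>x * ?Y ^ N * x\<^sup>\<star>\<parallel> \<le> \<parallel>x\<parallel> * r ^ N * \<parallel>x\<parallel>"
      using assms(1) by (intro nrm_mult_mono order_trans[OF nrm_power_ineq] power_mono) simp_all
    also note Suc
    also have "(1 + \<bar>t\<bar> * \<parallel>x\<parallel>\<^sup>2 * real N) * r ^ N + \<bar>t\<bar> * (\<parallel>x\<parallel> * r ^ N * \<parallel>x\<parallel>)
        = (1 + \<bar>t\<bar> * \<parallel>x\<parallel>\<^sup>2 * real (Suc N)) * r ^ N"
      by (simp add: algebra_simps power2_eq_square)
    also have "\<dots> \<le> (1 + \<bar>t\<bar> * \<parallel>x\<parallel>\<^sup>2 * real (Suc N)) * r ^ Suc N"
      using assms(2) by (intro mult_left_mono power_increasing) simp_all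
    finally show ?case by (simp add: add_mono mult_left_mono)
  qed (simp add: nrm_1)
qed (use assms(2) in simp_all)

lemma infinitesimally_positive_minus_mult_star:
  assumes "infinitesimally_positive (- (x\<^sup>\<star> * x))"
  shows "infinitesimally_positive (- (x * x\<^sup>\<star>))"
proof -
  obtain C where "0 \<le> C" and C: "\<And>t. 0 \<le> t \<Longrightarrow> \<parallel>1 + t *\<^sub>R (x\<^sup>\<star> * x)\<parallel> \<le> 1 + C * t\<^sup>2"
    using assms by (auto elim: infinitesimally_positiveE)
  then have "\<parallel>1 + t *\<^sub>R (x * x\<^sup>\<star>)\<parallel> \<le> 1 + C * t\<^sup>2" if "0 \<le> t" for t
    using that by (intro nrm_one_plus_mult_star_le) simp_all
  then show ?thesis
    unfolding infinitesimally_positive_def using \<open>0 \<le> C\<close> by auto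
qed

lemma two_nrm_square_le_nrm_add_square:
  assumes "a\<^sup>\<star> = a"
  shows "2 * \<parallel>a\<parallel>\<^sup>2 \<le> \<parallel>\<parallel>a\<parallel>\<^sup>2 *\<^sub>R 1 + a * a\<parallel>"
proof -
  define r where "r = \<parallel>a\<parallel>"
  let ?x = "(2 * r) *\<^sub>R a" and ?z = "r\<^sup>2 *\<^sub>R 1 - a * a" and ?s = "r\<^sup>2 *\<^sub>R 1 + a * a"
  have "?s\<^sup>\<star> = ?s" by (simp add: assms)
  have "(2 * r * r)\<^sup>2 = \<parallel>?x\<parallel>\<^sup>2" by (simp add: r_def power_mult_distrib)
  also have "\<dots> \<le> \<parallel>?x * ?x + ?z * ?z\<parallel>"
    by (rule nrm_square_le_commuting) (simp_all add: assms algebra_simps)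
  also have "?x * ?x + ?z * ?z = ?s\<^sup>\<star> * ?s"
    unfolding \<open>?s\<^sup>\<star> = ?s\<close>
    by (simp add: algebra_simps power2_eq_square) (simp flip: scaleR_add_left)
  finally have "(2 * r * r)\<^sup>2 \<le> \<parallel>?s\<parallel>\<^sup>2" by (simp only: nrm_star_mult)
  then show ?thesis using power2_le_imp_le[of "2 * r * r" "\<parallel>?s\<parallel>"] by (simp add: r_def power2_eq_square)
qed

text \<open>Convexity of \<open>s \<mapsto> \<parallel>s + a\<^sup>2\<parallel>\<close> turns the previous estimate into \<open>\<parallel>s + a\<^sup>2\<parallel> \<ge> s + \<parallel>a\<parallel>\<^sup>2\<close> for
  \<open>s \<ge> \<parallel>a\<parallel>\<^sup>2\<close>, and \<open>s = 1 / t\<close> with small \<open>t\<close> contradicts the first-order bound.\<close>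

lemma nrm_eq_0_if_minus_square_positive:
  assumes "a\<^sup>\<star> = a" "infinitesimally_positive (- (a * a))"
  shows "\<parallel>a\<parallel> = 0"
proof (rule ccontr)
  define c where "c = \<parallel>a\<parallel>\<^sup>2"
  assume "\<parallel>a\<parallel> \<noteq> 0"
  then have "0 < c" by (simp add: c_def)
  obtain C where "0 \<le> C" and C: "\<And>t. 0 \<le> t \<Longrightarrow> \<parallel>1 + t *\<^sub>R (a * a)\<parallel> \<le> 1 + C * t\<^sup>2"
    using assms(2) by (auto elim: infinitesimally_positiveE)
  define t where "t = c / (c\<^sup>2 + C + 1)"
  have pos: "0 < c\<^sup>2 + C + 1" using \<open>0 \<le> C\<close> by (simp add: add_nonneg_pos)
  have t: "0 < t" "c * t \<le> 1" "C * t < c"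
    using \<open>0 < c\<close> \<open>0 \<le> C\<close> pos
    by (simp_all add: t_def pos_divide_le_eq pos_divide_less_eq power2_eq_square algebra_simps
        add_strict_increasing add_nonneg_pos)
  have "c *\<^sub>R 1 + a * a = c *\<^sub>R (1 + t *\<^sub>R (a * a)) + (1 - c * t) *\<^sub>R (a * a)"
    by (simp add: algebra_simps)
  then have "\<parallel>c *\<^sub>R 1 + a * a\<parallel> \<le> c * \<parallel>1 + t *\<^sub>R (a * a)\<parallel> + (1 - c * t) * \<parallel>a * a\<parallel>"
    using nrm_triangle_ineq[of "c *\<^sub>R (1 + t *\<^sub>R (a * a))" "(1 - c * t) *\<^sub>R (a * a)"] t \<open>0 < c\<close>
    by simp
  also have "\<dots> \<le> c * (1 + C * t\<^sup>2) + (1 - c * t) * c"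
    using t \<open>0 < c\<close> nrm_star_mult[of a] assms(1)
    by (intro add_mono mult_left_mono C) (simp_all add: c_def)
  also have "\<dots> = 2 * c + c * t * (C * t - c)" by (simp add: algebra_simps power2_eq_square)
  also have "\<dots> < 2 * c" using t \<open>0 < c\<close> by (simp add: mult_pos_neg)
  finally show False using two_nrm_square_le_nrm_add_square[OF assms(1)] by (simp add: c_def)
qed

text \<open>The Kelley--Vaught argument: \<open>x x\<^sup>\<star>\<close> is as negative as \<open>x\<^sup>\<star> x\<close>, whereas
  \<open>x\<^sup>\<star> x + x x\<^sup>\<star>\<close> is a sum of two squares of selfadjoint elements.\<close>

lemma nrm_eq_0_if_star_mult_eq_minus_square:
  assumes g: "g\<^sup>\<star> = g" and x: "x\<^sup>\<star> * x = - (g * g)"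
  shows "\<parallel>g\<parallel> = 0"
proof (rule nrm_eq_0_if_minus_square_positive[OF g])
  define h k where "h = x + x\<^sup>\<star>" and "k = \<i> *\<^sub>C (x - x\<^sup>\<star>)"
  have sa: "h\<^sup>\<star> = h" "k\<^sup>\<star> = k"
    by (simp_all add: h_def k_def scaleC_algebra_simps add.commute)
  have "infinitesimally_positive (- (x * x\<^sup>\<star>))"
    by (rule infinitesimally_positive_minus_mult_star)
      (simp add: x infinitesimally_positive_square[OF g])
  then have "infinitesimally_positive (h * h + k * k + (- (x * x\<^sup>\<star>) + - (x * x\<^sup>\<star>)) + g * g)"
    by (intro infinitesimally_positive_add infinitesimally_positive_square sa g)
  also have "h * h + k * k = x\<^sup>\<star> * x + x\<^sup>\<star> * x + (x * x\<^sup>\<star> + x * x\<^sup>\<star>)"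
    unfolding h_def k_def by (simp add: algebra_simps scaleC_algebra_simps)
  finally show "infinitesimally_positive (- (g * g))" by (simp add: x)
qed

section \<open>Projections\<close>

definition projection :: "'b \<Rightarrow> bool" where
  "projection p \<longleftrightarrow> p\<^sup>\<star> = p \<and> p * p = p"

lemma projectionI: "p\<^sup>\<star> = p \<Longrightarrow> p * p = p \<Longrightarrow> projection p"
  by (simp add: projection_def)

lemma projection_star [simp]: "projection p \<Longrightarrow> p\<^sup>\<star> = p"
  by (simp add: projection_def)

lemma projection_idem [simp]: "projection p \<Longrightarrow> p * p = p"
  by (simp add: projection_def)

lemma projection_idem_left [simp]: "projection p \<Longrightarrow> p * (p * x) = p * x"
  by (simp flip: mult.assoc)

lemma nrm_projection: "projection p \<Longrightarrow> \<parallel>p\<parallel> \<le> 1"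
  by (rule nrm_le_1_if_star_mult_self) simp

lemma projection_diff:
  assumes "projection p" "projection q" "q * p = p"
  shows "projection (q - p)"
proof -
  have "p * q = p" using assms star_mult[of q p] by simp
  with assms show ?thesis by (intro projectionI) (simp_all add: algebra_simps)
qed

lemma projection_complement: "projection p \<Longrightarrow> projection (1 - p)"
  by (intro projectionI) (simp_all add: algebra_simps)

lemma nrm_contract_left: "\<parallel>p\<parallel> \<le> 1 \<Longrightarrow> \<parallel>p * x\<parallel> \<le> \<parallel>x\<parallel>"
  using nrm_mult_mono[of p 1 x "\<parallel>x\<parallel>"] by simp

lemma nrm_contract_right: "\<parallel>p\<parallel> \<le> 1 \<Longrightarrow> \<parallel>x * p\<parallel> \<le> \<parallel>x\<parallel>"
  using nrm_mult_mono[of x "\<parallel>x\<parallel>" p 1] by simp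

lemma nrm_contract: "\<parallel>p\<parallel> \<le> 1 \<Longrightarrow> \<parallel>q\<parallel> \<le> 1 \<Longrightarrow> \<parallel>p * x * q\<parallel> \<le> \<parallel>x\<parallel>"
  by (meson nrm_contract_left nrm_contract_right order_trans)

abbreviation compress :: "'b \<Rightarrow> 'b \<Rightarrow> 'b" where
  "compress p x \<equiv> p * x * p"

lemma nrm_compress_mono:
  assumes "projection p" "projection q" "q * p = p"
  shows "\<parallel>compress p x\<parallel> \<le> \<parallel>compress q x\<parallel>"
proof -
  have "p * q = p" using assms star_mult[of q p] by simp
  then have "p * x * p = p * (q * x * q) * p" using assms(3) by (metis mult.assoc)
  then show ?thesis using nrm_contract[OF nrm_projection nrm_projection] assms(1) by metis
qed

definition orthogonal_projections :: "'i set \<Rightarrow> ('i \<Rightarrow> 'b) \<Rightarrow> bool" where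
  "orthogonal_projections I p \<longleftrightarrow>
    (\<forall>i\<in>I. projection (p i)) \<and> (\<forall>i\<in>I. \<forall>j\<in>I. i \<noteq> j \<longrightarrow> p i * p j = 0)"

lemma projection_sum:
  assumes "finite I" "orthogonal_projections I p"
  shows "projection (\<Sum>i\<in>I. p i)"
proof (rule projectionI)
  show "(\<Sum>i\<in>I. p i)\<^sup>\<star> = (\<Sum>i\<in>I. p i)"
    using assms(2) by (simp add: orthogonal_projections_def)
  have "(\<Sum>i\<in>I. p i) * p j = p j" if "j \<in> I" for j
    using sum_mult_orthogonal[OF assms(1) that, of p "p j"] assms(2) that
    by (simp add: orthogonal_projections_def)
  then show "(\<Sum>i\<in>I. p i) * (\<Sum>i\<in>I. p i) = (\<Sum>i\<in>I. p i)"
    by (simp add: sum_distrib_left)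
qed

lemma nrm_sum_compress_le:
  assumes "finite I" "orthogonal_projections I p" "\<And>i. i \<in> I \<Longrightarrow> \<parallel>compress (p i) (X i)\<parallel> \<le> C" "0 \<le> C"
  shows "\<parallel>\<Sum>i\<in>I. compress (p i) (X i)\<parallel> \<le> C"
  using assms(1,2,3)
proof (induction I)
  case (insert j I)
  have proj: "projection (p i)" if "i \<in> insert j I" for i
    using insert.prems(1) that by (auto simp: orthogonal_projections_def)
  have orth: "p i * (p j * y) = 0" if "i \<in> I" for i y
    using insert.prems(1) insert.hyps(2) that
    by (auto simp: orthogonal_projections_def simp flip: mult.assoc)
  have "(\<Sum>i\<in>I. compress (p i) (X i))\<^sup>\<star> * compress (p j) (X j) = 0"
    "(\<Sum>i\<in>I. compress (p i) (X i)) * (compress (p j) (X j))\<^sup>\<star> = 0"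
    using proj by (simp_all add: sum_distrib_right mult.assoc orth)
  then have "\<parallel>(\<Sum>i\<in>I. compress (p i) (X i)) + compress (p j) (X j)\<parallel> \<le> C"
    using insert by (intro nrm_add_orthogonal) (simp_all add: orthogonal_projections_def)
  then show ?case using insert.hyps by (simp add: add.commute)
qed (simp add: assms(4))

lemma nrm_compress_sum_le:
  assumes fin: "finite I" and p: "orthogonal_projections I p"
    and le: "\<And>i. i \<in> I \<Longrightarrow> \<parallel>compress (p i) x\<parallel> \<le> C" and "0 \<le> C"
  shows "\<parallel>compress (\<Sum>i\<in>I. p i) x\<parallel> \<le> C + (\<Sum>i\<in>I. \<parallel>p i * x - x * p i\<parallel>)"
proof -
  define g where "g = (\<Sum>i\<in>I. p i)"
  have proj: "projection (p i)" if "i \<in> I" for i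
    using p that by (simp add: orthogonal_projections_def)
  have g: "projection g" unfolding g_def by (rule projection_sum[OF fin p])
  have absorb: "p i * g = p i" "g * p i = p i" if "i \<in> I" for i
    unfolding g_def using mult_sum_orthogonal[OF fin that, of "p i" p]
      sum_mult_orthogonal[OF fin that, of p "p i"] p that
    by (auto simp: orthogonal_projections_def)
  let ?off = "\<lambda>i. p i * (p i * x - x * p i) * (g - p i)"
  have "compress g x = (\<Sum>i\<in>I. p i * x * g)" unfolding g_def by (simp add: sum_distrib_right)
  also have "\<dots> = (\<Sum>i\<in>I. compress (p i) x + ?off i)"
    by (rule sum.cong) (simp_all add: algebra_simps absorb proj)
  finally have "\<parallel>compress g x\<parallel> \<le> \<parallel>\<Sum>i\<in>I. compress (p i) x\<parallel> + \<parallel>\<Sum>i\<in>I. ?off i\<parallel>"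
    by (simp add: sum.distrib nrm_triangle_ineq)
  also have "\<parallel>\<Sum>i\<in>I. compress (p i) x\<parallel> \<le> C" by (rule nrm_sum_compress_le[OF fin p le \<open>0 \<le> C\<close>])
  also have "\<parallel>\<Sum>i\<in>I. ?off i\<parallel> \<le> (\<Sum>i\<in>I. \<parallel>p i * x - x * p i\<parallel>)"
  proof (rule order_trans[OF nrm_sum sum_mono])
    fix i assume "i \<in> I"
    then show "\<parallel>?off i\<parallel> \<le> \<parallel>p i * x - x * p i\<parallel>"
      by (intro nrm_contract nrm_projection projection_diff) (simp_all add: proj g absorb)
  qed
  finally show ?thesis by (simp add: g_def)
qed

lemma projection_le_imp_absorb:
  assumes p: "projection p" and q: "projection q" and y: "y\<^sup>\<star> * y = q - p"
  shows "\<parallel>q * p - p\<parallel> = 0"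
proof -
  define u where "u = 1 - q"
  have u: "projection u" unfolding u_def by (rule projection_complement[OF q])
  have "u * q = 0" by (simp add: u_def q algebra_simps)
  define g where "g = p * u * p"
  have g: "g\<^sup>\<star> = g" by (simp add: g_def p u mult.assoc)
  have "(y * u * p)\<^sup>\<star> * (y * u * p) = p * u * (y\<^sup>\<star> * y) * u * p" by (simp add: p u mult.assoc)
  also have "\<dots> = p * (u * q) * u * p - p * u * p * u * p" unfolding y by (simp add: algebra_simps)
  also have "\<dots> = - (g * g)" by (simp add: \<open>u * q = 0\<close> g_def p mult.assoc)
  finally have "\<parallel>g\<parallel> = 0" by (rule nrm_eq_0_if_star_mult_eq_minus_square[OF g])
  also have "g = (u * p)\<^sup>\<star> * (u * p)" by (simp add: g_def p u mult.assoc)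
  finally have "\<parallel>u * p\<parallel> = 0" by (simp only: nrm_star_mult power_eq_0_iff)
  then show ?thesis by (simp add: u_def left_diff_distrib nrm_minus_commute)
qed

end

section \<open>Quotients by an ideal\<close>

locale star_ideal = cstar_seminorm star scaleC nrm
  for star :: "'b::{real_algebra,monoid_mult} \<Rightarrow> 'b" ("_\<^sup>\<star>" [1000] 1000)
    and scaleC :: "complex \<Rightarrow> 'b \<Rightarrow> 'b" (infixr "*\<^sub>C" 75)
    and nrm :: "'b \<Rightarrow> real" ("\<parallel>_\<parallel>") +
  fixes J :: "'b set"
  assumes zero_in_J [simp]: "0 \<in> J"
    and J_add: "a \<in> J \<Longrightarrow> b \<in> J \<Longrightarrow> a + b \<in> J"
    and J_mult_left: "a \<in> J \<Longrightarrow> x * a \<in> J"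
    and J_mult_right: "a \<in> J \<Longrightarrow> a * x \<in> J"
    and J_star: "a \<in> J \<Longrightarrow> a\<^sup>\<star> \<in> J"
begin

lemma J_scaleC: "a \<in> J \<Longrightarrow> c *\<^sub>C a \<in> J"
  using J_mult_left[of a "c *\<^sub>C 1"] by simp

lemma J_minus: "a \<in> J \<Longrightarrow> - a \<in> J"
  using J_mult_left[of a "- 1"] by simp

lemma J_diff: "a \<in> J \<Longrightarrow> b \<in> J \<Longrightarrow> a - b \<in> J"
  using J_add[of a "- b"] J_minus[of b] by simp

definition quotient_nrm :: "'b \<Rightarrow> real" ("\<parallel>_\<parallel>\<^sub>J") where
  "\<parallel>x\<parallel>\<^sub>J = Inf {\<parallel>x - a\<parallel> | a. a \<in> J}"

lemma quotient_nrm_le: "a \<in> J \<Longrightarrow> \<parallel>x\<parallel>\<^sub>J \<le> \<parallel>x - a\<parallel>"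
  unfolding quotient_nrm_def by (rule cInf_lower) (auto intro!: bdd_belowI[of _ 0])

lemma quotient_nrm_greatest: "(\<And>a. a \<in> J \<Longrightarrow> r \<le> \<parallel>x - a\<parallel>) \<Longrightarrow> r \<le> \<parallel>x\<parallel>\<^sub>J"
  unfolding quotient_nrm_def by (rule cInf_greatest) (auto intro: zero_in_J)

lemma quotient_nrm_lessE:
  assumes "\<parallel>x\<parallel>\<^sub>J < r"
  obtains a where "a \<in> J" "\<parallel>x - a\<parallel> < r"
  using assms quotient_nrm_greatest[of r x] by (meson not_le)

lemma quotient_nrm_cong:
  assumes "x - y \<in> J"
  shows "\<parallel>x\<parallel>\<^sub>J = \<parallel>y\<parallel>\<^sub>J"
proof -
  have le: "\<parallel>x\<parallel>\<^sub>J \<le> \<parallel>y\<parallel>\<^sub>J" if "x - y \<in> J" for x y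
  proof (rule quotient_nrm_greatest)
    fix a assume "a \<in> J"
    then have "\<parallel>x\<parallel>\<^sub>J \<le> \<parallel>x - ((x - y) + a)\<parallel>" using that by (intro quotient_nrm_le J_add)
    then show "\<parallel>x\<parallel>\<^sub>J \<le> \<parallel>y - a\<parallel>" by simp
  qed
  show ?thesis using le[OF assms] le[of y x] J_minus[OF assms] by simp
qed

definition as_cstar :: "'b cstar" where
  "as_cstar = \<lparr>cs_carrier = UNIV, cs_zero = 0, cs_add = (+), cs_smult = (*\<^sub>C), cs_mult = (*),
    cs_star = star, cs_nrm = nrm\<rparr>"

abbreviation eval :: "(nat \<Rightarrow> 'b) \<Rightarrow> 'b spoly \<Rightarrow> 'b" where
  "eval \<equiv> spoly_eval as_cstar"

lemma as_cstar_simps [simp]: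
  "cs_add as_cstar = (+)" "cs_smult as_cstar = (*\<^sub>C)" "cs_mult as_cstar = (*)"
  "cs_star as_cstar = star"
  by (simp_all add: as_cstar_def)

lemma eval_diff_in_J:
  assumes "\<And>k. b k - b' k \<in> J"
  shows "eval b P - eval b' P \<in> J"
proof (induction P)
  case (PAdd P Q)
  have "eval b (PAdd P Q) - eval b' (PAdd P Q) = (eval b P - eval b' P) + (eval b Q - eval b' Q)"
    by simp
  with PAdd show ?case by (simp only: J_add)
next
  case (PMult P Q)
  have "eval b (PMult P Q) - eval b' (PMult P Q)
      = (eval b P - eval b' P) * eval b Q + eval b' P * (eval b Q - eval b' Q)"
    by (simp add: algebra_simps)
  with PMult show ?case by (simp only: J_add J_mult_left J_mult_right)
next
  case (PScal z P)
  then show ?case using J_scaleC by (simp flip: scaleC_diff_right)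
next
  case (PStar P)
  then show ?case using J_star by (simp flip: star_diff)
qed (simp_all add: assms)

lemma bounded_representatives:
  assumes "\<And>k. \<parallel>b k\<parallel>\<^sub>J < r"
  obtains b' where "\<And>k. \<parallel>b' k\<parallel> \<le> r" "\<And>P. \<parallel>eval b' P\<parallel>\<^sub>J = \<parallel>eval b P\<parallel>\<^sub>J"
proof -
  have "\<exists>a\<in>J. \<parallel>b k - a\<parallel> < r" for k by (meson quotient_nrm_lessE assms)
  then obtain a where a: "\<And>k. a k \<in> J" "\<And>k. \<parallel>b k - a k\<parallel> < r" by metis
  show ?thesis
  proof (rule that[of "\<lambda>k. b k - a k"])
    show "\<parallel>b k - a k\<parallel> \<le> r" for k using a(2)[of k] by simp
    show "\<parallel>eval (\<lambda>k. b k - a k) P\<parallel>\<^sub>J = \<parallel>eval b P\<parallel>\<^sub>J" for P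
      by (rule quotient_nrm_cong[OF eval_diff_in_J]) (simp add: a(1) J_minus)
  qed
qed

definition strictly_Cauchy :: "(nat \<Rightarrow> 'b) \<Rightarrow> bool" where
  "strictly_Cauchy X \<longleftrightarrow> (\<forall>a\<in>J. \<forall>\<epsilon>>0. \<exists>N. \<forall>i\<ge>N. \<forall>j\<ge>N.
    \<parallel>X i * a - X j * a\<parallel> < \<epsilon> \<and> \<parallel>a * X i - a * X j\<parallel> < \<epsilon>)"

definition strict_limit :: "(nat \<Rightarrow> 'b) \<Rightarrow> 'b \<Rightarrow> bool" where
  "strict_limit X s \<longleftrightarrow> (\<forall>a\<in>J. (\<lambda>k. \<parallel>X k * a - s * a\<parallel>) \<longlonglongrightarrow> 0 \<and> (\<lambda>k. \<parallel>a * X k - a * s\<parallel>) \<longlonglongrightarrow> 0)"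

end

locale strictly_complete_ideal = star_ideal star scaleC nrm J
  for star :: "'b::{real_algebra,monoid_mult} \<Rightarrow> 'b" ("_\<^sup>\<star>" [1000] 1000)
    and scaleC (infixr "*\<^sub>C" 75) and nrm ("\<parallel>_\<parallel>") and J +
  assumes nrm_eq_0_in_J: "a \<in> J \<Longrightarrow> \<parallel>a\<parallel> = 0 \<Longrightarrow> a = 0"
    and nrm_le_if_essential: "(\<And>a. a \<in> J \<Longrightarrow> \<parallel>a\<parallel> \<le> 1 \<Longrightarrow> \<parallel>x * a\<parallel> \<le> C) \<Longrightarrow> \<parallel>x\<parallel> \<le> C"
    and strictly_complete: "(\<And>k. \<parallel>X k\<parallel> \<le> C) \<Longrightarrow> strictly_Cauchy X \<Longrightarrow> \<exists>s. strict_limit X s"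
begin

lemma eq_in_J: "a \<in> J \<Longrightarrow> b \<in> J \<Longrightarrow> \<parallel>a - b\<parallel> = 0 \<Longrightarrow> a = b"
  using nrm_eq_0_in_J[OF J_diff] by fastforce

lemma strict_limit_mult_eventually_const:
  assumes "strict_limit X s" "a \<in> J" "\<forall>\<^sub>F k in sequentially. X k * a = y" "y \<in> J"
  shows "s * a = y"
proof -
  have "(\<lambda>k. \<parallel>X k * a - s * a\<parallel>) \<longlonglongrightarrow> 0" using assms(1,2) by (simp add: strict_limit_def)
  then have "(\<lambda>k. \<parallel>y - s * a\<parallel>) \<longlonglongrightarrow> 0"
    by (rule Lim_transform_eventually) (use assms(3) in \<open>auto elim: eventually_mono\<close>)
  then have "\<parallel>y - s * a\<parallel> = 0" by (simp add: LIMSEQ_const_iff)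
  then show ?thesis using assms by (intro eq_in_J[symmetric] J_mult_left)
qed

lemma strict_limit_star: "strict_limit X s \<Longrightarrow> strict_limit (\<lambda>k. (X k)\<^sup>\<star>) s\<^sup>\<star>"
proof -
  have "\<parallel>(X k)\<^sup>\<star> * a - s\<^sup>\<star> * a\<parallel> = \<parallel>a\<^sup>\<star> * X k - a\<^sup>\<star> * s\<parallel>"
    "\<parallel>a * (X k)\<^sup>\<star> - a * s\<^sup>\<star>\<parallel> = \<parallel>X k * a\<^sup>\<star> - s * a\<^sup>\<star>\<parallel>" for k a
    using nrm_star[of "a\<^sup>\<star> * X k - a\<^sup>\<star> * s"] nrm_star[of "X k * a\<^sup>\<star> - s * a\<^sup>\<star>"] by simp_all
  then show "strict_limit X s \<Longrightarrow> strict_limit (\<lambda>k. (X k)\<^sup>\<star>) s\<^sup>\<star>"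
    using J_star by (simp add: strict_limit_def)
qed

end

section \<open>Increasing approximate units of projections\<close>

lemma dependent_subsequence_exists:
  fixes P :: "nat \<Rightarrow> nat \<Rightarrow> bool" and Q :: "nat \<Rightarrow> nat \<Rightarrow> nat \<Rightarrow> bool"
  assumes P: "\<And>m. \<forall>\<^sub>F k in sequentially. P m k" and Q: "\<And>m k. \<forall>\<^sub>F l in sequentially. Q m k l"
  shows "\<exists>\<kappa>. strict_mono \<kappa> \<and> (\<forall>m. P m (\<kappa> m)) \<and> (\<forall>m. Q m (\<kappa> m) (\<kappa> (Suc m)))"
proof -
  have "\<exists>\<kappa>. \<forall>m. P m (\<kappa> m) \<and> (\<kappa> m < \<kappa> (Suc m) \<and> Q m (\<kappa> m) (\<kappa> (Suc m)))"
  proof (rule dependent_nat_choice)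
    show "\<exists>k. P 0 k" by (rule eventually_happens'[OF sequentially_bot P])
    show "\<exists>l. P (Suc m) l \<and> k < l \<and> Q m k l" for k m
      by (rule eventually_happens'[OF sequentially_bot]) (intro eventually_conj P Q eventually_gt_at_top)
  qed
  then show ?thesis by (auto simp: strict_mono_Suc_iff)
qed

locale projection_unit = strictly_complete_ideal star scaleC nrm J
  for star :: "'b::{real_algebra,monoid_mult} \<Rightarrow> 'b" ("_\<^sup>\<star>" [1000] 1000)
    and scaleC (infixr "*\<^sub>C" 75) and nrm ("\<parallel>_\<parallel>") and J +
  fixes e :: "nat \<Rightarrow> 'b"
  assumes e_in_J: "e k \<in> J"
    and projection_e [simp]: "projection (e k)"
    and e_increasing: "\<exists>y. y\<^sup>\<star> * y = e (Suc k) - e k"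
    and e_unit: "a \<in> J \<Longrightarrow> (\<lambda>k. \<parallel>e k * a - a\<parallel>) \<longlonglongrightarrow> 0"
begin

lemma e_absorb:
  assumes "i \<le> j"
  shows "e j * e i = e i" "e i * e j = e i"
proof -
  have Suc: "e (Suc k) * e k = e k" for k
    using e_increasing[of k] projection_le_imp_absorb[of "e k" "e (Suc k)"]
    by (auto intro!: eq_in_J J_mult_left e_in_J)
  show left: "e j * e i = e i"
    using assms
  proof (induction j rule: dec_induct)
    case (step k)
    have "e (Suc k) * (e k * e i) = e k * e i" by (simp add: Suc flip: mult.assoc)
    then show ?case by (simp add: step)
  qed simp
  show "e i * e j = e i" using arg_cong[OF left, of star] by simp
qed

abbreviation segment :: "nat \<Rightarrow> nat \<Rightarrow> 'b" where
  "segment k l \<equiv> e l - e k"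

abbreviation corner :: "nat \<Rightarrow> 'b \<Rightarrow> 'b" where
  "corner k x \<equiv> compress (1 - e k) x"

lemma projection_segment: "k \<le> l \<Longrightarrow> projection (segment k l)"
  by (rule projection_diff) (simp_all add: e_absorb)

lemma quotient_nrm_le_corner: "\<parallel>x\<parallel>\<^sub>J \<le> \<parallel>corner k x\<parallel>"
proof -
  have "x - corner k x = e k * x + (x - e k * x) * e k" by (simp add: algebra_simps)
  then have "x - corner k x \<in> J" by (simp only: J_add J_mult_left J_mult_right e_in_J)
  then show ?thesis using quotient_nrm_le[of "x - corner k x" x] by simp
qed

lemma eventually_corner_le:
  assumes "\<parallel>x\<parallel>\<^sub>J < r"
  shows "\<forall>\<^sub>F k in sequentially. \<parallel>corner k x\<parallel> \<le> r"
proof -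
  obtain a where a: "a \<in> J" "\<parallel>x - a\<parallel> < r" using quotient_nrm_lessE[OF assms] .
  have "\<forall>\<^sub>F k in sequentially. \<parallel>e k * a - a\<parallel> < r - \<parallel>x - a\<parallel>"
    using e_unit[OF a(1)] a(2) by (intro order_tendstoD(2)) auto
  then show ?thesis
  proof eventually_elim
    case (elim k)
    have contraction: "\<parallel>1 - e k\<parallel> \<le> 1" by (intro nrm_projection projection_complement projection_e)
    have "corner k x = corner k (x - a) - (e k * a - a) * (1 - e k)" by (simp add: algebra_simps)
    then have "\<parallel>corner k x\<parallel> \<le> \<parallel>corner k (x - a)\<parallel> + \<parallel>(e k * a - a) * (1 - e k)\<parallel>"
      by (simp only: nrm_triangle_ineq4)
    also have "\<dots> \<le> \<parallel>x - a\<parallel> + \<parallel>e k * a - a\<parallel>"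
      by (intro add_mono nrm_contract nrm_contract_right contraction)
    finally show ?case using elim by simp
  qed
qed

lemma corner_le_if_segments_le:
  assumes le: "\<And>l. k \<le> l \<Longrightarrow> \<parallel>compress (segment k l) x\<parallel> \<le> C"
  shows "\<parallel>corner k x\<parallel> \<le> C"
proof (rule nrm_le_if_essential)
  fix a assume a: "a \<in> J" "\<parallel>a\<parallel> \<le> 1"
  define z where "z = corner k x"
  have "\<parallel>z * a\<parallel> \<le> C + (\<parallel>e l * (z * a) - z * a\<parallel> + \<parallel>z\<parallel> * \<parallel>e l * a - a\<parallel>)" if "k \<le> l" for l
  proof -
    have "e l * (1 - e k) = segment k l" "(1 - e k) * e l = segment k l"
      using that by (simp_all add: algebra_simps e_absorb)
    then have "compress (e l) z = compress (segment k l) x" unfolding z_def by (metis mult.assoc)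
    then have "\<parallel>compress (e l) z * a\<parallel> \<le> C * 1"
      using le[OF that] a by (intro nrm_mult_mono) auto
    moreover have "z * a = compress (e l) z * a - ((e l * (z * a) - z * a) + e l * z * (e l * a - a))"
      by (simp add: algebra_simps)
    then have "\<parallel>z * a\<parallel> \<le> \<parallel>compress (e l) z * a\<parallel>
        + (\<parallel>e l * (z * a) - z * a\<parallel> + \<parallel>e l * z * (e l * a - a)\<parallel>)"
      by (metis nrm_triangle_ineq4 nrm_triangle_ineq add_left_mono order_trans)
    moreover have "\<parallel>e l * z * (e l * a - a)\<parallel> \<le> \<parallel>z\<parallel> * \<parallel>e l * a - a\<parallel>"
      by (intro nrm_mult_mono nrm_contract_left nrm_projection projection_e order_refl)
    ultimately show ?thesis by simp
  qed
  moreover have "(\<lambda>l. C + (\<parallel>e l * (z * a) - z * a\<parallel> + \<parallel>z\<parallel> * \<parallel>e l * a - a\<parallel>)) \<longlonglongrightarrow> C + (0 + \<parallel>z\<parallel> * 0)"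
    by (intro tendsto_intros e_unit a J_mult_left)
  ultimately show "\<parallel>corner k x * a\<parallel> \<le> C"
    using LIMSEQ_le_const by (fastforce simp: z_def)
qed

lemma eventually_segment_ge:
  assumes "0 < \<epsilon>"
  shows "\<forall>\<^sub>F l in sequentially. \<parallel>corner k x\<parallel> - \<epsilon> \<le> \<parallel>compress (segment k l) x\<parallel>"
proof -
  have "\<exists>L\<ge>k. \<parallel>corner k x\<parallel> - \<epsilon> < \<parallel>compress (segment k L) x\<parallel>"
    using corner_le_if_segments_le[of k x "\<parallel>corner k x\<parallel> - \<epsilon>"] assms by force
  then obtain L where L: "k \<le> L" "\<parallel>corner k x\<parallel> - \<epsilon> < \<parallel>compress (segment k L) x\<parallel>" by blast
  have "\<parallel>compress (segment k L) x\<parallel> \<le> \<parallel>compress (segment k l) x\<parallel>" if "L \<le> l" for l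
    using L(1) that
    by (intro nrm_compress_mono projection_segment) (simp_all add: algebra_simps e_absorb)
  with L(2) show ?thesis unfolding eventually_sequentially by force
qed

lemma compress_segment_near_quotient_nrm:
  assumes "k \<le> l" "\<parallel>corner k x\<parallel> \<le> \<parallel>x\<parallel>\<^sub>J + \<epsilon>" "\<parallel>corner k x\<parallel> - \<epsilon> \<le> \<parallel>compress (segment k l) x\<parallel>"
  shows "\<bar>\<parallel>compress (segment k l) x\<parallel> - \<parallel>x\<parallel>\<^sub>J\<bar> \<le> \<epsilon>"
proof -
  have "\<parallel>compress (segment k l) x\<parallel> \<le> \<parallel>corner k x\<parallel>"
    using assms(1) by (intro nrm_compress_mono projection_segment projection_complement)
      (simp_all add: algebra_simps e_absorb)
  then show ?thesis using assms(2,3) quotient_nrm_le_corner[of x k] by linarith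
qed

lemma nrm_segment_commutator_le:
  "\<parallel>segment k l * d - d * segment k l\<parallel> \<le> \<parallel>e l * d - d * e l\<parallel> + \<parallel>e k * d - d * e k\<parallel>"
proof -
  have "segment k l * d - d * segment k l = (e l * d - d * e l) - (e k * d - d * e k)"
    by (simp add: algebra_simps)
  then show ?thesis by (simp only: nrm_triangle_ineq4)
qed

lemma sparse_subsequence_exists:
  fixes F G :: "nat \<Rightarrow> 'b set"
  assumes fin: "\<And>m. finite (F m)" "\<And>m. finite (G m)"
    and quasicentral: "\<And>m d. d \<in> F m \<Longrightarrow> (\<lambda>k. \<parallel>e k * d - d * e k\<parallel>) \<longlonglongrightarrow> 0"
  obtains \<kappa> where "strict_mono \<kappa>"
    "\<And>m d. d \<in> F m \<Longrightarrow> \<parallel>segment (\<kappa> m) (\<kappa> (Suc m)) * d - d * segment (\<kappa> m) (\<kappa> (Suc m))\<parallel> \<le> (1/2)^m"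
    "\<And>m x. x \<in> G m \<Longrightarrow> \<bar>\<parallel>compress (segment (\<kappa> m) (\<kappa> (Suc m))) x\<parallel> - \<parallel>x\<parallel>\<^sub>J\<bar> \<le> (1/2)^m"
proof -
  let ?central = "\<lambda>m k. \<forall>d\<in>F m. \<parallel>e k * d - d * e k\<parallel> \<le> (1/2)^m / 2"
  let ?above = "\<lambda>m k. \<forall>x\<in>G m. \<parallel>corner k x\<parallel> \<le> \<parallel>x\<parallel>\<^sub>J + (1/2)^m"
  let ?below = "\<lambda>m k l. \<forall>x\<in>G m. \<parallel>corner k x\<parallel> - (1/2)^m \<le> \<parallel>compress (segment k l) x\<parallel>"
  have central: "\<forall>\<^sub>F k in sequentially. ?central m k" for m
  proof (rule eventually_ball_finite[OF fin(1)], rule ballI)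
    fix d assume "d \<in> F m"
    from order_tendstoD(2)[OF quasicentral[OF this], of "(1/2)^m / 2"]
    show "\<forall>\<^sub>F k in sequentially. \<parallel>e k * d - d * e k\<parallel> \<le> (1/2)^m / 2"
      by (auto elim: eventually_mono)
  qed
  have above: "\<forall>\<^sub>F k in sequentially. ?above m k" for m
    using fin(2) by (intro eventually_ball_finite ballI eventually_corner_le) simp_all
  have below: "\<forall>\<^sub>F l in sequentially. ?below m k l" for m k
    using fin(2) by (intro eventually_ball_finite ballI eventually_segment_ge) simp_all
  have "\<exists>\<kappa>. strict_mono \<kappa> \<and> (\<forall>m. ?central m (\<kappa> m) \<and> ?above m (\<kappa> m)) \<and>
      (\<forall>m. ?central m (\<kappa> (Suc m)) \<and> ?below m (\<kappa> m) (\<kappa> (Suc m)))"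
    by (rule dependent_subsequence_exists) (intro eventually_conj central above below)+
  then obtain \<kappa> where \<kappa>: "strict_mono \<kappa>" "\<And>m. ?central m (\<kappa> m) \<and> ?above m (\<kappa> m)"
    "\<And>m. ?central m (\<kappa> (Suc m)) \<and> ?below m (\<kappa> m) (\<kappa> (Suc m))"
    by blast
  show ?thesis
  proof (rule that[OF \<kappa>(1)])
    fix m
    show "\<parallel>segment (\<kappa> m) (\<kappa> (Suc m)) * d - d * segment (\<kappa> m) (\<kappa> (Suc m))\<parallel> \<le> (1/2)^m"
      if "d \<in> F m" for d
      using nrm_segment_commutator_le[of "\<kappa> (Suc m)" "\<kappa> m" d]
        bspec[OF conjunct1[OF \<kappa>(2)] that] bspec[OF conjunct1[OF \<kappa>(3)] that] by linarith
    show "\<bar>\<parallel>compress (segment (\<kappa> m) (\<kappa> (Suc m))) x\<parallel> - \<parallel>x\<parallel>\<^sub>J\<bar> \<le> (1/2)^m" if "x \<in> G m" for x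
      using that \<kappa>(2,3) strict_monoD[OF \<kappa>(1), of m "Suc m"]
      by (intro compress_segment_near_quotient_nrm) simp_all
  qed
qed

lemma nrm_mult_le_if_annihilates_e:
  assumes "x * e m = 0"
  shows "\<parallel>x * a\<parallel> \<le> \<parallel>x\<parallel> * \<parallel>e m * a - a\<parallel>"
proof -
  have "x * a = x * e m * a - x * (e m * a - a)" by (simp add: algebra_simps)
  then show ?thesis using nrm_mult_ineq[of x "e m * a - a"] by (simp add: assms)
qed

lemma strictly_Cauchy_if_eventually_const:
  assumes bounded: "\<And>k. \<parallel>X k\<parallel> \<le> C"
    and const: "\<And>m. \<exists>N. \<forall>i\<ge>N. X i * e m = X N * e m \<and> e m * X i = e m * X N"
  shows "strictly_Cauchy X"
  unfolding strictly_Cauchy_def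
proof (intro ballI allI impI)
  fix a and \<epsilon> :: real assume a: "a \<in> J" and "0 < \<epsilon>"
  have bound: "\<parallel>X i - X j\<parallel> \<le> 2 * C" for i j
    using nrm_triangle_ineq4[of "X i" "X j"] bounded[of i] bounded[of j] by linarith
  have "(\<lambda>m. 2 * C * \<parallel>e m * a - a\<parallel>) \<longlonglongrightarrow> 2 * C * 0" "(\<lambda>m. 2 * C * \<parallel>e m * a\<^sup>\<star> - a\<^sup>\<star>\<parallel>) \<longlonglongrightarrow> 2 * C * 0"
    by (intro tendsto_intros e_unit a J_star)+
  then have "\<forall>\<^sub>F m in sequentially. 2 * C * \<parallel>e m * a - a\<parallel> < \<epsilon> \<and> 2 * C * \<parallel>e m * a\<^sup>\<star> - a\<^sup>\<star>\<parallel> < \<epsilon>"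
    using \<open>0 < \<epsilon>\<close> by (intro eventually_conj order_tendstoD(2)) auto
  then obtain m where m: "2 * C * \<parallel>e m * a - a\<parallel> < \<epsilon>" "2 * C * \<parallel>e m * a\<^sup>\<star> - a\<^sup>\<star>\<parallel> < \<epsilon>"
    by (auto simp: eventually_sequentially)
  obtain N where N: "\<forall>i\<ge>N. X i * e m = X N * e m \<and> e m * X i = e m * X N"
    using const by blast
  have "\<parallel>X i * a - X j * a\<parallel> < \<epsilon> \<and> \<parallel>a * X i - a * X j\<parallel> < \<epsilon>" if "N \<le> i" "N \<le> j" for i j
  proof -
    define d where "d = X i - X j"
    have "X i * e m = X j * e m" "e m * X i = e m * X j" using N that by metis+
    then have "d * e m = 0" "e m * d = 0" by (simp_all add: d_def left_diff_distrib right_diff_distrib)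
    then have "d\<^sup>\<star> * e m = 0" using star_mult[of "e m" d] by simp
    have le: "\<parallel>d\<parallel> * y \<le> 2 * C * y" if "0 \<le> y" for y
      using that by (intro mult_right_mono) (simp_all add: d_def bound)
    have "\<parallel>d * a\<parallel> < \<epsilon>"
      using nrm_mult_le_if_annihilates_e[OF \<open>d * e m = 0\<close>] le m(1)
      by (meson nrm_nonneg order_trans le_less_trans)
    moreover have "\<parallel>a * d\<parallel> < \<epsilon>"
      using nrm_mult_le_if_annihilates_e[OF \<open>d\<^sup>\<star> * e m = 0\<close>, of "a\<^sup>\<star>"] le[of "\<parallel>e m * a\<^sup>\<star> - a\<^sup>\<star>\<parallel>"] m(2)
        nrm_star[of "a * d"] nrm_star[of d] by simp
    ultimately show ?thesis by (simp add: d_def algebra_simps)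
  qed
  then show "\<exists>N. \<forall>i\<ge>N. \<forall>j\<ge>N. \<parallel>X i * a - X j * a\<parallel> < \<epsilon> \<and> \<parallel>a * X i - a * X j\<parallel> < \<epsilon>" by blast
qed

end

section \<open>Block diagonal elements\<close>

context cstar_seminorm
begin

definition nrm_bounded :: "(nat \<Rightarrow> 'b) \<Rightarrow> bool" where
  "nrm_bounded X \<longleftrightarrow> (\<exists>C. \<forall>m. \<parallel>X m\<parallel> \<le> C)"

lemma nrm_boundedI: "(\<And>m. \<parallel>X m\<parallel> \<le> C) \<Longrightarrow> nrm_bounded X"
  by (auto simp: nrm_bounded_def)

lemma nrm_bounded_const: "nrm_bounded (\<lambda>m. x)"
  by (rule nrm_boundedI[OF order_refl])

lemma nrm_bounded_star: "nrm_bounded X \<Longrightarrow> nrm_bounded (\<lambda>m. (X m)\<^sup>\<star>)"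
  by (simp add: nrm_bounded_def)

lemma nrm_bounded_add: "nrm_bounded X \<Longrightarrow> nrm_bounded Y \<Longrightarrow> nrm_bounded (\<lambda>m. X m + Y m)"
  unfolding nrm_bounded_def by (meson add_mono nrm_triangle_ineq order_trans)

lemma nrm_bounded_mult: "nrm_bounded X \<Longrightarrow> nrm_bounded Y \<Longrightarrow> nrm_bounded (\<lambda>m. X m * Y m)"
  unfolding nrm_bounded_def by (meson nrm_mult_mono)

definition nrm_summable :: "(nat \<Rightarrow> 'b) \<Rightarrow> bool" where
  "nrm_summable X \<longleftrightarrow> summable (\<lambda>m. \<parallel>X m\<parallel>)"

lemma nrm_summable_comparison:
  assumes "summable g" "\<forall>\<^sub>F m in sequentially. \<parallel>X m\<parallel> \<le> g m"
  shows "nrm_summable X"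
  unfolding nrm_summable_def
  by (rule summable_comparison_test_ev[OF _ assms(1)]) (use assms(2) in simp)

lemma nrm_summable_star: "nrm_summable X \<Longrightarrow> nrm_summable (\<lambda>m. (X m)\<^sup>\<star>)"
  by (simp add: nrm_summable_def)

lemma nrm_summable_minus: "nrm_summable X \<Longrightarrow> nrm_summable (\<lambda>m. - X m)"
  by (simp add: nrm_summable_def)

lemma nrm_summable_add:
  assumes "nrm_summable X" "nrm_summable Y"
  shows "nrm_summable (\<lambda>m. X m + Y m)"
  using summable_add[OF assms[unfolded nrm_summable_def]]
  by (rule nrm_summable_comparison) (simp add: nrm_triangle_ineq)

lemma nrm_summable_mult_left:
  assumes "nrm_bounded A" "nrm_summable X"
  shows "nrm_summable (\<lambda>m. A m * X m)"
proof -
  obtain C where "\<And>m. \<parallel>A m\<parallel> \<le> C" using assms(1) by (auto simp: nrm_bounded_def)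
  then have "\<parallel>A m * X m\<parallel> \<le> C * \<parallel>X m\<parallel>" for m by (intro nrm_mult_mono) simp_all
  then show ?thesis
    using assms(2) by (intro nrm_summable_comparison[of "\<lambda>m. C * \<parallel>X m\<parallel>"])
      (simp_all add: nrm_summable_def summable_mult)
qed

lemma nrm_summable_mult_right:
  assumes "nrm_bounded A" "nrm_summable X"
  shows "nrm_summable (\<lambda>m. X m * A m)"
proof -
  have "nrm_summable (\<lambda>m. (A m)\<^sup>\<star> * (X m)\<^sup>\<star>)"
    by (intro nrm_summable_mult_left nrm_bounded_star nrm_summable_star assms)
  then show ?thesis using nrm_summable_star[of "\<lambda>m. (A m)\<^sup>\<star> * (X m)\<^sup>\<star>"] by simp
qed

lemmas nrm_summable_intros = nrm_summable_star nrm_summable_minus nrm_summable_add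
  nrm_summable_mult_left nrm_summable_mult_right nrm_bounded_const

end

locale projection_blocks = projection_unit star scaleC nrm J e
  for star :: "'b::{real_algebra,monoid_mult} \<Rightarrow> 'b" ("_\<^sup>\<star>" [1000] 1000)
    and scaleC (infixr "*\<^sub>C" 75) and nrm ("\<parallel>_\<parallel>") and J e +
  fixes \<kappa> :: "nat \<Rightarrow> nat"
  assumes strict_mono_\<kappa>: "strict_mono \<kappa>"
begin

definition block :: "nat \<Rightarrow> 'b" where
  "block m = segment (\<kappa> m) (\<kappa> (Suc m))"

lemma \<kappa>_mono: "i \<le> j \<Longrightarrow> \<kappa> i \<le> \<kappa> j"
  using strict_mono_\<kappa> by (simp add: strict_mono_less_eq)

lemma le_\<kappa>: "m \<le> \<kappa> m"
  using strict_mono_\<kappa> by (rule strict_mono_imp_increasing)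

lemma block_in_J: "block m \<in> J"
  by (simp add: block_def J_diff e_in_J)

lemma projection_block [simp]: "projection (block m)"
  by (simp add: block_def projection_segment \<kappa>_mono)

lemma nrm_block: "\<parallel>block m\<parallel> \<le> 1"
  by (simp add: nrm_projection)

lemma nrm_bounded_block: "nrm_bounded block"
  by (rule nrm_boundedI[OF nrm_block])

lemma block_orthogonal: "i \<noteq> j \<Longrightarrow> block i * block j = 0"
proof (induction i j rule: linorder_wlog)
  case (le i j)
  then show ?case by (simp add: block_def algebra_simps e_absorb \<kappa>_mono)
next
  case (sym i j)
  then show ?case using star_mult[of "block j" "block i"] by simp
qed

lemma orthogonal_projections_block: "orthogonal_projections I block"
  by (simp add: orthogonal_projections_def block_orthogonal)

lemma block_mult_e: "k \<le> m \<Longrightarrow> block m * e (\<kappa> k) = 0" "k \<le> m \<Longrightarrow> e (\<kappa> k) * block m = 0"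
  by (simp_all add: block_def algebra_simps e_absorb \<kappa>_mono)

lemma sum_block: "a \<le> b \<Longrightarrow> (\<Sum>m=a..<b. block m) = segment (\<kappa> a) (\<kappa> b)"
  by (induction b rule: dec_induct) (simp_all add: block_def)

lemma eventually_block_le:
  assumes "\<parallel>x\<parallel>\<^sub>J < r"
  shows "\<forall>\<^sub>F m in sequentially. \<parallel>compress (block m) x\<parallel> \<le> r"
proof -
  have "\<forall>\<^sub>F m in sequentially. \<parallel>corner (\<kappa> m) x\<parallel> \<le> r"
    using eventually_corner_le[OF assms] filterlim_subseq[OF strict_mono_\<kappa>]
    by (rule eventually_compose_filterlim)
  then show ?thesis
  proof eventually_elim
    case (elim m)
    have "\<parallel>compress (block m) x\<parallel> \<le> \<parallel>corner (\<kappa> m) x\<parallel>"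
      by (intro nrm_compress_mono projection_complement projection_block projection_e)
        (simp add: left_diff_distrib block_mult_e)
    with elim show ?case by simp
  qed
qed

lemma quotient_nrm_le_if_blocks_le:
  assumes commutator: "nrm_summable (\<lambda>m. block m * x - x * block m)"
    and le: "\<forall>\<^sub>F m in sequentially. \<parallel>compress (block m) x\<parallel> \<le> C"
  shows "\<parallel>x\<parallel>\<^sub>J \<le> C"
proof (rule field_le_epsilon)
  fix \<epsilon> :: real assume "0 < \<epsilon>"
  obtain N where N: "\<And>m. N \<le> m \<Longrightarrow> \<parallel>compress (block m) x\<parallel> \<le> C"
    using le by (auto simp: eventually_sequentially)
  obtain N' where N': "\<And>a b. N' \<le> a \<Longrightarrow> \<bar>\<Sum>m=a..<b. \<parallel>block m * x - x * block m\<parallel>\<bar> < \<epsilon>"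
    using commutator \<open>0 < \<epsilon>\<close> unfolding nrm_summable_def summable_Cauchy real_norm_def by blast
  define a where "a = max N N'"
  have "0 \<le> C" using N[OF order_refl] nrm_nonneg order_trans by blast
  have "\<parallel>compress (segment (\<kappa> a) l) x\<parallel> \<le> C + \<epsilon>" if "\<kappa> a \<le> l" for l
  proof -
    define b where "b = max a l"
    have ab: "a \<le> b" "l \<le> \<kappa> b" using le_\<kappa>[of b] by (simp_all add: b_def)
    have "\<parallel>compress (segment (\<kappa> a) l) x\<parallel> \<le> \<parallel>compress (segment (\<kappa> a) (\<kappa> b)) x\<parallel>"
      using that ab
      by (intro nrm_compress_mono projection_segment) (simp_all add: algebra_simps e_absorb \<kappa>_mono)
    also have "\<dots> \<le> C + (\<Sum>m=a..<b. \<parallel>block m * x - x * block m\<parallel>)"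
      unfolding sum_block[OF ab(1), symmetric]
      using \<open>0 \<le> C\<close> by (intro nrm_compress_sum_le orthogonal_projections_block N) (simp_all add: a_def)
    also have "\<dots> \<le> C + \<epsilon>" using N'[of a b] by (simp add: a_def abs_less_iff)
    finally show ?thesis .
  qed
  then show "\<parallel>x\<parallel>\<^sub>J \<le> C + \<epsilon>" by (rule order_trans[OF quotient_nrm_le_corner corner_le_if_segments_le])
qed

lemma frequently_block_near_quotient_nrm:
  assumes "nrm_summable (\<lambda>m. block m * x - x * block m)" "0 < \<epsilon>"
  shows "\<exists>\<^sub>F m in sequentially. \<bar>\<parallel>compress (block m) x\<parallel> - \<parallel>x\<parallel>\<^sub>J\<bar> < \<epsilon>"
proof -
  have "\<not> (\<forall>\<^sub>F m in sequentially. \<parallel>compress (block m) x\<parallel> \<le> \<parallel>x\<parallel>\<^sub>J - \<epsilon>/2)"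
    using quotient_nrm_le_if_blocks_le[OF assms(1)] \<open>0 < \<epsilon>\<close> by force
  moreover have "\<forall>\<^sub>F m in sequentially. \<parallel>compress (block m) x\<parallel> \<le> \<parallel>x\<parallel>\<^sub>J + \<epsilon>/2"
    using \<open>0 < \<epsilon>\<close> by (intro eventually_block_le) simp
  ultimately have "\<exists>\<^sub>F m in sequentially. \<parallel>compress (block m) x\<parallel> \<le> \<parallel>x\<parallel>\<^sub>J + \<epsilon>/2 \<and>
      \<not> \<parallel>compress (block m) x\<parallel> \<le> \<parallel>x\<parallel>\<^sub>J - \<epsilon>/2"
    unfolding not_eventually by (intro frequently_eventually_conj)
  then show ?thesis by (rule frequently_elim1) (use \<open>0 < \<epsilon>\<close> in linarith)
qed

definition diagonal_sum :: "(nat \<Rightarrow> 'b) \<Rightarrow> nat \<Rightarrow> 'b" where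
  "diagonal_sum X N = (\<Sum>m<N. compress (block m) (X m))"

lemma star_diagonal_sum: "(diagonal_sum X N)\<^sup>\<star> = diagonal_sum (\<lambda>m. (X m)\<^sup>\<star>) N"
  by (simp add: diagonal_sum_def mult.assoc)

lemma nrm_diagonal_sum_le:
  assumes "\<And>m. \<parallel>X m\<parallel> \<le> C"
  shows "\<parallel>diagonal_sum X N\<parallel> \<le> C"
proof -
  have "0 \<le> C" using assms[of 0] nrm_nonneg order_trans by blast
  moreover have "\<parallel>compress (block m) (X m)\<parallel> \<le> C" for m
    using nrm_contract[OF nrm_block nrm_block] assms order_trans by blast
  ultimately show ?thesis
    unfolding diagonal_sum_def by (intro nrm_sum_compress_le orthogonal_projections_block) simp_all
qed

lemma diagonal_sum_mult_block:
  assumes "m < N"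
  shows "diagonal_sum X N * block m = compress (block m) (X m)"
  unfolding diagonal_sum_def using assms
  by (subst sum_mult_orthogonal[of _ m]) (simp_all add: mult.assoc block_orthogonal)

lemma diagonal_sum_mult_e:
  assumes "m \<le> N"
  shows "diagonal_sum X N * e m = diagonal_sum X m * e m"
proof -
  have zero: "block i * e m = 0" if "m \<le> i" for i
  proof -
    have "block i * e m = block i * e (\<kappa> m) * e m" by (simp add: e_absorb le_\<kappa> mult.assoc)
    then show ?thesis by (simp add: block_mult_e that)
  qed
  have "diagonal_sum X N = diagonal_sum X m + (\<Sum>i=m..<N. compress (block i) (X i))"
    using assms by (simp add: diagonal_sum_def lessThan_atLeast0 sum.atLeastLessThan_concat)
  moreover have "(\<Sum>i=m..<N. compress (block i) (X i)) * e m = 0"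
    by (simp add: sum_distrib_right mult.assoc zero)
  ultimately show ?thesis by (simp add: distrib_right)
qed

lemma strictly_Cauchy_diagonal_sum:
  assumes "\<And>m. \<parallel>X m\<parallel> \<le> C"
  shows "strictly_Cauchy (diagonal_sum X)"
proof (rule strictly_Cauchy_if_eventually_const[OF nrm_diagonal_sum_le[OF assms]])
  have "e m * diagonal_sum X N = e m * diagonal_sum X m" if "m \<le> N" for m N
    using arg_cong[OF diagonal_sum_mult_e[OF that, of "\<lambda>m. (X m)\<^sup>\<star>"], of star]
    by (simp add: star_diagonal_sum)
  then show "\<exists>N. \<forall>i\<ge>N. diagonal_sum X i * e m = diagonal_sum X N * e m \<and>
      e m * diagonal_sum X i = e m * diagonal_sum X N" for m
    using diagonal_sum_mult_e by blast
qed

lemma strict_limit_diagonal_sum_mult_block: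
  assumes "strict_limit (diagonal_sum X) s"
  shows "s * block m = compress (block m) (X m)"
  using assms block_in_J
proof (rule strict_limit_mult_eventually_const)
  show "\<forall>\<^sub>F N in sequentially. diagonal_sum X N * block m = compress (block m) (X m)"
    using eventually_gt_at_top[of m] by eventually_elim (rule diagonal_sum_mult_block)
qed (simp add: J_mult_left block_in_J)

lemma block_diagonal_exists:
  assumes "\<And>m. \<parallel>X m\<parallel> \<le> C"
  obtains s where "\<And>m. s * block m = compress (block m) (X m)"
    "\<And>m. block m * s = compress (block m) (X m)"
proof -
  obtain s where s: "strict_limit (diagonal_sum X) s"
    using strictly_complete[of "diagonal_sum X" C] nrm_diagonal_sum_le strictly_Cauchy_diagonal_sum assms
    by blast
  then have "s\<^sup>\<star> * block m = compress (block m) (X m)\<^sup>\<star>" for m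
    using strict_limit_star[OF s]
    by (intro strict_limit_diagonal_sum_mult_block) (simp add: star_diagonal_sum)
  then have "block m * s = compress (block m) (X m)" for m
    using star_mult[of "s\<^sup>\<star>" "block m"] by (simp add: mult.assoc)
  then show ?thesis using that strict_limit_diagonal_sum_mult_block[OF s] by blast
qed

definition blockwise_close :: "'b \<Rightarrow> (nat \<Rightarrow> 'b) \<Rightarrow> bool" where
  "blockwise_close x X \<longleftrightarrow> nrm_bounded X \<and>
    nrm_summable (\<lambda>m. block m * x - block m * X m) \<and>
    nrm_summable (\<lambda>m. x * block m - X m * block m) \<and>
    nrm_summable (\<lambda>m. block m * X m - X m * block m)"

lemma blockwise_close_const:
  assumes "nrm_summable (\<lambda>m. block m * c - c * block m)"
  shows "blockwise_close c (\<lambda>m. c)"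
  using assms by (simp add: blockwise_close_def nrm_bounded_const) (simp add: nrm_summable_def)

lemma blockwise_close_scaleC_one: "blockwise_close (c *\<^sub>C 1) (\<lambda>m. c *\<^sub>C 1)"
  by (rule blockwise_close_const) (simp add: nrm_summable_def)

lemma blockwise_close_add:
  assumes "blockwise_close x X" "blockwise_close y Y"
  shows "blockwise_close (x + y) (\<lambda>m. X m + Y m)"
proof -
  have "block m * (x + y) - block m * (X m + Y m)
      = (block m * x - block m * X m) + (block m * y - block m * Y m)"
    "(x + y) * block m - (X m + Y m) * block m
      = (x * block m - X m * block m) + (y * block m - Y m * block m)"
    "block m * (X m + Y m) - (X m + Y m) * block m
      = (block m * X m - X m * block m) + (block m * Y m - Y m * block m)" for m
    by (simp_all add: algebra_simps)
  then show ?thesis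
    using assms by (simp add: blockwise_close_def nrm_bounded_add nrm_summable_add)
qed

lemma blockwise_close_star:
  assumes "blockwise_close x X"
  shows "blockwise_close x\<^sup>\<star> (\<lambda>m. (X m)\<^sup>\<star>)"
proof -
  have "block m * x\<^sup>\<star> - block m * (X m)\<^sup>\<star> = (x * block m - X m * block m)\<^sup>\<star>"
    "x\<^sup>\<star> * block m - (X m)\<^sup>\<star> * block m = (block m * x - block m * X m)\<^sup>\<star>"
    "block m * (X m)\<^sup>\<star> - (X m)\<^sup>\<star> * block m = - (block m * X m - X m * block m)\<^sup>\<star>" for m
    by simp_all
  then show ?thesis
    using assms unfolding blockwise_close_def
    by (simp only: nrm_bounded_star nrm_summable_star nrm_summable_minus)
qed

lemma blockwise_close_mult:
  assumes "blockwise_close x X" "blockwise_close y Y"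
  shows "blockwise_close (x * y) (\<lambda>m. X m * Y m)"
proof -
  have bounded: "nrm_bounded X" "nrm_bounded Y"
    and left: "nrm_summable (\<lambda>m. block m * x - block m * X m)"
      "nrm_summable (\<lambda>m. block m * y - block m * Y m)"
    and right: "nrm_summable (\<lambda>m. x * block m - X m * block m)"
      "nrm_summable (\<lambda>m. y * block m - Y m * block m)"
    and comm: "nrm_summable (\<lambda>m. block m * X m - X m * block m)"
      "nrm_summable (\<lambda>m. block m * Y m - Y m * block m)"
    using assms by (simp_all add: blockwise_close_def)
  have "block m * (x * y) - block m * (X m * Y m)
      = (block m * x - block m * X m) * y + (block m * X m - X m * block m) * y
        + X m * (block m * y - block m * Y m) + - (block m * X m - X m * block m) * Y m"
    "x * y * block m - X m * Y m * block m
      = x * (y * block m - Y m * block m) + x * - (block m * Y m - Y m * block m)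
        + (x * block m - X m * block m) * Y m + X m * (block m * Y m - Y m * block m)"
    "block m * (X m * Y m) - X m * Y m * block m
      = (block m * X m - X m * block m) * Y m + X m * (block m * Y m - Y m * block m)" for m
    by (simp_all add: algebra_simps)
  then show ?thesis
    unfolding blockwise_close_def
    by (simp only:) (intro conjI nrm_bounded_mult nrm_summable_intros bounded left right comm)
qed

lemma blockwise_close_eval:
  assumes "\<And>k. blockwise_close (b k) (\<lambda>m. B m k)"
    and "\<And>c. c \<in> spoly_consts P \<Longrightarrow> blockwise_close c (\<lambda>m. c)"
  shows "blockwise_close (eval b P) (\<lambda>m. eval (B m) P)"
  using assms(2)
proof (induction P)
  case (PScal z P)
  then show ?case
    using blockwise_close_mult[OF blockwise_close_scaleC_one[of z], of "eval b P"] by simp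
qed (simp_all add: assms(1) blockwise_close_add blockwise_close_mult blockwise_close_star)

lemma blockwise_close_commutator:
  assumes "blockwise_close x X"
  shows "nrm_summable (\<lambda>m. block m * x - x * block m)"
proof -
  have "block m * x - x * block m
      = (block m * x - block m * X m) + (block m * X m - X m * block m)
        + - (x * block m - X m * block m)" for m
    by simp
  then show ?thesis
    using assms unfolding blockwise_close_def by (simp only: nrm_summable_add nrm_summable_minus)
qed

lemma blockwise_close_exists:
  assumes bounded: "\<And>m. \<parallel>X m\<parallel> \<le> C" and comm: "nrm_summable (\<lambda>m. block m * X m - X m * block m)"
  shows "\<exists>s. blockwise_close s X"
proof -
  obtain s where s: "\<And>m. s * block m = compress (block m) (X m)"
    "\<And>m. block m * s = compress (block m) (X m)"
    by (rule block_diagonal_exists[of X C, OF bounded]) blast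
  have "block m * s - block m * X m = block m * - (block m * X m - X m * block m)"
    "s * block m - X m * block m = (block m * X m - X m * block m) * block m" for m
    by (simp_all add: s algebra_simps)
  then have "blockwise_close s X"
    unfolding blockwise_close_def
    by (simp only:) (intro conjI nrm_boundedI[OF bounded] comm nrm_summable_intros nrm_bounded_block)
  then show ?thesis by blast
qed

lemma quotient_nrm_in_closed:
  assumes close: "blockwise_close x X" and "closed K" and K: "\<forall>\<^sub>F m in sequentially. y m \<in> K"
    and lim: "(\<lambda>m. \<parallel>compress (block m) (X m)\<parallel> - y m) \<longlonglongrightarrow> 0"
  shows "\<parallel>x\<parallel>\<^sub>J \<in> K"
proof -
  have "\<exists>k\<in>K. dist k (\<parallel>x\<parallel>\<^sub>J) < \<epsilon>" if "0 < \<epsilon>" for \<epsilon>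
  proof -
    have "(\<lambda>m. \<parallel>block m * x - block m * X m\<parallel>) \<longlonglongrightarrow> 0"
      using close by (simp add: blockwise_close_def nrm_summable_def summable_LIMSEQ_zero)
    then have small: "\<forall>\<^sub>F m in sequentially. \<parallel>block m * x - block m * X m\<parallel> < \<epsilon>/3"
      using that by (intro order_tendstoD(2)) auto
    have near: "\<forall>\<^sub>F m in sequentially. dist (\<parallel>compress (block m) (X m)\<parallel> - y m) 0 < \<epsilon>/3"
      using that by (intro tendstoD[OF lim]) simp
    have "\<exists>\<^sub>F m in sequentially. \<bar>\<parallel>compress (block m) x\<parallel> - \<parallel>x\<parallel>\<^sub>J\<bar> < \<epsilon>/3"
      using that blockwise_close_commutator[OF close]
      by (intro frequently_block_near_quotient_nrm) simp_all
    from frequently_eventually_conj[OF this eventually_conj[OF K eventually_conj[OF small near]]]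
    obtain m where m: "y m \<in> K" "\<parallel>block m * x - block m * X m\<parallel> < \<epsilon>/3"
      "\<bar>\<parallel>compress (block m) (X m)\<parallel> - y m\<bar> < \<epsilon>/3" "\<bar>\<parallel>compress (block m) x\<parallel> - \<parallel>x\<parallel>\<^sub>J\<bar> < \<epsilon>/3"
      by (auto dest: frequently_ex)
    have "\<parallel>compress (block m) x - compress (block m) (X m)\<parallel> \<le> \<parallel>block m * x - block m * X m\<parallel>"
      using nrm_contract_right[OF nrm_block, of "block m * x - block m * X m" m]
      by (simp add: left_diff_distrib)
    then have "dist (y m) (\<parallel>x\<parallel>\<^sub>J) < \<epsilon>"
      using m nrm_triangle_ineq2[of "compress (block m) x" "compress (block m) (X m)"]
        nrm_triangle_ineq2[of "compress (block m) (X m)" "compress (block m) x"]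
        nrm_minus_commute[of "compress (block m) x" "compress (block m) (X m)"]
      unfolding dist_real_def by linarith
    with m(1) show ?thesis by blast
  qed
  then show ?thesis using closed_approachable[OF \<open>closed K\<close>] by blast
qed

lemma quotient_nrm_in_closed_if_approx:
  assumes close: "blockwise_close x X" and "closed K"
    and near: "\<forall>\<^sub>F m in sequentially. \<bar>\<parallel>compress (block m) (X m)\<parallel> - \<parallel>X m\<parallel>\<^sub>J\<bar> \<le> (1/2)^m"
    and approx: "\<forall>\<^sub>F m in sequentially. \<exists>y\<in>K. \<bar>\<parallel>X m\<parallel>\<^sub>J - y\<bar> \<le> 1 / real (Suc m)"
  shows "\<parallel>x\<parallel>\<^sub>J \<in> K"
proof -
  obtain y where y: "\<forall>\<^sub>F m in sequentially. y m \<in> K \<and> \<bar>\<parallel>X m\<parallel>\<^sub>J - y m\<bar> \<le> 1 / real (Suc m)"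
    using approx unfolding Bex_def eventually_ex by blast
  have "(\<lambda>m. \<parallel>compress (block m) (X m)\<parallel> - y m) \<longlonglongrightarrow> 0"
  proof (rule Lim_null_comparison)
    show "\<forall>\<^sub>F m in sequentially. norm (\<parallel>compress (block m) (X m)\<parallel> - y m) \<le> (1/2)^m + 1 / real (Suc m)"
      unfolding real_norm_def using near y by eventually_elim (elim conjE, linarith)
    have "(\<lambda>m. (1/2::real)^m + 1 / real (Suc m)) \<longlonglongrightarrow> 0 + 0"
      by (intro tendsto_add LIMSEQ_power_zero LIMSEQ_Suc[OF lim_1_over_n]) simp
    then show "(\<lambda>m. (1/2::real)^m + 1 / real (Suc m)) \<longlonglongrightarrow> 0" by simp
  qed
  then show ?thesis
    using y by (intro quotient_nrm_in_closed[OF close \<open>closed K\<close>]) (auto elim: eventually_mono)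
qed

end

section \<open>Saturation of the quotient\<close>

lemma finite_spoly_consts: "finite (spoly_consts P)"
  by (induction P) simp_all

context projection_unit
begin

lemma saturation_if_quasicentral:
  fixes P :: "nat \<Rightarrow> 'b spoly" and K :: "nat \<Rightarrow> real set"
  assumes bounded: "\<And>m k. \<parallel>B m k\<parallel> \<le> C" and K: "\<And>j. closed (K j)"
    and central_B: "\<And>m k. (\<lambda>i. \<parallel>e i * B m k - B m k * e i\<parallel>) \<longlonglongrightarrow> 0"
    and central_P: "\<And>j c. c \<in> spoly_consts (P j) \<Longrightarrow> (\<lambda>i. \<parallel>e i * c - c * e i\<parallel>) \<longlonglongrightarrow> 0"
    and approx: "\<And>m j. j \<le> m \<Longrightarrow> \<exists>y\<in>K j. \<bar>\<parallel>eval (B m) (P j)\<parallel>\<^sub>J - y\<bar> \<le> 1 / real (Suc m)"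
  shows "\<exists>b. \<forall>j. \<parallel>eval b (P j)\<parallel>\<^sub>J \<in> K j"
proof -
  define F where "F m = B m ` {..m} \<union> (\<Union>j\<le>m. spoly_consts (P j))" for m
  define G where "G m = (\<lambda>j. eval (B m) (P j)) ` {..m}" for m
  have F: "(\<lambda>i. \<parallel>e i * d - d * e i\<parallel>) \<longlonglongrightarrow> 0" if "d \<in> F m" for m d
    using that central_B central_P by (auto simp: F_def)
  obtain \<kappa> where "strict_mono \<kappa>" and commutator:
      "\<And>m d. d \<in> F m \<Longrightarrow> \<parallel>segment (\<kappa> m) (\<kappa> (Suc m)) * d - d * segment (\<kappa> m) (\<kappa> (Suc m))\<parallel> \<le> (1/2)^m"
    and near: "\<And>m x. x \<in> G m \<Longrightarrow> \<bar>\<parallel>compress (segment (\<kappa> m) (\<kappa> (Suc m))) x\<parallel> - \<parallel>x\<parallel>\<^sub>J\<bar> \<le> (1/2)^m"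
    using sparse_subsequence_exists[of F G] F by (auto simp: F_def G_def finite_spoly_consts)
  interpret projection_blocks star scaleC nrm J e \<kappa> by unfold_locales fact
  note commutator = commutator[folded block_def] and near = near[folded block_def]
  have commuting: "nrm_summable (\<lambda>m. block m * d m - d m * block m)"
    if "\<forall>\<^sub>F m in sequentially. d m \<in> F m" for d
    using that by (intro nrm_summable_comparison[of "\<lambda>m. (1/2)^m"])
      (auto elim: eventually_mono intro: commutator)
  have "\<exists>b. blockwise_close b (\<lambda>m. B m k)" for k
  proof (rule blockwise_close_exists[OF bounded commuting])
    show "\<forall>\<^sub>F m in sequentially. B m k \<in> F m"
      using eventually_ge_at_top[of k] by eventually_elim (simp add: F_def)
  qed
  then obtain b where b: "\<And>k. blockwise_close (b k) (\<lambda>m. B m k)" by metis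
  have "\<parallel>eval b (P j)\<parallel>\<^sub>J \<in> K j" for j
  proof (rule quotient_nrm_in_closed_if_approx[OF _ K])
    show "blockwise_close (eval b (P j)) (\<lambda>m. eval (B m) (P j))"
    proof (intro blockwise_close_eval b blockwise_close_const commuting)
      show "\<forall>\<^sub>F m in sequentially. c \<in> F m" if "c \<in> spoly_consts (P j)" for c
        using eventually_ge_at_top[of j] by eventually_elim (use that in \<open>auto simp: F_def\<close>)
    qed
    show "\<forall>\<^sub>F m in sequentially.
        \<bar>\<parallel>compress (block m) (eval (B m) (P j))\<parallel> - \<parallel>eval (B m) (P j)\<parallel>\<^sub>J\<bar> \<le> (1/2)^m"
      using eventually_ge_at_top[of j] by eventually_elim (rule near, simp add: G_def)
    show "\<forall>\<^sub>F m in sequentially. \<exists>y\<in>K j. \<bar>\<parallel>eval (B m) (P j)\<parallel>\<^sub>J - y\<bar> \<le> 1 / real (Suc m)"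
      using eventually_ge_at_top[of j] by eventually_elim (rule approx)
  qed
  then show ?thesis by blast
qed

end

context strictly_complete_ideal
begin

lemma saturation_closed:
  fixes P :: "nat \<Rightarrow> 'b spoly" and K :: "nat \<Rightarrow> real set"
  assumes units: "\<And>D. countable D \<Longrightarrow>
      \<exists>e. projection_unit star scaleC nrm J e \<and> (\<forall>d\<in>D. (\<lambda>k. \<parallel>e k * d - d * e k\<parallel>) \<longlonglongrightarrow> 0)"
    and K: "\<And>j. closed (K j)"
    and bounded: "\<And>m k. \<parallel>B m k\<parallel>\<^sub>J < C"
    and approx: "\<And>m j. j \<le> m \<Longrightarrow> \<exists>y\<in>K j. \<bar>\<parallel>eval (B m) (P j)\<parallel>\<^sub>J - y\<bar> \<le> 1 / real (Suc m)"
  shows "\<exists>b. \<forall>j. \<parallel>eval b (P j)\<parallel>\<^sub>J \<in> K j"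
proof -
  have "\<exists>b. (\<forall>k. \<parallel>b k\<parallel> \<le> C) \<and> (\<forall>P. \<parallel>eval b P\<parallel>\<^sub>J = \<parallel>eval (B m) P\<parallel>\<^sub>J)" for m
    using bounded_representatives[of "B m", OF bounded] by metis
  then obtain B' where B': "\<And>m k. \<parallel>B' m k\<parallel> \<le> C" "\<And>m P. \<parallel>eval (B' m) P\<parallel>\<^sub>J = \<parallel>eval (B m) P\<parallel>\<^sub>J"
    by metis
  let ?D = "(\<Union>m. range (B' m)) \<union> (\<Union>j. spoly_consts (P j))"
  have "countable ?D"
    by (intro countable_Un countable_UN) (simp_all add: countable_finite finite_spoly_consts)
  then obtain e where "projection_unit star scaleC nrm J e"
    and central: "\<And>d. d \<in> ?D \<Longrightarrow> (\<lambda>k. \<parallel>e k * d - d * e k\<parallel>) \<longlonglongrightarrow> 0"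
    using units by metis
  then interpret projection_unit star scaleC nrm J e by simp
  show ?thesis
    by (rule saturation_if_quasicentral[of B' C, OF B'(1) K]) (use central approx B'(2) in auto)
qed

text \<open>The constraint \<open>\<parallel>b k\<parallel>\<^sub>J \<le> 1\<close> is the polynomial condition of the variable \<open>k\<close> with values in \<open>{..1}\<close>.\<close>

theorem saturation:
  fixes P :: "nat \<Rightarrow> 'b spoly" and K :: "nat \<Rightarrow> real set"
  assumes units: "\<And>D. countable D \<Longrightarrow>
      \<exists>e. projection_unit star scaleC nrm J e \<and> (\<forall>d\<in>D. (\<lambda>k. \<parallel>e k * d - d * e k\<parallel>) \<longlonglongrightarrow> 0)"
    and K: "\<And>j. closed (K j)"
    and approx: "\<And>m. \<exists>b. (\<forall>k. \<parallel>b k\<parallel>\<^sub>J \<le> 1) \<and>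
      (\<forall>j\<le>m. \<exists>y\<in>K j. \<bar>\<parallel>eval b (P j)\<parallel>\<^sub>J - y\<bar> \<le> 1 / real (Suc m))"
  shows "\<exists>b. (\<forall>k. \<parallel>b k\<parallel>\<^sub>J \<le> 1) \<and> (\<forall>j. \<parallel>eval b (P j)\<parallel>\<^sub>J \<in> K j)"
proof -
  obtain B where B: "\<And>m k. \<parallel>B m k\<parallel>\<^sub>J \<le> 1"
    "\<And>m j. j \<le> m \<Longrightarrow> \<exists>y\<in>K j. \<bar>\<parallel>eval (B m) (P j)\<parallel>\<^sub>J - y\<bar> \<le> 1 / real (Suc m)"
    using approx by metis
  define P' where "P' i = (if even i then PVar (i div 2) else P (i div 2))" for i
  define K' where "K' i = (if even i then {..1} else K (i div 2))" for i
  have "\<exists>b. \<forall>i. \<parallel>eval b (P' i)\<parallel>\<^sub>J \<in> K' i"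
  proof (rule saturation_closed[OF units])
    show "closed (K' i)" for i by (simp add: K'_def K)
    show "\<parallel>B m k\<parallel>\<^sub>J < 2" for m k using B(1)[of m k] by simp
    show "\<exists>y\<in>K' i. \<bar>\<parallel>eval (B m) (P' i)\<parallel>\<^sub>J - y\<bar> \<le> 1 / real (Suc m)" if "i \<le> m" for m i
    proof (cases "even i")
      case True
      then show ?thesis using B(1) by (intro bexI[of _ "\<parallel>B m (i div 2)\<parallel>\<^sub>J"]) (simp_all add: P'_def K'_def)
    next
      case False
      then show ?thesis using B(2)[of "i div 2" m] that by (simp add: P'_def K'_def)
    qed
  qed
  then obtain b where b: "\<And>i. \<parallel>eval b (P' i)\<parallel>\<^sub>J \<in> K' i" by blast
  have "\<parallel>b k\<parallel>\<^sub>J \<le> 1" "\<parallel>eval b (P k)\<parallel>\<^sub>J \<in> K k" for k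
    using b[of "2 * k"] b[of "Suc (2 * k)"] by (simp_all add: P'_def K'_def)
  then show ?thesis by blast
qed

end

section \<open>C*-algebras as records\<close>

locale cstar_algebra =
  fixes A :: "'a cstar"
  assumes is_cstar: "is_cstar A"
begin

abbreviation carrier_A ("\<A>") where "\<A> \<equiv> cs_carrier A"
abbreviation zero_A ("\<zero>") where "\<zero> \<equiv> cs_zero A"
abbreviation add_A (infixl "\<oplus>" 65) where "x \<oplus> y \<equiv> cs_add A x y"
abbreviation minus_A (infixl "\<ominus>" 65) where "x \<ominus> y \<equiv> cs_minus A x y"
abbreviation mult_A (infixl "\<otimes>" 70) where "x \<otimes> y \<equiv> cs_mult A x y"
abbreviation smult_A (infixr "\<odot>" 75) where "c \<odot> x \<equiv> cs_smult A c x"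
abbreviation star_A ("_\<^sup>\<star>" [1000] 1000) where "x\<^sup>\<star> \<equiv> cs_star A x"
abbreviation nrm_A ("\<parallel>_\<parallel>") where "\<parallel>x\<parallel> \<equiv> cs_nrm A x"

lemma
  shows zero_closed [simp]: "\<zero> \<in> \<A>"
    and smult_closed [rule_format, simp]: "\<forall>c. \<forall>x\<in>\<A>. c \<odot> x \<in> \<A>"
    and star_closed [rule_format, simp]: "\<forall>x\<in>\<A>. x\<^sup>\<star> \<in> \<A>"
    and add_assoc [rule_format]: "\<forall>x\<in>\<A>. \<forall>y\<in>\<A>. \<forall>z\<in>\<A>. x \<oplus> y \<oplus> z = x \<oplus> (y \<oplus> z)"
    and add_commute [rule_format]: "\<forall>x\<in>\<A>. \<forall>y\<in>\<A>. x \<oplus> y = y \<oplus> x"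
    and zero_add [rule_format, simp]: "\<forall>x\<in>\<A>. \<zero> \<oplus> x = x"
    and add_smult_minus_one [rule_format]: "\<forall>x\<in>\<A>. x \<oplus> (-1) \<odot> x = \<zero>"
    and smult_add_right [rule_format]: "\<forall>c. \<forall>x\<in>\<A>. \<forall>y\<in>\<A>. c \<odot> (x \<oplus> y) = c \<odot> x \<oplus> c \<odot> y"
    and smult_add_left [rule_format]: "\<forall>c d. \<forall>x\<in>\<A>. (c + d) \<odot> x = c \<odot> x \<oplus> d \<odot> x"
    and smult_smult [rule_format]: "\<forall>c d. \<forall>x\<in>\<A>. c \<odot> d \<odot> x = (c * d) \<odot> x"
    and smult_one [rule_format, simp]: "\<forall>x\<in>\<A>. 1 \<odot> x = x"
    and mult_assoc [rule_format]: "\<forall>x\<in>\<A>. \<forall>y\<in>\<A>. \<forall>z\<in>\<A>. x \<otimes> y \<otimes> z = x \<otimes> (y \<otimes> z)"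
    and mult_add_right [rule_format]: "\<forall>x\<in>\<A>. \<forall>y\<in>\<A>. \<forall>z\<in>\<A>. x \<otimes> (y \<oplus> z) = x \<otimes> y \<oplus> x \<otimes> z"
    and mult_add_left [rule_format]: "\<forall>x\<in>\<A>. \<forall>y\<in>\<A>. \<forall>z\<in>\<A>. (x \<oplus> y) \<otimes> z = x \<otimes> z \<oplus> y \<otimes> z"
    and star_star [rule_format, simp]: "\<forall>x\<in>\<A>. x\<^sup>\<star>\<^sup>\<star> = x"
    and star_add [rule_format]: "\<forall>x\<in>\<A>. \<forall>y\<in>\<A>. (x \<oplus> y)\<^sup>\<star> = x\<^sup>\<star> \<oplus> y\<^sup>\<star>"
    and star_smult [rule_format]: "\<forall>c. \<forall>x\<in>\<A>. (c \<odot> x)\<^sup>\<star> = cnj c \<odot> x\<^sup>\<star>"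
    and star_mult [rule_format]: "\<forall>x\<in>\<A>. \<forall>y\<in>\<A>. (x \<otimes> y)\<^sup>\<star> = y\<^sup>\<star> \<otimes> x\<^sup>\<star>"
    and nrm_triangle_ineq [rule_format]: "\<forall>x\<in>\<A>. \<forall>y\<in>\<A>. \<parallel>x \<oplus> y\<parallel> \<le> \<parallel>x\<parallel> + \<parallel>y\<parallel>"
    and nrm_smult [rule_format]: "\<forall>c. \<forall>x\<in>\<A>. \<parallel>c \<odot> x\<parallel> = cmod c * \<parallel>x\<parallel>"
    and nrm_mult_ineq [rule_format]: "\<forall>x\<in>\<A>. \<forall>y\<in>\<A>. \<parallel>x \<otimes> y\<parallel> \<le> \<parallel>x\<parallel> * \<parallel>y\<parallel>"
    and nrm_star_mult [rule_format]: "\<forall>x\<in>\<A>. \<parallel>x\<^sup>\<star> \<otimes> x\<parallel> = \<parallel>x\<parallel>\<^sup>2"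
  using is_cstar unfolding is_cstar_def Let_def by - (elim conjE, assumption)+

lemma
  shows add_closed [simp]: "x \<in> \<A> \<Longrightarrow> y \<in> \<A> \<Longrightarrow> x \<oplus> y \<in> \<A>"
    and mult_closed [simp]: "x \<in> \<A> \<Longrightarrow> y \<in> \<A> \<Longrightarrow> x \<otimes> y \<in> \<A>"
    and mult_smult_left: "x \<in> \<A> \<Longrightarrow> y \<in> \<A> \<Longrightarrow> (c \<odot> x) \<otimes> y = c \<odot> (x \<otimes> y)"
    and mult_smult_right: "x \<in> \<A> \<Longrightarrow> y \<in> \<A> \<Longrightarrow> x \<otimes> (c \<odot> y) = c \<odot> (x \<otimes> y)"
    and nrm_nonneg [simp]: "x \<in> \<A> \<Longrightarrow> 0 \<le> \<parallel>x\<parallel>"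
    and nrm_eq_0_iff: "x \<in> \<A> \<Longrightarrow> \<parallel>x\<parallel> = 0 \<longleftrightarrow> x = \<zero>"
  using is_cstar unfolding is_cstar_def Let_def by - (elim conjE, metis)+

lemma complete:
  assumes "\<And>k. X k \<in> \<A>" "\<And>\<epsilon>. 0 < \<epsilon> \<Longrightarrow> \<exists>N. \<forall>i\<ge>N. \<forall>j\<ge>N. \<parallel>X i \<ominus> X j\<parallel> < \<epsilon>"
  shows "\<exists>l\<in>\<A>. (\<lambda>k. \<parallel>X k \<ominus> l\<parallel>) \<longlonglongrightarrow> 0"
  using is_cstar assms unfolding is_cstar_def Let_def by blast

lemma add_left_commute: "\<lbrakk>x \<in> \<A>; y \<in> \<A>; z \<in> \<A>\<rbrakk> \<Longrightarrow> x \<oplus> (y \<oplus> z) = y \<oplus> (x \<oplus> z)"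
  by (metis add_assoc add_commute)

lemmas add_ac = add_assoc add_commute add_left_commute

lemma minus_closed [simp]: "\<lbrakk>x \<in> \<A>; y \<in> \<A>\<rbrakk> \<Longrightarrow> x \<ominus> y \<in> \<A>"
  by (simp add: cs_minus_def)

lemma minus_self [simp]: "x \<in> \<A> \<Longrightarrow> x \<ominus> x = \<zero>"
  by (simp add: cs_minus_def add_smult_minus_one)

lemma smult_0_left [simp]: "x \<in> \<A> \<Longrightarrow> 0 \<odot> x = \<zero>"
  using smult_add_left[of x 1 "-1"] by (simp add: add_smult_minus_one)

lemma smult_zero [simp]: "c \<odot> \<zero> = \<zero>"
  using smult_smult[of \<zero> c 0] by simp

lemma add_zero [simp]: "x \<in> \<A> \<Longrightarrow> x \<oplus> \<zero> = x"
  by (subst add_commute) simp_all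

lemma minus_zero [simp]: "x \<in> \<A> \<Longrightarrow> x \<ominus> \<zero> = x"
  by (simp add: cs_minus_def)

lemma mult_zero_right [simp]: "x \<in> \<A> \<Longrightarrow> x \<otimes> \<zero> = \<zero>"
  using mult_smult_right[of x \<zero> 0] by simp

lemma mult_zero_left [simp]: "x \<in> \<A> \<Longrightarrow> \<zero> \<otimes> x = \<zero>"
  using mult_smult_left[of \<zero> x 0] by simp

lemma star_zero [simp]: "\<zero>\<^sup>\<star> = \<zero>"
  using star_smult[of \<zero> 0] by simp

lemma nrm_zero [simp]: "\<parallel>\<zero>\<parallel> = 0"
  by (simp add: nrm_eq_0_iff)

lemma minus_add_minus_cancel:
  assumes "x \<in> \<A>" "y \<in> \<A>" "z \<in> \<A>"
  shows "(x \<ominus> y) \<oplus> (y \<ominus> z) = x \<ominus> z"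
proof -
  have "(x \<ominus> y) \<oplus> (y \<ominus> z) = (x \<ominus> z) \<oplus> (y \<oplus> (-1) \<odot> y)"
    using assms by (simp add: cs_minus_def add_ac)
  then show ?thesis using assms by (simp add: add_smult_minus_one)
qed

lemma minus_eq_zero_iff: "\<lbrakk>x \<in> \<A>; y \<in> \<A>\<rbrakk> \<Longrightarrow> x \<ominus> y = \<zero> \<longleftrightarrow> x = y"
  using minus_add_minus_cancel[of x y \<zero>] by auto

lemma mult_minus_right: "\<lbrakk>x \<in> \<A>; y \<in> \<A>; z \<in> \<A>\<rbrakk> \<Longrightarrow> x \<otimes> (y \<ominus> z) = x \<otimes> y \<ominus> x \<otimes> z"
  by (simp add: cs_minus_def mult_add_right mult_smult_right)

lemma mult_minus_left: "\<lbrakk>x \<in> \<A>; y \<in> \<A>; z \<in> \<A>\<rbrakk> \<Longrightarrow> (x \<ominus> y) \<otimes> z = x \<otimes> z \<ominus> y \<otimes> z"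
  by (simp add: cs_minus_def mult_add_left mult_smult_left)

lemma smult_minus_right: "\<lbrakk>x \<in> \<A>; y \<in> \<A>\<rbrakk> \<Longrightarrow> c \<odot> (x \<ominus> y) = c \<odot> x \<ominus> c \<odot> y"
  by (simp add: cs_minus_def smult_add_right smult_smult mult.commute)

lemma smult_minus_left: "x \<in> \<A> \<Longrightarrow> (c - d) \<odot> x = c \<odot> x \<ominus> d \<odot> x"
  using smult_add_left[of x c "- d"] by (simp add: cs_minus_def smult_smult)

lemma star_minus: "\<lbrakk>x \<in> \<A>; y \<in> \<A>\<rbrakk> \<Longrightarrow> (x \<ominus> y)\<^sup>\<star> = x\<^sup>\<star> \<ominus> y\<^sup>\<star>"
  by (simp add: cs_minus_def star_add star_smult)

lemma nrm_minus_commute: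
  assumes "x \<in> \<A>" "y \<in> \<A>"
  shows "\<parallel>x \<ominus> y\<parallel> = \<parallel>y \<ominus> x\<parallel>"
proof -
  have "x \<ominus> y = (-1) \<odot> (y \<ominus> x)"
    using assms by (simp add: cs_minus_def smult_add_right smult_smult add_commute)
  then show ?thesis using assms by (simp add: nrm_smult)
qed

lemma nrm_minus_triangle: "\<lbrakk>x \<in> \<A>; y \<in> \<A>; z \<in> \<A>\<rbrakk> \<Longrightarrow> \<parallel>x \<ominus> z\<parallel> \<le> \<parallel>x \<ominus> y\<parallel> + \<parallel>y \<ominus> z\<parallel>"
  using nrm_triangle_ineq[of "x \<ominus> y" "y \<ominus> z"] by (simp add: minus_add_minus_cancel)

lemma nrm_le_nrm_minus_add: "\<lbrakk>x \<in> \<A>; y \<in> \<A>\<rbrakk> \<Longrightarrow> \<parallel>x\<parallel> \<le> \<parallel>x \<ominus> y\<parallel> + \<parallel>y\<parallel>"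
  using nrm_minus_triangle[of x y \<zero>] by simp

lemma nrm_star [simp]:
  assumes "x \<in> \<A>"
  shows "\<parallel>x\<^sup>\<star>\<parallel> = \<parallel>x\<parallel>"
proof -
  have le: "\<parallel>x\<parallel> \<le> \<parallel>x\<^sup>\<star>\<parallel>" if "x \<in> \<A>" for x
  proof (cases "\<parallel>x\<parallel> = 0")
    case False
    moreover have "\<parallel>x\<parallel> * \<parallel>x\<parallel> \<le> \<parallel>x\<^sup>\<star>\<parallel> * \<parallel>x\<parallel>"
      using nrm_star_mult[OF that] nrm_mult_ineq[of "x\<^sup>\<star>" x] that by (simp add: power2_eq_square)
    ultimately show ?thesis using nrm_nonneg[OF that] by (simp add: mult_le_cancel_right)
  qed (simp add: that)
  show ?thesis using le[of x] le[of "x\<^sup>\<star>"] assms by simp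
qed

lemma eq_zero_if_mult_left:
  assumes "x \<in> \<A>" "\<And>y. y \<in> \<A> \<Longrightarrow> y \<otimes> x = \<zero>"
  shows "x = \<zero>"
  using nrm_star_mult[of x] assms nrm_eq_0_iff[of x] by simp

subsection \<open>Convergence\<close>

definition converges :: "(nat \<Rightarrow> 'a) \<Rightarrow> 'a \<Rightarrow> bool" where
  "converges X l \<longleftrightarrow> (\<forall>k. X k \<in> \<A>) \<and> l \<in> \<A> \<and> (\<lambda>k. \<parallel>X k \<ominus> l\<parallel>) \<longlonglongrightarrow> 0"

lemma convergesD:
  assumes "converges X l"
  shows "X k \<in> \<A>" "l \<in> \<A>" "(\<lambda>k. \<parallel>X k \<ominus> l\<parallel>) \<longlonglongrightarrow> 0"
  using assms by (simp_all add: converges_def)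

lemma converges_comparison:
  assumes "\<And>k. X k \<in> \<A>" "l \<in> \<A>" "\<And>k. \<parallel>X k \<ominus> l\<parallel> \<le> g k" "g \<longlonglongrightarrow> 0"
  shows "converges X l"
  unfolding converges_def
proof (intro conjI allI assms(1,2))
  show "(\<lambda>k. \<parallel>X k \<ominus> l\<parallel>) \<longlonglongrightarrow> 0"
    by (rule tendsto_sandwich[OF _ _ tendsto_const assms(4)]) (simp_all add: assms(1-3))
qed

lemma converges_const: "x \<in> \<A> \<Longrightarrow> converges (\<lambda>k. x) x"
  by (simp add: converges_def)

lemma converges_nrm_le:
  assumes X: "converges X l" and le: "\<And>k. \<parallel>X k\<parallel> \<le> c"
  shows "\<parallel>l\<parallel> \<le> c"
proof -
  have "(\<lambda>k. \<parallel>X k \<ominus> l\<parallel> + c) \<longlonglongrightarrow> 0 + c" by (intro tendsto_intros convergesD(3)[OF X])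
  moreover have "\<parallel>l\<parallel> \<le> \<parallel>X k \<ominus> l\<parallel> + c" for k
    using nrm_le_nrm_minus_add[of l "X k"] convergesD(1,2)[OF X] le[of k] nrm_minus_commute[of l "X k"]
    by fastforce
  ultimately show ?thesis using LIMSEQ_le_const by fastforce
qed

lemma converges_add:
  assumes X: "converges X l" and Y: "converges Y l'"
  shows "converges (\<lambda>k. X k \<oplus> Y k) (l \<oplus> l')"
proof (rule converges_comparison)
  note [simp] = convergesD(1,2)[OF X] convergesD(1,2)[OF Y]
  show "X k \<oplus> Y k \<in> \<A>" "l \<oplus> l' \<in> \<A>" for k by simp_all
  have "X k \<oplus> Y k \<ominus> (l \<oplus> l') = (X k \<ominus> l) \<oplus> (Y k \<ominus> l')" for k
    by (simp add: cs_minus_def smult_add_right add_ac)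
  then show "\<parallel>X k \<oplus> Y k \<ominus> (l \<oplus> l')\<parallel> \<le> \<parallel>X k \<ominus> l\<parallel> + \<parallel>Y k \<ominus> l'\<parallel>" for k
    by (simp add: nrm_triangle_ineq)
  show "(\<lambda>k. \<parallel>X k \<ominus> l\<parallel> + \<parallel>Y k \<ominus> l'\<parallel>) \<longlonglongrightarrow> 0"
    using X Y by (intro tendsto_add_zero convergesD(3))
qed

lemma converges_mult:
  assumes X: "converges X l" and Y: "converges Y l'"
  shows "converges (\<lambda>k. X k \<otimes> Y k) (l \<otimes> l')"
proof (rule converges_comparison)
  note [simp] = convergesD(1,2)[OF X] convergesD(1,2)[OF Y]
  show "X k \<otimes> Y k \<in> \<A>" "l \<otimes> l' \<in> \<A>" for k by simp_all
  let ?dx = "\<lambda>k. \<parallel>X k \<ominus> l\<parallel>" and ?dy = "\<lambda>k. \<parallel>Y k \<ominus> l'\<parallel>"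
  show "\<parallel>X k \<otimes> Y k \<ominus> l \<otimes> l'\<parallel> \<le> ?dx k * (?dy k + \<parallel>l'\<parallel>) + \<parallel>l\<parallel> * ?dy k" for k
  proof -
    have "\<parallel>X k \<otimes> Y k \<ominus> l \<otimes> l'\<parallel> \<le> \<parallel>X k \<otimes> Y k \<ominus> l \<otimes> Y k\<parallel> + \<parallel>l \<otimes> Y k \<ominus> l \<otimes> l'\<parallel>"
      by (rule nrm_minus_triangle) simp_all
    also have "\<parallel>X k \<otimes> Y k \<ominus> l \<otimes> Y k\<parallel> \<le> ?dx k * \<parallel>Y k\<parallel>"
      using nrm_mult_ineq[of "X k \<ominus> l" "Y k"] by (simp add: mult_minus_left)
    also have "\<dots> \<le> ?dx k * (?dy k + \<parallel>l'\<parallel>)"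
      by (intro mult_left_mono nrm_le_nrm_minus_add) simp_all
    also have "\<parallel>l \<otimes> Y k \<ominus> l \<otimes> l'\<parallel> \<le> \<parallel>l\<parallel> * ?dy k"
      using nrm_mult_ineq[of l "Y k \<ominus> l'"] by (simp add: mult_minus_right)
    finally show ?thesis by simp
  qed
  have "(\<lambda>k. ?dx k * (?dy k + \<parallel>l'\<parallel>) + \<parallel>l\<parallel> * ?dy k) \<longlonglongrightarrow> 0 * (0 + \<parallel>l'\<parallel>) + \<parallel>l\<parallel> * 0"
    by (intro tendsto_intros convergesD(3)[OF X] convergesD(3)[OF Y])
  then show "(\<lambda>k. ?dx k * (?dy k + \<parallel>l'\<parallel>) + \<parallel>l\<parallel> * ?dy k) \<longlonglongrightarrow> 0" by simp
qed

lemma converges_smult: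
  assumes c: "c \<longlonglongrightarrow> d" and X: "converges X l"
  shows "converges (\<lambda>k. c k \<odot> X k) (d \<odot> l)"
proof (rule converges_comparison)
  note [simp] = convergesD(1,2)[OF X]
  show "c k \<odot> X k \<in> \<A>" "d \<odot> l \<in> \<A>" for k by simp_all
  show "\<parallel>c k \<odot> X k \<ominus> d \<odot> l\<parallel> \<le> cmod (c k) * \<parallel>X k \<ominus> l\<parallel> + cmod (c k - d) * \<parallel>l\<parallel>" for k
    using nrm_minus_triangle[of "c k \<odot> X k" "c k \<odot> l" "d \<odot> l"]
    by (simp add: nrm_smult flip: smult_minus_right smult_minus_left)
  have "(\<lambda>k. cmod (c k) * \<parallel>X k \<ominus> l\<parallel> + cmod (c k - d) * \<parallel>l\<parallel>) \<longlonglongrightarrow> cmod d * 0 + cmod (d - d) * \<parallel>l\<parallel>"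
    by (intro tendsto_intros c convergesD(3)[OF X])
  then show "(\<lambda>k. cmod (c k) * \<parallel>X k \<ominus> l\<parallel> + cmod (c k - d) * \<parallel>l\<parallel>) \<longlonglongrightarrow> 0" by simp
qed

lemma converges_star:
  assumes "converges X l"
  shows "converges (\<lambda>k. (X k)\<^sup>\<star>) l\<^sup>\<star>"
  using assms by (simp add: converges_def flip: star_minus)

lemma converges_unique:
  assumes X: "converges X l" "converges X l'"
  shows "l = l'"
proof -
  note [simp] = convergesD(1,2)[OF X(1)] convergesD(2)[OF X(2)]
  have "converges (\<lambda>k. X k \<oplus> (-1) \<odot> X k) (l \<oplus> (-1) \<odot> l')"
    by (intro converges_add converges_smult tendsto_const X)
  then have "converges (\<lambda>k. \<zero>) (l \<ominus> l')" by (simp add: add_smult_minus_one cs_minus_def)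
  then have "\<parallel>l \<ominus> l'\<parallel> \<le> 0" by (rule converges_nrm_le) simp
  then have "\<parallel>l \<ominus> l'\<parallel> = 0" by (intro antisym nrm_nonneg) simp_all
  then show ?thesis by (simp add: nrm_eq_0_iff minus_eq_zero_iff)
qed

end

subsection \<open>Separable subalgebras\<close>

inductive_set op_closure :: "('a \<Rightarrow> 'a \<Rightarrow> 'a) set \<Rightarrow> 'a set \<Rightarrow> 'a set" for F D where
  base: "x \<in> D \<Longrightarrow> x \<in> op_closure F D"
| op: "f \<in> F \<Longrightarrow> x \<in> op_closure F D \<Longrightarrow> y \<in> op_closure F D \<Longrightarrow> f x y \<in> op_closure F D"

lemma countable_op_closure:
  assumes "countable F" "countable D"
  shows "countable (op_closure F D)"
proof -
  define step where "step G = G \<union> (\<lambda>(f, x, y). f x y) ` (F \<times> G \<times> G)" for G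
  define G where "G i = (step ^^ i) D" for i
  have G_Suc: "G (Suc i) = step (G i)" for i by (simp add: G_def)
  have "countable (G i)" for i
    by (induction i) (auto simp: G_def step_def assms)
  then have "countable (\<Union>i. G i)" by simp
  moreover have mono: "G i \<subseteq> G j" if "i \<le> j" for i j
    using that by (rule lift_Suc_mono_le[rotated]) (auto simp: G_Suc step_def)
  have "op_closure F D \<subseteq> (\<Union>i. G i)"
  proof
    fix z assume "z \<in> op_closure F D"
    then show "z \<in> (\<Union>i. G i)"
    proof induction
      case (base x)
      then have "x \<in> G 0" by (simp add: G_def)
      then show ?case by blast
    next
      case (op f x y)
      then obtain i j where "x \<in> G i" "y \<in> G j" by blast
      then have "x \<in> G (max i j)" "y \<in> G (max i j)"
        using mono[of i "max i j"] mono[of j "max i j"] by auto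
      then have "f x y \<in> G (Suc (max i j))" using op.hyps(1) by (force simp: G_Suc step_def)
      then show ?case by blast
    qed
  qed
  ultimately show ?thesis using countable_subset by blast
qed

context cstar_algebra
begin

definition norm_closure :: "'a set \<Rightarrow> 'a set" where
  "norm_closure D = {x \<in> \<A>. \<forall>\<epsilon>>0. \<exists>d\<in>D. \<parallel>x \<ominus> d\<parallel> < \<epsilon>}"

lemma norm_closure_approx: "x \<in> norm_closure D \<Longrightarrow> 0 < \<epsilon> \<Longrightarrow> \<exists>d\<in>D. \<parallel>x \<ominus> d\<parallel> < \<epsilon>"
  by (simp add: norm_closure_def)

lemma subset_norm_closure: "D \<subseteq> \<A> \<Longrightarrow> D \<subseteq> norm_closure D"
  by (auto simp: norm_closure_def intro!: bexI)

lemma norm_closure_sequenceE: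
  assumes "x \<in> norm_closure D" "D \<subseteq> \<A>"
  obtains X where "\<And>k. X k \<in> D" "converges X x"
proof -
  have "\<exists>d\<in>D. \<parallel>x \<ominus> d\<parallel> < inverse (real (Suc k))" for k
    by (rule norm_closure_approx[OF assms(1)]) simp
  then obtain X where X: "\<And>k. X k \<in> D" "\<And>k. \<parallel>x \<ominus> X k\<parallel> < inverse (real (Suc k))" by metis
  have "converges X x"
  proof (rule converges_comparison[OF _ _ _ LIMSEQ_inverse_real_of_nat])
    show mem: "X k \<in> \<A>" "x \<in> \<A>" for k using X(1) assms by (auto simp: norm_closure_def)
    show "\<parallel>X k \<ominus> x\<parallel> \<le> inverse (real (Suc k))" for k
      using X(2)[of k] nrm_minus_commute[OF mem, of k] by simp
  qed
  with X(1) show ?thesis by (rule that)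
qed

lemma converges_in_norm_closure:
  assumes X: "converges X l" and D: "\<And>k. X k \<in> norm_closure D" "D \<subseteq> \<A>"
  shows "l \<in> norm_closure D"
  unfolding norm_closure_def
proof (intro CollectI conjI allI impI)
  show "l \<in> \<A>" by (rule convergesD(2)[OF X])
  fix \<epsilon> :: real assume "0 < \<epsilon>"
  then have "\<forall>\<^sub>F k in sequentially. \<parallel>X k \<ominus> l\<parallel> < \<epsilon>/2"
    using convergesD(3)[OF X] by (intro order_tendstoD(2)) auto
  then obtain k where k: "\<parallel>X k \<ominus> l\<parallel> < \<epsilon>/2" by (auto simp: eventually_sequentially)
  obtain d where d: "d \<in> D" "\<parallel>X k \<ominus> d\<parallel> < \<epsilon>/2"
    using norm_closure_approx[OF D(1), of "\<epsilon>/2"] \<open>0 < \<epsilon>\<close> by auto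
  have "\<parallel>l \<ominus> d\<parallel> \<le> \<parallel>X k \<ominus> l\<parallel> + \<parallel>X k \<ominus> d\<parallel>"
    using nrm_minus_triangle[of l "X k" d] convergesD(1,2)[OF X] d(1) D(2) nrm_minus_commute[of l "X k"]
    by (metis subsetD)
  with k d show "\<exists>d\<in>D. \<parallel>l \<ominus> d\<parallel> < \<epsilon>" by force
qed

lemma separable_subalg_norm_closure:
  assumes "countable D" "D \<subseteq> \<A>" "\<zero> \<in> D" and Q: "closure Q = UNIV"
    and closed: "\<And>x y. x \<in> D \<Longrightarrow> y \<in> D \<Longrightarrow> x \<oplus> y \<in> D" "\<And>x y. x \<in> D \<Longrightarrow> y \<in> D \<Longrightarrow> x \<otimes> y \<in> D"
      "\<And>x. x \<in> D \<Longrightarrow> x\<^sup>\<star> \<in> D" "\<And>c x. c \<in> Q \<Longrightarrow> x \<in> D \<Longrightarrow> c \<odot> x \<in> D"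
  shows "separable_subalg A (norm_closure D)"
proof -
  let ?B = "norm_closure D"
  have D_B: "D \<subseteq> ?B" by (rule subset_norm_closure[OF assms(2)])
  have limit: "l \<in> ?B" if "converges X l" "\<And>k. X k \<in> D" for X l
    using that D_B by (auto intro: converges_in_norm_closure[OF that(1) _ assms(2)])
  show ?thesis
    unfolding separable_subalg_def
  proof (intro conjI ballI allI impI)
    show "?B \<subseteq> \<A>" by (auto simp: norm_closure_def)
    show "\<zero> \<in> ?B" using assms(3) D_B by blast
    show "l \<in> ?B" if "(\<forall>k. X k \<in> ?B) \<and> l \<in> \<A> \<and> (\<lambda>k. \<parallel>X k \<ominus> l\<parallel>) \<longlonglongrightarrow> 0" for X l
      by (rule converges_in_norm_closure[of X, OF _ _ assms(2)])
        (use that \<open>?B \<subseteq> \<A>\<close> in \<open>auto simp: converges_def\<close>)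
    show "\<exists>E. countable E \<and> E \<subseteq> ?B \<and> (\<forall>b\<in>?B. \<forall>\<epsilon>>0. \<exists>d\<in>E. \<parallel>b \<ominus> d\<parallel> < \<epsilon>)"
      by (intro exI[of _ D] conjI ballI allI impI assms(1) D_B norm_closure_approx)
    fix x assume "x \<in> ?B"
    then obtain X where X: "\<And>k. X k \<in> D" "converges X x"
      using norm_closure_sequenceE[OF _ assms(2)] by metis
    show "x\<^sup>\<star> \<in> ?B" by (rule limit[OF converges_star[OF X(2)]]) (intro closed X(1))
    show "c \<odot> x \<in> ?B" for c
    proof -
      obtain r where r: "\<And>k. r k \<in> Q" "r \<longlonglongrightarrow> c"
        using closure_sequential[of c Q] Q by auto
      show ?thesis by (rule limit[OF converges_smult[OF r(2) X(2)]]) (intro closed r(1) X(1))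
    qed
    fix y assume "y \<in> ?B"
    then obtain Y where Y: "\<And>k. Y k \<in> D" "converges Y y"
      using norm_closure_sequenceE[OF _ assms(2)] by metis
    show "x \<oplus> y \<in> ?B" by (rule limit[OF converges_add[OF X(2) Y(2)]]) (intro closed X(1) Y(1))
    show "x \<otimes> y \<in> ?B" by (rule limit[OF converges_mult[OF X(2) Y(2)]]) (intro closed X(1) Y(1))
  qed
qed

lemma separable_subalg_exists:
  assumes "countable D" "D \<subseteq> \<A>"
  obtains B where "separable_subalg A B" "D \<subseteq> B"
proof -
  obtain Q :: "complex set" where "countable Q"
    and dense: "\<And>X. open X \<Longrightarrow> X \<noteq> {} \<Longrightarrow> \<exists>c\<in>Q. c \<in> X"
    using countable_dense_setE by metis
  have "closure Q = UNIV"
    using dense[of "- closure Q"] closure_subset[of Q] by auto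
  define F where "F = {cs_add A, cs_mult A, \<lambda>x y. x\<^sup>\<star>} \<union> (\<lambda>c x y. c \<odot> x) ` Q"
  define E where "E = op_closure F (insert \<zero> D)"
  have E_closed: "f x y \<in> E" if "f \<in> F" "x \<in> E" "y \<in> E" for f x y
    using that unfolding E_def by (rule op_closure.op)
  have "x \<in> \<A>" if "x \<in> E" for x
    using that unfolding E_def by induction (use assms(2) in \<open>auto simp: F_def\<close>)
  then have "E \<subseteq> \<A>" by blast
  have "D \<subseteq> E" "\<zero> \<in> E" unfolding E_def by (auto intro: op_closure.base)
  have "separable_subalg A (norm_closure E)"
  proof (rule separable_subalg_norm_closure[OF _ \<open>E \<subseteq> \<A>\<close> \<open>\<zero> \<in> E\<close> \<open>closure Q = UNIV\<close>])
    show "countable E"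
      using assms(1) \<open>countable Q\<close> by (auto simp: E_def F_def intro!: countable_op_closure)
    fix x assume x: "x \<in> E"
    show "x \<oplus> y \<in> E" "x \<otimes> y \<in> E" if "y \<in> E" for y
      using E_closed[of "cs_add A"] E_closed[of "cs_mult A"] x that by (simp_all add: F_def)
    show "x\<^sup>\<star> \<in> E" using E_closed[of "\<lambda>x y. x\<^sup>\<star>" x x] x by (simp add: F_def)
    show "c \<odot> x \<in> E" if "c \<in> Q" for c
      using E_closed[of "\<lambda>x y. c \<odot> x" x x] x that by (simp add: F_def)
  qed
  moreover have "D \<subseteq> norm_closure E" using \<open>D \<subseteq> E\<close> subset_norm_closure[OF \<open>E \<subseteq> \<A>\<close>] by blast
  ultimately show ?thesis by (rule that)
qed

end

section \<open>The multiplier algebra\<close>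

lemma double_sequence_small_if_scaled_le:
  fixes c d :: "nat \<Rightarrow> nat \<Rightarrow> real"
  assumes c: "\<And>\<epsilon>. 0 < \<epsilon> \<Longrightarrow> \<exists>N. \<forall>i\<ge>N. \<forall>j\<ge>N. c i j < \<epsilon>"
    and d: "\<And>i j. d i j \<le> c i j * r" and "0 \<le> r" "0 < \<epsilon>"
  shows "\<exists>N. \<forall>i\<ge>N. \<forall>j\<ge>N. d i j < \<epsilon>"
proof -
  obtain N where N: "\<forall>i\<ge>N. \<forall>j\<ge>N. c i j < \<epsilon> / (1 + r)"
    using c[of "\<epsilon> / (1 + r)"] \<open>0 \<le> r\<close> \<open>0 < \<epsilon>\<close> by auto
  have "d i j < \<epsilon>" if "N \<le> i" "N \<le> j" for i j
  proof -
    have "d i j \<le> \<epsilon> / (1 + r) * r"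
      using d[of i j] N that \<open>0 \<le> r\<close> by (meson less_imp_le mult_right_mono order_trans)
    also have "\<dots> < \<epsilon>" using \<open>0 \<le> r\<close> \<open>0 < \<epsilon>\<close> by (simp add: field_simps)
    finally show ?thesis .
  qed
  then show ?thesis by blast
qed

context cstar_algebra
begin

abbreviation mult_alg_A ("M") where "M \<equiv> mult_alg A"
abbreviation carrier_M ("\<M>") where "\<M> \<equiv> cs_carrier M"
abbreviation nrm_M ("\<parallel>_\<parallel>\<^sub>M") where "\<parallel>m\<parallel>\<^sub>M \<equiv> cs_nrm M m"
abbreviation emb ("\<iota>") where "\<iota> \<equiv> mult_emb A"

definition multiplier_one :: "'a mult" where
  "multiplier_one = (restrict (\<lambda>x. x) \<A>, restrict (\<lambda>x. x) \<A>)"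

lemma multiplier_apply [simp]:
  assumes "x \<in> \<A>"
  shows "fst (cs_zero M) x = \<zero>" "snd (cs_zero M) x = \<zero>"
    "fst (cs_add M m1 m2) x = fst m1 x \<oplus> fst m2 x" "snd (cs_add M m1 m2) x = snd m1 x \<oplus> snd m2 x"
    "fst (cs_smult M c m1) x = c \<odot> fst m1 x" "snd (cs_smult M c m1) x = c \<odot> snd m1 x"
    "fst (cs_mult M m1 m2) x = fst m1 (fst m2 x)" "snd (cs_mult M m1 m2) x = snd m2 (snd m1 x)"
    "fst (cs_star M m1) x = (snd m1 x\<^sup>\<star>)\<^sup>\<star>" "snd (cs_star M m1) x = (fst m1 x\<^sup>\<star>)\<^sup>\<star>"
    "fst multiplier_one x = x" "snd multiplier_one x = x"
    "fst (\<iota> a) x = a \<otimes> x" "snd (\<iota> a) x = x \<otimes> a"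
  using assms by (simp_all add: mult_alg_def Let_def multiplier_one_def mult_emb_def)

lemma multiplier_extensional [simp]:
  "fst (cs_zero M) \<in> extensional \<A>" "snd (cs_zero M) \<in> extensional \<A>"
  "fst (cs_add M m1 m2) \<in> extensional \<A>" "snd (cs_add M m1 m2) \<in> extensional \<A>"
  "fst (cs_smult M c m1) \<in> extensional \<A>" "snd (cs_smult M c m1) \<in> extensional \<A>"
  "fst (cs_mult M m1 m2) \<in> extensional \<A>" "snd (cs_mult M m1 m2) \<in> extensional \<A>"
  "fst (cs_star M m1) \<in> extensional \<A>" "snd (cs_star M m1) \<in> extensional \<A>"
  "fst multiplier_one \<in> extensional \<A>" "snd multiplier_one \<in> extensional \<A>"
  "fst (\<iota> a) \<in> extensional \<A>" "snd (\<iota> a) \<in> extensional \<A>"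
  by (simp_all add: mult_alg_def Let_def multiplier_one_def mult_emb_def)

lemma multiplier_minus_apply [simp]:
  assumes "x \<in> \<A>"
  shows "fst (cs_minus M m1 m2) x = fst m1 x \<ominus> fst m2 x" "snd (cs_minus M m1 m2) x = snd m1 x \<ominus> snd m2 x"
  using assms by (simp_all add: cs_minus_def)

subsection \<open>Bounded linear maps\<close>

lemma bdd_linear_onI:
  assumes "T \<in> extensional \<A>" "\<And>x. x \<in> \<A> \<Longrightarrow> T x \<in> \<A>"
    "\<And>x y. x \<in> \<A> \<Longrightarrow> y \<in> \<A> \<Longrightarrow> T (x \<oplus> y) = T x \<oplus> T y"
    "\<And>c x. x \<in> \<A> \<Longrightarrow> T (c \<odot> x) = c \<odot> T x" "\<And>x. x \<in> \<A> \<Longrightarrow> \<parallel>T x\<parallel> \<le> K * \<parallel>x\<parallel>"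
  shows "bdd_linear_on A T"
  unfolding bdd_linear_on_def using assms by blast

lemma bdd_linear_onD:
  assumes "bdd_linear_on A T"
  shows "T \<in> extensional \<A>" "x \<in> \<A> \<Longrightarrow> T x \<in> \<A>"
    "x \<in> \<A> \<Longrightarrow> y \<in> \<A> \<Longrightarrow> T (x \<oplus> y) = T x \<oplus> T y" "x \<in> \<A> \<Longrightarrow> T (c \<odot> x) = c \<odot> T x"
  using assms by (auto simp: bdd_linear_on_def)

lemma bdd_linear_on_bound:
  assumes "bdd_linear_on A T"
  obtains K where "0 \<le> K" "\<And>x. x \<in> \<A> \<Longrightarrow> \<parallel>T x\<parallel> \<le> K * \<parallel>x\<parallel>"
proof -
  obtain K where K: "\<And>x. x \<in> \<A> \<Longrightarrow> \<parallel>T x\<parallel> \<le> K * \<parallel>x\<parallel>"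
    using assms unfolding bdd_linear_on_def by blast
  have "\<parallel>T x\<parallel> \<le> max K 0 * \<parallel>x\<parallel>" if "x \<in> \<A>" for x
    using K[OF that] mult_right_mono[of K "max K 0" "\<parallel>x\<parallel>"] that by simp
  then show ?thesis by (intro that[of "max K 0"]) auto
qed

lemma bdd_linear_on_zero:
  assumes "R \<in> extensional \<A>" "\<And>x. x \<in> \<A> \<Longrightarrow> R x = \<zero>"
  shows "bdd_linear_on A R"
  using assms by (intro bdd_linear_onI[where K = 0]) simp_all

lemma bdd_linear_on_add:
  assumes S: "bdd_linear_on A S" and T: "bdd_linear_on A T"
    and R: "R \<in> extensional \<A>" "\<And>x. x \<in> \<A> \<Longrightarrow> R x = S x \<oplus> T x"
  shows "bdd_linear_on A R"
proof -
  obtain K L where K: "\<And>x. x \<in> \<A> \<Longrightarrow> \<parallel>S x\<parallel> \<le> K * \<parallel>x\<parallel>" and L: "\<And>x. x \<in> \<A> \<Longrightarrow> \<parallel>T x\<parallel> \<le> L * \<parallel>x\<parallel>"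
    using bdd_linear_on_bound S T by metis
  show ?thesis
  proof (rule bdd_linear_onI[where K = "K + L"])
    fix x assume x: "x \<in> \<A>"
    then show "\<parallel>R x\<parallel> \<le> (K + L) * \<parallel>x\<parallel>"
      using nrm_triangle_ineq[of "S x" "T x"] K[OF x] L[OF x]
      by (simp add: R(2) bdd_linear_onD(2)[OF S] bdd_linear_onD(2)[OF T] distrib_right)
  qed (simp_all add: R bdd_linear_onD[OF S] bdd_linear_onD[OF T] smult_add_right add_ac)
qed

lemma bdd_linear_on_smult:
  assumes S: "bdd_linear_on A S" and R: "R \<in> extensional \<A>" "\<And>x. x \<in> \<A> \<Longrightarrow> R x = c \<odot> S x"
  shows "bdd_linear_on A R"
proof -
  obtain K where K: "\<And>x. x \<in> \<A> \<Longrightarrow> \<parallel>S x\<parallel> \<le> K * \<parallel>x\<parallel>" using bdd_linear_on_bound[OF S] by metis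
  show ?thesis
  proof (rule bdd_linear_onI[where K = "cmod c * K"])
    fix x assume x: "x \<in> \<A>"
    then show "\<parallel>R x\<parallel> \<le> (cmod c * K) * \<parallel>x\<parallel>"
      using mult_left_mono[OF K[OF x], of "cmod c"]
      by (simp add: R(2) bdd_linear_onD(2)[OF S] nrm_smult mult.assoc)
  qed (simp_all add: R bdd_linear_onD[OF S] smult_add_right smult_smult mult.commute)
qed

lemma bdd_linear_on_comp:
  assumes S: "bdd_linear_on A S" and T: "bdd_linear_on A T"
    and R: "R \<in> extensional \<A>" "\<And>x. x \<in> \<A> \<Longrightarrow> R x = S (T x)"
  shows "bdd_linear_on A R"
proof -
  obtain K L where "0 \<le> K" and K: "\<And>x. x \<in> \<A> \<Longrightarrow> \<parallel>S x\<parallel> \<le> K * \<parallel>x\<parallel>"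
    and L: "\<And>x. x \<in> \<A> \<Longrightarrow> \<parallel>T x\<parallel> \<le> L * \<parallel>x\<parallel>"
    using bdd_linear_on_bound S T by metis
  show ?thesis
  proof (rule bdd_linear_onI[where K = "K * L"])
    fix x assume x: "x \<in> \<A>"
    then have "\<parallel>S (T x)\<parallel> \<le> K * \<parallel>T x\<parallel>" by (intro K bdd_linear_onD(2)[OF T])
    also have "\<dots> \<le> K * (L * \<parallel>x\<parallel>)" by (intro mult_left_mono L x \<open>0 \<le> K\<close>)
    finally show "\<parallel>R x\<parallel> \<le> (K * L) * \<parallel>x\<parallel>" using x by (simp add: R(2) mult.assoc)
  qed (simp_all add: R bdd_linear_onD[OF S] bdd_linear_onD[OF T])
qed

lemma bdd_linear_on_star:
  assumes S: "bdd_linear_on A S" and R: "R \<in> extensional \<A>" "\<And>x. x \<in> \<A> \<Longrightarrow> R x = (S x\<^sup>\<star>)\<^sup>\<star>"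
  shows "bdd_linear_on A R"
proof -
  obtain K where K: "\<And>x. x \<in> \<A> \<Longrightarrow> \<parallel>S x\<parallel> \<le> K * \<parallel>x\<parallel>" using bdd_linear_on_bound[OF S] by metis
  show ?thesis
  proof (rule bdd_linear_onI[where K = K])
    fix x assume "x \<in> \<A>"
    then show "\<parallel>R x\<parallel> \<le> K * \<parallel>x\<parallel>" using K[of "x\<^sup>\<star>"] by (simp add: R(2) bdd_linear_onD(2)[OF S])
  qed (simp_all add: R bdd_linear_onD[OF S] star_add star_smult)
qed

lemma bdd_linear_on_limit:
  assumes T: "\<And>k. bdd_linear_on A (T k)" "\<And>k x. x \<in> \<A> \<Longrightarrow> \<parallel>T k x\<parallel> \<le> K * \<parallel>x\<parallel>"
    and R: "R \<in> extensional \<A>" "\<And>x. x \<in> \<A> \<Longrightarrow> converges (\<lambda>k. T k x) (R x)"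
  shows "bdd_linear_on A R"
proof (rule bdd_linear_onI[OF R(1), where K = K])
  fix x assume x: "x \<in> \<A>"
  show "R x \<in> \<A>" by (rule convergesD(2)[OF R(2)[OF x]])
  show "R (x \<oplus> y) = R x \<oplus> R y" if y: "y \<in> \<A>" for y
    using converges_add[OF R(2)[OF x] R(2)[OF y]] R(2)[of "x \<oplus> y"] x y
    by (intro converges_unique[of "\<lambda>k. T k (x \<oplus> y)"]) (simp_all add: bdd_linear_onD(3)[OF T(1)])
  show "R (c \<odot> x) = c \<odot> R x" for c
    using converges_smult[OF tendsto_const R(2)[OF x]] R(2)[of "c \<odot> x"] x
    by (intro converges_unique[of "\<lambda>k. T k (c \<odot> x)"]) (simp_all add: bdd_linear_onD(4)[OF T(1)])
  show "\<parallel>R x\<parallel> \<le> K * \<parallel>x\<parallel>" by (rule converges_nrm_le[OF R(2)[OF x] T(2)[OF x]])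
qed

subsection \<open>Double centralizers\<close>

lemma multiplier_memI:
  assumes "bdd_linear_on A (fst m)" "bdd_linear_on A (snd m)"
    "\<And>x y. x \<in> \<A> \<Longrightarrow> y \<in> \<A> \<Longrightarrow> x \<otimes> fst m y = snd m x \<otimes> y"
  shows "m \<in> \<M>"
  using assms by (simp add: mult_alg_def Let_def double_centralizer_def)

lemma
  assumes "m \<in> \<M>"
  shows bdd_linear_fst: "bdd_linear_on A (fst m)"
    and bdd_linear_snd: "bdd_linear_on A (snd m)"
    and centralizer_eq: "x \<in> \<A> \<Longrightarrow> y \<in> \<A> \<Longrightarrow> x \<otimes> fst m y = snd m x \<otimes> y"
  using assms by (auto simp: mult_alg_def Let_def double_centralizer_def)

lemma multiplier_apply_closed [simp]:
  assumes "m \<in> \<M>" "x \<in> \<A>"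
  shows "fst m x \<in> \<A>" "snd m x \<in> \<A>"
  using bdd_linear_onD(2)[OF bdd_linear_fst[OF assms(1)]]
    bdd_linear_onD(2)[OF bdd_linear_snd[OF assms(1)]] assms(2) by auto

lemma multiplier_apply_add [simp]:
  assumes "m \<in> \<M>" "x \<in> \<A>" "y \<in> \<A>"
  shows "fst m (x \<oplus> y) = fst m x \<oplus> fst m y" "snd m (x \<oplus> y) = snd m x \<oplus> snd m y"
  using bdd_linear_onD(3)[OF bdd_linear_fst[OF assms(1)]]
    bdd_linear_onD(3)[OF bdd_linear_snd[OF assms(1)]] assms(2,3) by auto

lemma multiplier_apply_smult [simp]:
  assumes "m \<in> \<M>" "x \<in> \<A>"
  shows "fst m (c \<odot> x) = c \<odot> fst m x" "snd m (c \<odot> x) = c \<odot> snd m x"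
  using bdd_linear_onD(4)[OF bdd_linear_fst[OF assms(1)]]
    bdd_linear_onD(4)[OF bdd_linear_snd[OF assms(1)]] assms(2) by auto

lemma multiplier_apply_zero [simp]: "m \<in> \<M> \<Longrightarrow> fst m \<zero> = \<zero>"
  using multiplier_apply_smult(1)[of m \<zero> 0] by simp

lemma multiplier_eqI:
  assumes "m \<in> \<M>" "m' \<in> \<M>"
    "\<And>x. x \<in> \<A> \<Longrightarrow> fst m x = fst m' x" "\<And>x. x \<in> \<A> \<Longrightarrow> snd m x = snd m' x"
  shows "m = m'"
proof (rule prod_eqI)
  have ext: "fst n \<in> extensional \<A>" "snd n \<in> extensional \<A>" if "n \<in> \<M>" for n
    by (rule bdd_linear_onD(1)[OF bdd_linear_fst[OF that]] bdd_linear_onD(1)[OF bdd_linear_snd[OF that]])+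
  show "fst m = fst m'" by (rule extensionalityI[OF ext(1)[OF assms(1)] ext(1)[OF assms(2)] assms(3)])
  show "snd m = snd m'" by (rule extensionalityI[OF ext(2)[OF assms(1)] ext(2)[OF assms(2)] assms(4)])
qed

lemma multiplier_zero_closed [simp]: "cs_zero M \<in> \<M>"
  by (rule multiplier_memI) (simp_all add: bdd_linear_on_zero)

lemma multiplier_one_closed [simp]: "multiplier_one \<in> \<M>"
  by (rule multiplier_memI; (rule bdd_linear_onI[where K = 1])?) simp_all

lemma multiplier_add_closed [simp]:
  assumes "m1 \<in> \<M>" "m2 \<in> \<M>"
  shows "cs_add M m1 m2 \<in> \<M>"
proof (rule multiplier_memI)
  show "bdd_linear_on A (fst (cs_add M m1 m2))"
    by (rule bdd_linear_on_add[OF bdd_linear_fst[OF assms(1)] bdd_linear_fst[OF assms(2)]]) simp_all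
  show "bdd_linear_on A (snd (cs_add M m1 m2))"
    by (rule bdd_linear_on_add[OF bdd_linear_snd[OF assms(1)] bdd_linear_snd[OF assms(2)]]) simp_all
qed (simp add: assms centralizer_eq mult_add_right mult_add_left)

lemma multiplier_smult_closed [simp]:
  assumes "m \<in> \<M>"
  shows "cs_smult M c m \<in> \<M>"
proof (rule multiplier_memI)
  show "bdd_linear_on A (fst (cs_smult M c m))"
    by (rule bdd_linear_on_smult[OF bdd_linear_fst[OF assms]]) simp_all
  show "bdd_linear_on A (snd (cs_smult M c m))"
    by (rule bdd_linear_on_smult[OF bdd_linear_snd[OF assms]]) simp_all
qed (simp add: assms centralizer_eq mult_smult_left mult_smult_right)

lemma multiplier_mult_closed [simp]:
  assumes "m1 \<in> \<M>" "m2 \<in> \<M>"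
  shows "cs_mult M m1 m2 \<in> \<M>"
proof (rule multiplier_memI)
  show "bdd_linear_on A (fst (cs_mult M m1 m2))"
    by (rule bdd_linear_on_comp[OF bdd_linear_fst[OF assms(1)] bdd_linear_fst[OF assms(2)]]) simp_all
  show "bdd_linear_on A (snd (cs_mult M m1 m2))"
    by (rule bdd_linear_on_comp[OF bdd_linear_snd[OF assms(2)] bdd_linear_snd[OF assms(1)]]) simp_all
qed (simp add: assms centralizer_eq)

lemma multiplier_star_closed [simp]:
  assumes "m \<in> \<M>"
  shows "cs_star M m \<in> \<M>"
proof (rule multiplier_memI)
  show "bdd_linear_on A (fst (cs_star M m))"
    by (rule bdd_linear_on_star[OF bdd_linear_snd[OF assms]]) simp_all
  show "bdd_linear_on A (snd (cs_star M m))"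
    by (rule bdd_linear_on_star[OF bdd_linear_fst[OF assms]]) simp_all
  fix x y assume "x \<in> \<A>" "y \<in> \<A>"
  then show "x \<otimes> fst (cs_star M m) y = snd (cs_star M m) x \<otimes> y"
    using arg_cong[OF centralizer_eq[OF assms, of "y\<^sup>\<star>" "x\<^sup>\<star>"], of "cs_star A"] assms
    by (simp add: star_mult)
qed

lemma multiplier_minus_closed [simp]: "m1 \<in> \<M> \<Longrightarrow> m2 \<in> \<M> \<Longrightarrow> cs_minus M m1 m2 \<in> \<M>"
  by (simp add: cs_minus_def)

lemma emb_closed [simp]:
  assumes "a \<in> \<A>"
  shows "\<iota> a \<in> \<M>"
proof (rule multiplier_memI)
  show "bdd_linear_on A (fst (\<iota> a))"
    using assms by (intro bdd_linear_onI[where K = "\<parallel>a\<parallel>"])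
      (simp_all add: mult_add_right mult_smult_right nrm_mult_ineq)
  show "bdd_linear_on A (snd (\<iota> a))"
    using assms by (intro bdd_linear_onI[where K = "\<parallel>a\<parallel>"])
      (simp_all add: mult_add_left mult_smult_left nrm_mult_ineq mult.commute[of "\<parallel>a\<parallel>"])
qed (simp add: assms mult_assoc)

lemma multiplier_fst_mult:
  assumes m: "m \<in> \<M>" and "x \<in> \<A>" "y \<in> \<A>"
  shows "fst m (x \<otimes> y) = fst m x \<otimes> y"
proof -
  have "fst m (x \<otimes> y) \<ominus> fst m x \<otimes> y = \<zero>"
  proof (rule eq_zero_if_mult_left)
    fix z assume "z \<in> \<A>"
    then have "z \<otimes> fst m (x \<otimes> y) = z \<otimes> (fst m x \<otimes> y)"
      using assms by (simp add: centralizer_eq[OF m] flip: mult_assoc)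
    then show "z \<otimes> (fst m (x \<otimes> y) \<ominus> fst m x \<otimes> y) = \<zero>"
      using assms \<open>z \<in> \<A>\<close> by (simp add: mult_minus_right)
  qed (use assms in simp)
  then show ?thesis using assms by (simp add: minus_eq_zero_iff)
qed

lemma multiplier_snd_mult:
  assumes m: "m \<in> \<M>" and "x \<in> \<A>" "y \<in> \<A>"
  shows "snd m (x \<otimes> y) = x \<otimes> snd m y"
proof -
  have "((snd m (x \<otimes> y))\<^sup>\<star>)\<^sup>\<star> = ((snd m y)\<^sup>\<star> \<otimes> x\<^sup>\<star>)\<^sup>\<star>"
    using multiplier_fst_mult[OF multiplier_star_closed[OF m], of "y\<^sup>\<star>" "x\<^sup>\<star>"] assms by (simp add: star_mult)
  then show ?thesis using assms by (simp add: star_mult)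
qed

lemma multiplier_mult_emb: "m \<in> \<M> \<Longrightarrow> a \<in> \<A> \<Longrightarrow> cs_mult M m (\<iota> a) = \<iota> (fst m a)"
  by (rule multiplier_eqI) (simp_all add: multiplier_fst_mult centralizer_eq)

lemma emb_mult_multiplier: "m \<in> \<M> \<Longrightarrow> a \<in> \<A> \<Longrightarrow> cs_mult M (\<iota> a) m = \<iota> (snd m a)"
  by (rule multiplier_eqI) (simp_all add: multiplier_snd_mult centralizer_eq)

lemma emb_add: "a \<in> \<A> \<Longrightarrow> b \<in> \<A> \<Longrightarrow> \<iota> (a \<oplus> b) = cs_add M (\<iota> a) (\<iota> b)"
  by (rule multiplier_eqI) (simp_all add: mult_add_right mult_add_left)

lemma emb_minus: "a \<in> \<A> \<Longrightarrow> b \<in> \<A> \<Longrightarrow> \<iota> (a \<ominus> b) = cs_minus M (\<iota> a) (\<iota> b)"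
  by (rule multiplier_eqI) (simp_all add: mult_minus_right mult_minus_left)

lemma emb_star: "a \<in> \<A> \<Longrightarrow> \<iota> a\<^sup>\<star> = cs_star M (\<iota> a)"
  by (rule multiplier_eqI) (simp_all add: star_mult)

lemma emb_zero: "\<iota> \<zero> = cs_zero M"
  by (rule multiplier_eqI) simp_all

subsection \<open>The multiplier norm\<close>

lemma nrm_M_eq: "\<parallel>m\<parallel>\<^sub>M = Sup {\<parallel>fst m x\<parallel> | x. x \<in> \<A> \<and> \<parallel>x\<parallel> \<le> 1}"
  by (simp add: mult_alg_def Let_def)

lemma nrm_M_least: "(\<And>x. x \<in> \<A> \<Longrightarrow> \<parallel>x\<parallel> \<le> 1 \<Longrightarrow> \<parallel>fst m x\<parallel> \<le> c) \<Longrightarrow> \<parallel>m\<parallel>\<^sub>M \<le> c"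
  unfolding nrm_M_eq by (rule cSup_least) (auto intro!: exI[of _ \<zero>])

lemma nrm_M_upper:
  assumes m: "m \<in> \<M>" and x: "x \<in> \<A>" "\<parallel>x\<parallel> \<le> 1"
  shows "\<parallel>fst m x\<parallel> \<le> \<parallel>m\<parallel>\<^sub>M"
  unfolding nrm_M_eq
proof (rule cSup_upper)
  obtain K where K: "0 \<le> K" "\<And>x. x \<in> \<A> \<Longrightarrow> \<parallel>fst m x\<parallel> \<le> K * \<parallel>x\<parallel>"
    using bdd_linear_on_bound[OF bdd_linear_fst[OF m]] by blast
  have "\<parallel>fst m y\<parallel> \<le> K" if "y \<in> \<A>" "\<parallel>y\<parallel> \<le> 1" for y
    using K(2)[OF that(1)] mult_left_mono[OF that(2) K(1)] by simp
  then show "bdd_above {\<parallel>fst m x\<parallel> | x. x \<in> \<A> \<and> \<parallel>x\<parallel> \<le> 1}" by (auto intro!: bdd_aboveI[of _ K])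
qed (use x in blast)

lemma nrm_M_nonneg [simp]: "m \<in> \<M> \<Longrightarrow> 0 \<le> \<parallel>m\<parallel>\<^sub>M"
  by (rule order_trans[OF nrm_nonneg nrm_M_upper[of m \<zero>]]) simp_all

lemma nrm_fst_le:
  assumes m: "m \<in> \<M>" and x: "x \<in> \<A>"
  shows "\<parallel>fst m x\<parallel> \<le> \<parallel>m\<parallel>\<^sub>M * \<parallel>x\<parallel>"
proof (cases "x = \<zero>")
  case False
  then have "\<parallel>x\<parallel> \<noteq> 0" using x by (simp add: nrm_eq_0_iff)
  then have pos: "0 < \<parallel>x\<parallel>" using nrm_nonneg[OF x] by linarith
  have "\<parallel>fst m (complex_of_real (1 / \<parallel>x\<parallel>) \<odot> x)\<parallel> \<le> \<parallel>m\<parallel>\<^sub>M"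
    using x pos by (intro nrm_M_upper[OF m]) (simp_all add: nrm_smult norm_divide)
  then have "\<parallel>fst m x\<parallel> / \<parallel>x\<parallel> \<le> \<parallel>m\<parallel>\<^sub>M"
    using m x pos by (simp add: nrm_smult norm_divide)
  then show ?thesis using pos by (simp add: pos_divide_le_eq)
qed (simp add: m)

lemma nrm_M_eq_0_iff:
  assumes m: "m \<in> \<M>"
  shows "\<parallel>m\<parallel>\<^sub>M = 0 \<longleftrightarrow> m = cs_zero M"
proof
  assume "\<parallel>m\<parallel>\<^sub>M = 0"
  have fst_zero: "fst m x = \<zero>" if "x \<in> \<A>" for x
    using nrm_fst_le[OF m that] \<open>\<parallel>m\<parallel>\<^sub>M = 0\<close> nrm_nonneg[of "fst m x"] nrm_eq_0_iff[of "fst m x"] that m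
    by (simp del: nrm_nonneg)
  have "snd m x = \<zero>" if "x \<in> \<A>" for x
  proof -
    have "snd m x \<otimes> (snd m x)\<^sup>\<star> = \<zero>"
      using centralizer_eq[OF m that, of "(snd m x)\<^sup>\<star>"] fst_zero that m by simp
    then have "(snd m x)\<^sup>\<star> = \<zero>"
      using nrm_star_mult[of "(snd m x)\<^sup>\<star>"] that m nrm_eq_0_iff[of "(snd m x)\<^sup>\<star>"] by simp
    then show ?thesis using star_star[of "snd m x"] that m by simp
  qed
  with fst_zero show "m = cs_zero M" by (intro multiplier_eqI m) simp_all
next
  assume "m = cs_zero M"
  then have "\<parallel>m\<parallel>\<^sub>M \<le> 0" by (intro nrm_M_least) simp
  then show "\<parallel>m\<parallel>\<^sub>M = 0" using nrm_M_nonneg[OF m] by linarith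
qed

lemma nrm_M_triangle_ineq:
  assumes "m1 \<in> \<M>" "m2 \<in> \<M>"
  shows "\<parallel>cs_add M m1 m2\<parallel>\<^sub>M \<le> \<parallel>m1\<parallel>\<^sub>M + \<parallel>m2\<parallel>\<^sub>M"
proof (rule nrm_M_least)
  fix x assume x: "x \<in> \<A>" "\<parallel>x\<parallel> \<le> 1"
  then show "\<parallel>fst (cs_add M m1 m2) x\<parallel> \<le> \<parallel>m1\<parallel>\<^sub>M + \<parallel>m2\<parallel>\<^sub>M"
    using nrm_triangle_ineq[of "fst m1 x" "fst m2 x"] nrm_M_upper[OF assms(1) x]
      nrm_M_upper[OF assms(2) x] assms by simp
qed

lemma nrm_M_mult_ineq:
  assumes "m1 \<in> \<M>" "m2 \<in> \<M>"
  shows "\<parallel>cs_mult M m1 m2\<parallel>\<^sub>M \<le> \<parallel>m1\<parallel>\<^sub>M * \<parallel>m2\<parallel>\<^sub>M"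
proof (rule nrm_M_least)
  fix x assume x: "x \<in> \<A>" "\<parallel>x\<parallel> \<le> 1"
  have "\<parallel>fst m1 (fst m2 x)\<parallel> \<le> \<parallel>m1\<parallel>\<^sub>M * \<parallel>fst m2 x\<parallel>"
    using assms x by (intro nrm_fst_le) simp_all
  also have "\<dots> \<le> \<parallel>m1\<parallel>\<^sub>M * \<parallel>m2\<parallel>\<^sub>M"
    using assms x by (intro mult_left_mono nrm_M_upper) simp_all
  finally show "\<parallel>fst (cs_mult M m1 m2) x\<parallel> \<le> \<parallel>m1\<parallel>\<^sub>M * \<parallel>m2\<parallel>\<^sub>M" using x by simp
qed

lemma nrm_M_smult:
  assumes m: "m \<in> \<M>"
  shows "\<parallel>cs_smult M c m\<parallel>\<^sub>M = cmod c * \<parallel>m\<parallel>\<^sub>M"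
proof -
  have le: "\<parallel>cs_smult M c m\<parallel>\<^sub>M \<le> cmod c * \<parallel>m\<parallel>\<^sub>M" if "m \<in> \<M>" for c m
    by (rule nrm_M_least) (simp add: that nrm_smult nrm_M_upper mult_left_mono)
  show ?thesis
  proof (cases "c = 0")
    case True
    then show ?thesis using le[OF m, of c] nrm_M_nonneg[OF multiplier_smult_closed[OF m, of c]] by simp
  next
    case False
    have "cs_smult M (1 / c) (cs_smult M c m) = m"
      by (rule multiplier_eqI) (simp_all add: m False smult_smult)
    then have "\<parallel>m\<parallel>\<^sub>M \<le> cmod (1 / c) * \<parallel>cs_smult M c m\<parallel>\<^sub>M"
      using le[of "cs_smult M c m" "1 / c"] m by simp
    then have "cmod c * \<parallel>m\<parallel>\<^sub>M \<le> \<parallel>cs_smult M c m\<parallel>\<^sub>M"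
      using False by (simp add: norm_divide field_simps)
    with le[OF m, of c] show ?thesis by simp
  qed
qed

lemma nrm_M_square_le:
  assumes m: "m \<in> \<M>"
  shows "\<parallel>m\<parallel>\<^sub>M\<^sup>2 \<le> \<parallel>cs_mult M (cs_star M m) m\<parallel>\<^sub>M"
proof -
  let ?mm = "cs_mult M (cs_star M m) m"
  have mm: "?mm \<in> \<M>" using m by simp
  have "\<parallel>m\<parallel>\<^sub>M \<le> sqrt \<parallel>?mm\<parallel>\<^sub>M"
  proof (rule nrm_M_least)
    fix x assume x: "x \<in> \<A>" "\<parallel>x\<parallel> \<le> 1"
    have "(fst m x)\<^sup>\<star> \<otimes> fst m x = x\<^sup>\<star> \<otimes> fst ?mm x"
      using centralizer_eq[OF multiplier_star_closed[OF m], of "x\<^sup>\<star>" "fst m x"] m x by simp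
    then have "\<parallel>fst m x\<parallel>\<^sup>2 = \<parallel>x\<^sup>\<star> \<otimes> fst ?mm x\<parallel>"
      using nrm_star_mult[of "fst m x"] m x by simp
    also have "\<dots> \<le> \<parallel>x\<parallel> * \<parallel>fst ?mm x\<parallel>"
      using nrm_mult_ineq[of "x\<^sup>\<star>" "fst ?mm x"] m x by simp
    also have "\<dots> \<le> 1 * \<parallel>?mm\<parallel>\<^sub>M"
      using nrm_M_upper[OF mm x] m x by (intro mult_mono) simp_all
    finally show "\<parallel>fst m x\<parallel> \<le> sqrt \<parallel>?mm\<parallel>\<^sub>M" by (simp add: real_le_rsqrt)
  qed
  then have "\<parallel>m\<parallel>\<^sub>M\<^sup>2 \<le> (sqrt \<parallel>?mm\<parallel>\<^sub>M)\<^sup>2" by (rule power_mono) (simp add: m)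
  then show ?thesis by (simp add: m)
qed

lemma nrm_M_star [simp]:
  assumes m: "m \<in> \<M>"
  shows "\<parallel>cs_star M m\<parallel>\<^sub>M = \<parallel>m\<parallel>\<^sub>M"
proof -
  have le: "\<parallel>m\<parallel>\<^sub>M \<le> \<parallel>cs_star M m\<parallel>\<^sub>M" if m: "m \<in> \<M>" for m
  proof (cases "\<parallel>m\<parallel>\<^sub>M = 0")
    case False
    then have "0 < \<parallel>m\<parallel>\<^sub>M" using nrm_M_nonneg[OF m] by linarith
    moreover have "\<parallel>m\<parallel>\<^sub>M * \<parallel>m\<parallel>\<^sub>M \<le> \<parallel>cs_star M m\<parallel>\<^sub>M * \<parallel>m\<parallel>\<^sub>M"
      using nrm_M_square_le[OF m] nrm_M_mult_ineq[OF multiplier_star_closed[OF m] m]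
      by (simp add: power2_eq_square)
    ultimately show ?thesis by simp
  qed (simp add: m)
  have "cs_star M (cs_star M m) = m" by (rule multiplier_eqI) (simp_all add: m)
  then show ?thesis using le[OF m] le[OF multiplier_star_closed[OF m]] by simp
qed

lemma nrm_M_star_mult:
  assumes m: "m \<in> \<M>"
  shows "\<parallel>cs_mult M (cs_star M m) m\<parallel>\<^sub>M = \<parallel>m\<parallel>\<^sub>M\<^sup>2"
  using nrm_M_square_le[OF m] nrm_M_mult_ineq[OF multiplier_star_closed[OF m] m] m
  by (simp add: power2_eq_square)

lemma nrm_snd_le:
  assumes "m \<in> \<M>" "x \<in> \<A>"
  shows "\<parallel>snd m x\<parallel> \<le> \<parallel>m\<parallel>\<^sub>M * \<parallel>x\<parallel>"
  using nrm_fst_le[of "cs_star M m" "x\<^sup>\<star>"] assms by simp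

lemma nrm_emb [simp]:
  assumes a: "a \<in> \<A>"
  shows "\<parallel>\<iota> a\<parallel>\<^sub>M = \<parallel>a\<parallel>"
proof (rule antisym)
  show "\<parallel>\<iota> a\<parallel>\<^sub>M \<le> \<parallel>a\<parallel>"
  proof (rule nrm_M_least)
    fix x assume "x \<in> \<A>" "\<parallel>x\<parallel> \<le> 1"
    then show "\<parallel>fst (\<iota> a) x\<parallel> \<le> \<parallel>a\<parallel>"
      using nrm_mult_ineq[OF a, of x] mult_left_mono[of "\<parallel>x\<parallel>" 1 "\<parallel>a\<parallel>"] a by simp
  qed
  have "\<parallel>a\<parallel> * \<parallel>a\<parallel> \<le> \<parallel>\<iota> a\<parallel>\<^sub>M * \<parallel>a\<parallel>"
    using nrm_fst_le[of "\<iota> a" "a\<^sup>\<star>"] nrm_star_mult[of "a\<^sup>\<star>"] a by (simp add: power2_eq_square)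
  then show "\<parallel>a\<parallel> \<le> \<parallel>\<iota> a\<parallel>\<^sub>M"
    using nrm_nonneg[OF a] nrm_M_nonneg[OF emb_closed[OF a]]
    by (cases "\<parallel>a\<parallel> = 0") (auto simp: mult_le_cancel_right)
qed

subsection \<open>Completeness\<close>

lemma multiplier_strict_limit_exists:
  assumes S: "\<And>k. S k \<in> \<M>" "\<And>k. \<parallel>S k\<parallel>\<^sub>M \<le> c"
    and Cauchy_fst: "\<And>a \<epsilon>. a \<in> \<A> \<Longrightarrow> 0 < \<epsilon>
      \<Longrightarrow> \<exists>N. \<forall>i\<ge>N. \<forall>j\<ge>N. \<parallel>fst (S i) a \<ominus> fst (S j) a\<parallel> < \<epsilon>"
    and Cauchy_snd: "\<And>a \<epsilon>. a \<in> \<A> \<Longrightarrow> 0 < \<epsilon>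
      \<Longrightarrow> \<exists>N. \<forall>i\<ge>N. \<forall>j\<ge>N. \<parallel>snd (S i) a \<ominus> snd (S j) a\<parallel> < \<epsilon>"
  obtains s where "s \<in> \<M>" "\<And>a. a \<in> \<A> \<Longrightarrow> converges (\<lambda>k. fst (S k) a) (fst s a)"
    "\<And>a. a \<in> \<A> \<Longrightarrow> converges (\<lambda>k. snd (S k) a) (snd s a)"
proof -
  have "\<forall>a\<in>\<A>. \<exists>l. converges (\<lambda>k. fst (S k) a) l" "\<forall>a\<in>\<A>. \<exists>l. converges (\<lambda>k. snd (S k) a) l"
    using complete[of "\<lambda>k. fst (S k) a" for a, OF _ Cauchy_fst]
      complete[of "\<lambda>k. snd (S k) a" for a, OF _ Cauchy_snd] S(1)
    by (auto simp: converges_def Bex_def)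
  then obtain L R where LR: "\<forall>a\<in>\<A>. converges (\<lambda>k. fst (S k) a) (L a)"
    "\<forall>a\<in>\<A>. converges (\<lambda>k. snd (S k) a) (R a)"
    by (auto dest!: bchoice)
  define s where "s = (restrict L \<A>, restrict R \<A>)"
  have s: "converges (\<lambda>k. fst (S k) a) (fst s a)" "converges (\<lambda>k. snd (S k) a) (snd s a)" if "a \<in> \<A>" for a
    using LR that by (simp_all add: s_def)
  have bound: "\<parallel>S k\<parallel>\<^sub>M * \<parallel>x\<parallel> \<le> c * \<parallel>x\<parallel>" if "x \<in> \<A>" for k x
    using S(2) that by (intro mult_right_mono) simp_all
  have "s \<in> \<M>"
  proof (rule multiplier_memI)
    show "bdd_linear_on A (fst s)"
      by (rule bdd_linear_on_limit[OF bdd_linear_fst[OF S(1)] order_trans[OF nrm_fst_le[OF S(1)] bound] _ s(1)])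
        (simp_all add: s_def restrict_extensional del: restrict_apply)
    show "bdd_linear_on A (snd s)"
      by (rule bdd_linear_on_limit[OF bdd_linear_snd[OF S(1)] order_trans[OF nrm_snd_le[OF S(1)] bound] _ s(2)])
        (simp_all add: s_def restrict_extensional del: restrict_apply)
    fix x y assume xy: "x \<in> \<A>" "y \<in> \<A>"
    have "converges (\<lambda>k. x \<otimes> fst (S k) y) (x \<otimes> fst s y)"
      "converges (\<lambda>k. snd (S k) x \<otimes> y) (snd s x \<otimes> y)"
      by (intro converges_mult converges_const s xy)+
    then show "x \<otimes> fst s y = snd s x \<otimes> y"
      using converges_unique by (simp add: centralizer_eq[OF S(1) xy])
  qed
  with s show ?thesis using that by blast
qed

lemma nrm_M_diff_le:
  assumes "m1 \<in> \<M>" "m2 \<in> \<M>"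
  shows "\<bar>\<parallel>m1\<parallel>\<^sub>M - \<parallel>m2\<parallel>\<^sub>M\<bar> \<le> \<parallel>cs_minus M m1 m2\<parallel>\<^sub>M"
proof -
  have cancel: "(x \<ominus> y) \<oplus> y = x" if "x \<in> \<A>" "y \<in> \<A>" for x y
    using minus_add_minus_cancel[of x y \<zero>] that by simp
  have le: "\<parallel>m\<parallel>\<^sub>M \<le> \<parallel>cs_minus M m n\<parallel>\<^sub>M + \<parallel>n\<parallel>\<^sub>M" if "m \<in> \<M>" "n \<in> \<M>" for m n
  proof -
    have "cs_add M (cs_minus M m n) n = m" by (rule multiplier_eqI) (simp_all add: that cancel)
    then show ?thesis using nrm_M_triangle_ineq[of "cs_minus M m n" n] that by simp
  qed
  have "cs_minus M m2 m1 = cs_smult M (-1) (cs_minus M m1 m2)"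
    by (rule multiplier_eqI) (simp_all add: assms cs_minus_def smult_add_right smult_smult add_commute)
  then have "\<parallel>cs_minus M m2 m1\<parallel>\<^sub>M = \<parallel>cs_minus M m1 m2\<parallel>\<^sub>M" using assms by (simp add: nrm_M_smult)
  with le[OF assms] le[OF assms(2,1)] show ?thesis by linarith
qed

lemma nrm_M_limit_of_pointwise_limit:
  assumes X: "\<And>k. X k \<in> \<M>" and s: "s \<in> \<M>" "\<And>a. a \<in> \<A> \<Longrightarrow> converges (\<lambda>k. fst (X k) a) (fst s a)"
    and Cauchy: "\<And>\<epsilon>. 0 < \<epsilon> \<Longrightarrow> \<exists>N. \<forall>i\<ge>N. \<forall>j\<ge>N. \<parallel>cs_minus M (X i) (X j)\<parallel>\<^sub>M < \<epsilon>"
  shows "(\<lambda>k. \<parallel>cs_minus M (X k) s\<parallel>\<^sub>M) \<longlonglongrightarrow> 0"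
proof (rule LIMSEQ_I)
  fix \<epsilon> :: real assume "0 < \<epsilon>"
  then obtain N where N: "\<And>i j. N \<le> i \<Longrightarrow> N \<le> j \<Longrightarrow> \<parallel>cs_minus M (X i) (X j)\<parallel>\<^sub>M < \<epsilon>/2"
    using Cauchy[of "\<epsilon>/2"] by auto
  have "\<parallel>cs_minus M (X i) s\<parallel>\<^sub>M \<le> \<epsilon>/2" if "N \<le> i" for i
  proof (rule nrm_M_least)
    fix a assume a: "a \<in> \<A>" "\<parallel>a\<parallel> \<le> 1"
    have "(\<lambda>k. \<epsilon>/2 + \<parallel>fst (X k) a \<ominus> fst s a\<parallel>) \<longlonglongrightarrow> \<epsilon>/2 + 0"
      by (intro tendsto_intros convergesD(3)[OF s(2)[OF a(1)]])
    moreover have "\<parallel>fst (X i) a \<ominus> fst s a\<parallel> \<le> \<epsilon>/2 + \<parallel>fst (X k) a \<ominus> fst s a\<parallel>" if "N \<le> k" for k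
      using nrm_minus_triangle[of "fst (X i) a" "fst (X k) a" "fst s a"] N[OF \<open>N \<le> i\<close> that]
        nrm_M_upper[OF _ a, of "cs_minus M (X i) (X k)"] a X s(1) by simp
    ultimately show "\<parallel>fst (cs_minus M (X i) s) a\<parallel> \<le> \<epsilon>/2"
      using a(1) LIMSEQ_le_const by fastforce
  qed
  then have "\<parallel>cs_minus M (X i) s\<parallel>\<^sub>M < \<epsilon>" if "N \<le> i" for i
    using that \<open>0 < \<epsilon>\<close> by fastforce
  then show "\<exists>N. \<forall>i\<ge>N. norm (\<parallel>cs_minus M (X i) s\<parallel>\<^sub>M - 0) < \<epsilon>"
    using X s(1) by auto
qed

lemma multiplier_limit_exists:
  assumes X: "\<And>k. X k \<in> \<M>"
    and Cauchy: "\<And>\<epsilon>. 0 < \<epsilon> \<Longrightarrow> \<exists>N. \<forall>i\<ge>N. \<forall>j\<ge>N. \<parallel>cs_minus M (X i) (X j)\<parallel>\<^sub>M < \<epsilon>"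
  shows "\<exists>s\<in>\<M>. (\<lambda>k. \<parallel>cs_minus M (X k) s\<parallel>\<^sub>M) \<longlonglongrightarrow> 0"
proof -
  have "Cauchy (\<lambda>k. \<parallel>X k\<parallel>\<^sub>M)"
  proof (rule CauchyI)
    fix \<epsilon> :: real assume "0 < \<epsilon>"
    then show "\<exists>N. \<forall>i\<ge>N. \<forall>j\<ge>N. norm (\<parallel>X i\<parallel>\<^sub>M - \<parallel>X j\<parallel>\<^sub>M) < \<epsilon>"
      using Cauchy[of \<epsilon>] nrm_M_diff_le[OF X X] unfolding real_norm_def by (meson le_less_trans)
  qed
  then obtain c where c: "\<And>k. \<parallel>X k\<parallel>\<^sub>M \<le> c"
    by (metis BseqE Cauchy_Bseq X nrm_M_nonneg real_norm_def abs_of_nonneg)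
  obtain s where "s \<in> \<M>" "\<And>a. a \<in> \<A> \<Longrightarrow> converges (\<lambda>k. fst (X k) a) (fst s a)"
  proof (rule multiplier_strict_limit_exists[OF X c])
    fix a and \<epsilon> :: real assume "a \<in> \<A>" "0 < \<epsilon>"
    then show "\<exists>N. \<forall>i\<ge>N. \<forall>j\<ge>N. \<parallel>fst (X i) a \<ominus> fst (X j) a\<parallel> < \<epsilon>"
      "\<exists>N. \<forall>i\<ge>N. \<forall>j\<ge>N. \<parallel>snd (X i) a \<ominus> snd (X j) a\<parallel> < \<epsilon>"
      using nrm_fst_le[of "cs_minus M (X i) (X j)" a for i j]
        nrm_snd_le[of "cs_minus M (X i) (X j)" a for i j] X
      by (intro double_sequence_small_if_scaled_le[OF Cauchy, where r = "\<parallel>a\<parallel>"]; simp)+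
  qed blast
  then show ?thesis using nrm_M_limit_of_pointwise_limit[OF X _ _ Cauchy] by blast
qed

theorem is_cstar_mult_alg: "is_cstar M"
  unfolding is_cstar_def Let_def
proof (intro conjI allI ballI impI)
  fix m1 c d assume m1: "m1 \<in> \<M>"
  show "cs_add M (cs_zero M) m1 = m1" "cs_add M m1 (cs_smult M (- 1) m1) = cs_zero M"
    "cs_smult M (c + d) m1 = cs_add M (cs_smult M c m1) (cs_smult M d m1)"
    "cs_smult M c (cs_smult M d m1) = cs_smult M (c * d) m1" "cs_smult M 1 m1 = m1"
    "cs_star M (cs_star M m1) = m1" "cs_star M (cs_smult M c m1) = cs_smult M (cnj c) (cs_star M m1)"
    by (rule multiplier_eqI; simp add: m1 add_smult_minus_one smult_add_left smult_smult star_smult)+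
  fix m2 assume m2: "m2 \<in> \<M>"
  show "cs_add M m1 m2 = cs_add M m2 m1"
    "cs_smult M c (cs_add M m1 m2) = cs_add M (cs_smult M c m1) (cs_smult M c m2)"
    "cs_smult M c (cs_mult M m1 m2) = cs_mult M (cs_smult M c m1) m2"
    "cs_smult M c (cs_mult M m1 m2) = cs_mult M m1 (cs_smult M c m2)"
    "cs_star M (cs_add M m1 m2) = cs_add M (cs_star M m1) (cs_star M m2)"
    "cs_star M (cs_mult M m1 m2) = cs_mult M (cs_star M m2) (cs_star M m1)"
    by (rule multiplier_eqI; simp add: m1 m2 smult_add_right star_add add_commute)+
  fix m3 assume m3: "m3 \<in> \<M>"
  show "cs_add M (cs_add M m1 m2) m3 = cs_add M m1 (cs_add M m2 m3)"
    "cs_mult M (cs_mult M m1 m2) m3 = cs_mult M m1 (cs_mult M m2 m3)"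
    "cs_mult M m1 (cs_add M m2 m3) = cs_add M (cs_mult M m1 m2) (cs_mult M m1 m3)"
    "cs_mult M (cs_add M m1 m2) m3 = cs_add M (cs_mult M m1 m3) (cs_mult M m2 m3)"
    by (rule multiplier_eqI; simp add: m1 m2 m3 add_assoc)+
qed (simp_all add: nrm_M_eq_0_iff nrm_M_triangle_ineq nrm_M_smult nrm_M_mult_ineq
    nrm_M_star_mult multiplier_limit_exists)

end

section \<open>Unital C*-algebras inside a ring type\<close>

locale unital_cstar_algebra = cstar_algebra A
  for A :: "'a cstar" +
  assumes unit_exists: "\<exists>u\<in>cs_carrier A. \<forall>x\<in>cs_carrier A. cs_mult A u x = x \<and> cs_mult A x u = x"
begin

definition unit :: 'a where
  "unit = (SOME u. u \<in> \<A> \<and> (\<forall>x\<in>\<A>. u \<otimes> x = x \<and> x \<otimes> u = x))"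

lemma unit_closed [simp]: "unit \<in> \<A>"
  and unit_mult [simp]: "x \<in> \<A> \<Longrightarrow> unit \<otimes> x = x"
  and mult_unit [simp]: "x \<in> \<A> \<Longrightarrow> x \<otimes> unit = x"
proof -
  have "unit \<in> \<A> \<and> (\<forall>x\<in>\<A>. unit \<otimes> x = x \<and> x \<otimes> unit = x)"
    unfolding unit_def by (rule someI_ex) (use unit_exists in blast)
  then show "unit \<in> \<A>" "x \<in> \<A> \<Longrightarrow> unit \<otimes> x = x" "x \<in> \<A> \<Longrightarrow> x \<otimes> unit = x" by auto
qed

end

text \<open>The carrier of a single C*-algebra is only a set. The product of all unital C*-algebras on
  \<open>'a\<close> is a type and a ring, so identities in one of its factors can be computed in a type class.\<close>

typedef 'a cstar_section = "Pi\<^sub>E (Collect unital_cstar_algebra) (cs_carrier :: 'a cstar \<Rightarrow> 'a set)"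
  morphisms component Abs_cstar_section
proof
  show "restrict cs_zero (Collect unital_cstar_algebra) \<in> Pi\<^sub>E (Collect unital_cstar_algebra) cs_carrier"
    by (simp add: unital_cstar_algebra_def cstar_algebra.zero_closed)
qed

setup_lifting type_definition_cstar_section

lemma component_closed [simp]: "unital_cstar_algebra S \<Longrightarrow> component x S \<in> cs_carrier S"
  by transfer auto

lemma cstar_section_eqI:
  assumes "\<And>S. unital_cstar_algebra S \<Longrightarrow> component x S = component y S"
  shows "x = y"
  using assms by transfer (auto intro: PiE_ext)

lift_definition section_star :: "'a cstar_section \<Rightarrow> 'a cstar_section" is
  "\<lambda>x. \<lambda>S\<in>Collect unital_cstar_algebra. cs_star S (x S)"
  by (simp add: restrict_PiE_iff PiE_mem cstar_algebra.star_closed unital_cstar_algebra.axioms(1))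

lift_definition section_scaleC :: "complex \<Rightarrow> 'a cstar_section \<Rightarrow> 'a cstar_section" is
  "\<lambda>c x. \<lambda>S\<in>Collect unital_cstar_algebra. cs_smult S c (x S)"
  by (simp add: restrict_PiE_iff PiE_mem cstar_algebra.smult_closed unital_cstar_algebra.axioms(1))

instantiation cstar_section :: (type) "{real_algebra, monoid_mult}"
begin

lift_definition zero_cstar_section :: "'a cstar_section" is
  "\<lambda>S\<in>Collect unital_cstar_algebra. cs_zero S"
  by (simp add: restrict_PiE_iff PiE_mem cstar_algebra.zero_closed unital_cstar_algebra.axioms(1))

lift_definition one_cstar_section :: "'a cstar_section" is
  "\<lambda>S\<in>Collect unital_cstar_algebra. unital_cstar_algebra.unit S"
  by (simp add: restrict_PiE_iff unital_cstar_algebra.unit_closed)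

lift_definition plus_cstar_section :: "'a cstar_section \<Rightarrow> 'a cstar_section \<Rightarrow> 'a cstar_section" is
  "\<lambda>x y. \<lambda>S\<in>Collect unital_cstar_algebra. cs_add S (x S) (y S)"
  by (simp add: restrict_PiE_iff PiE_mem cstar_algebra.add_closed unital_cstar_algebra.axioms(1))

lift_definition minus_cstar_section :: "'a cstar_section \<Rightarrow> 'a cstar_section \<Rightarrow> 'a cstar_section" is
  "\<lambda>x y. \<lambda>S\<in>Collect unital_cstar_algebra. cs_minus S (x S) (y S)"
  by (simp add: restrict_PiE_iff PiE_mem cstar_algebra.minus_closed unital_cstar_algebra.axioms(1))

lift_definition times_cstar_section :: "'a cstar_section \<Rightarrow> 'a cstar_section \<Rightarrow> 'a cstar_section" is
  "\<lambda>x y. \<lambda>S\<in>Collect unital_cstar_algebra. cs_mult S (x S) (y S)"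
  by (simp add: restrict_PiE_iff PiE_mem cstar_algebra.mult_closed unital_cstar_algebra.axioms(1))

definition uminus_cstar_section :: "'a cstar_section \<Rightarrow> 'a cstar_section" where
  "uminus_cstar_section = section_scaleC (-1)"

definition scaleR_cstar_section :: "real \<Rightarrow> 'a cstar_section \<Rightarrow> 'a cstar_section" where
  "scaleR_cstar_section t = section_scaleC (complex_of_real t)"

lemma component_simps [simp]:
  assumes "unital_cstar_algebra S"
  shows "component 0 S = cs_zero S" "component 1 S = unital_cstar_algebra.unit S"
    "component (x + y) S = cs_add S (component x S) (component y S)"
    "component (x - y) S = cs_minus S (component x S) (component y S)"
    "component (x * y) S = cs_mult S (component x S) (component y S)"
    "component (- x) S = cs_smult S (-1) (component x S)"
    "component (t *\<^sub>R x) S = cs_smult S (complex_of_real t) (component x S)"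
    "component (section_star x) S = cs_star S (component x S)"
    "component (section_scaleC c x) S = cs_smult S c (component x S)"
  using assms
  by (simp_all add: zero_cstar_section.rep_eq one_cstar_section.rep_eq plus_cstar_section.rep_eq
      minus_cstar_section.rep_eq times_cstar_section.rep_eq uminus_cstar_section_def
      scaleR_cstar_section_def section_star.rep_eq section_scaleC.rep_eq)

instance
proof
  fix x y z :: "'a cstar_section" and s t :: real
  note laws = unital_cstar_algebra.axioms(1) cs_minus_def cstar_algebra.add_assoc cstar_algebra.add_commute
    cstar_algebra.zero_add cstar_algebra.add_smult_minus_one cstar_algebra.mult_assoc
    cstar_algebra.mult_add_left cstar_algebra.mult_add_right unital_cstar_algebra.unit_mult
    unital_cstar_algebra.mult_unit cstar_algebra.smult_add_right cstar_algebra.smult_add_left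
    cstar_algebra.smult_smult cstar_algebra.smult_one cstar_algebra.mult_smult_left
    cstar_algebra.mult_smult_right cstar_algebra.smult_closed
  show "x + y + z = x + (y + z)" "x + y = y + x" "0 + x = x" "- x + x = 0" "x - y = x + - y"
    "x * y * z = x * (y * z)" "(x + y) * z = x * z + y * z" "x * (y + z) = x * y + x * z"
    "1 * x = x" "x * 1 = x" "s *\<^sub>R (x + y) = s *\<^sub>R x + s *\<^sub>R y" "(s + t) *\<^sub>R x = s *\<^sub>R x + t *\<^sub>R x"
    "s *\<^sub>R t *\<^sub>R x = (s * t) *\<^sub>R x" "1 *\<^sub>R x = x"
    "s *\<^sub>R x * y = s *\<^sub>R (x * y)" "x * s *\<^sub>R y = s *\<^sub>R (x * y)"
    by (rule cstar_section_eqI; simp add: laws)+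
qed

end

lift_definition single :: "'a cstar \<Rightarrow> 'a \<Rightarrow> 'a cstar_section" is
  "\<lambda>S m. \<lambda>T\<in>Collect unital_cstar_algebra. if T = S \<and> m \<in> cs_carrier S then m else cs_zero T"
  by (simp add: restrict_PiE_iff PiE_mem cstar_algebra.zero_closed unital_cstar_algebra.axioms(1))

lemma component_single:
  assumes "unital_cstar_algebra T" "m \<in> cs_carrier S"
  shows "component (single S m) T = (if T = S then m else cs_zero T)"
  using assms by transfer simp

context unital_cstar_algebra
begin

lemma component_single_self [simp]: "m \<in> \<A> \<Longrightarrow> component (single A m) A = m"
  by (simp add: component_single unital_cstar_algebra_axioms)

lemma component_closed_self [simp]: "component x A \<in> \<A>"
  by (rule component_closed[OF unital_cstar_algebra_axioms])

lemma single_zero: "single A \<zero> = 0"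
  by (rule cstar_section_eqI) (simp add: component_single)

lemma single_eqI:
  assumes "m \<in> \<A>" "component x A = m"
    and "\<And>T. unital_cstar_algebra T \<Longrightarrow> T \<noteq> A \<Longrightarrow> component x T = cs_zero T"
  shows "x = single A m"
  by (rule cstar_section_eqI) (use assms in \<open>simp add: component_single\<close>)

lemmas other_component_simps = component_single unital_cstar_algebra.axioms(1) cstar_algebra.zero_add
  cstar_algebra.zero_closed cstar_algebra.minus_self cstar_algebra.star_zero
  cstar_algebra.mult_zero_left cstar_algebra.mult_zero_right

lemmas component_simps_self [simp] = component_simps[OF unital_cstar_algebra_axioms]

lemma single_add: "m \<in> \<A> \<Longrightarrow> m' \<in> \<A> \<Longrightarrow> single A m + single A m' = single A (m \<oplus> m')"
  by (rule single_eqI) (simp_all add: other_component_simps)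

lemma single_minus: "m \<in> \<A> \<Longrightarrow> m' \<in> \<A> \<Longrightarrow> single A m - single A m' = single A (m \<ominus> m')"
  by (rule single_eqI) (simp_all add: other_component_simps)

lemma mult_single: "m \<in> \<A> \<Longrightarrow> x * single A m = single A (component x A \<otimes> m)"
  by (rule single_eqI) (simp_all add: other_component_simps)

lemma single_mult: "m \<in> \<A> \<Longrightarrow> single A m * x = single A (m \<otimes> component x A)"
  by (rule single_eqI) (simp_all add: other_component_simps)

lemma section_star_single: "m \<in> \<A> \<Longrightarrow> section_star (single A m) = single A m\<^sup>\<star>"
  by (rule single_eqI) (simp_all add: other_component_simps)

lemma cstar_seminorm_component:
  "cstar_seminorm section_star section_scaleC (\<lambda>x. \<parallel>component x A\<parallel>)"
proof
  fix x y :: "'a cstar_section" and c d :: complex and t :: real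
  note laws = unital_cstar_algebra.axioms(1) cstar_algebra.star_star cstar_algebra.star_add
    cstar_algebra.star_mult cstar_algebra.star_smult cstar_algebra.smult_add_right
    cstar_algebra.smult_smult cstar_algebra.mult_smult_left cstar_algebra.mult_smult_right
  show "section_star (section_star x) = x" "section_star (x + y) = section_star x + section_star y"
    "section_star (x * y) = section_star y * section_star x"
    "section_star (section_scaleC c x) = section_scaleC (cnj c) (section_star x)"
    "section_scaleC c (x + y) = section_scaleC c x + section_scaleC c y"
    "section_scaleC c (section_scaleC d x) = section_scaleC (c * d) x"
    "t *\<^sub>R x = section_scaleC (complex_of_real t) x"
    "section_scaleC c x * y = section_scaleC c (x * y)"
    "x * section_scaleC c y = section_scaleC c (x * y)"
    by (rule cstar_section_eqI; simp add: laws)+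
qed (simp_all add: nrm_triangle_ineq nrm_mult_ineq nrm_smult nrm_star_mult)

end

section \<open>Saturation of the corona\<close>

context cstar_algebra
begin

lemma unital_cstar_algebra_mult_alg: "unital_cstar_algebra M"
proof (intro unital_cstar_algebra.intro cstar_algebra.intro is_cstar_mult_alg
    unital_cstar_algebra_axioms.intro)
  have "cs_mult M multiplier_one m = m" "cs_mult M m multiplier_one = m" if "m \<in> \<M>" for m
    by (rule multiplier_eqI; simp add: that)+
  then show "\<exists>u\<in>\<M>. \<forall>m\<in>\<M>. cs_mult M u m = m \<and> cs_mult M m u = m"
    using multiplier_one_closed by blast
qed

interpretation M: unital_cstar_algebra M
  by (rule unital_cstar_algebra_mult_alg)

definition lift :: "'a \<Rightarrow> 'a mult cstar_section" where
  "lift a = single M (\<iota> a)"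

definition section_nrm :: "'a mult cstar_section \<Rightarrow> real" where
  "section_nrm x = \<parallel>component x M\<parallel>\<^sub>M"

lemma component_lift [simp]: "a \<in> \<A> \<Longrightarrow> component (lift a) M = \<iota> a"
  by (simp add: lift_def)

lemma mult_lift: "a \<in> \<A> \<Longrightarrow> x * lift a = lift (fst (component x M) a)"
  by (simp add: lift_def M.mult_single multiplier_mult_emb)

lemma lift_mult: "a \<in> \<A> \<Longrightarrow> lift a * x = lift (snd (component x M) a)"
  by (simp add: lift_def M.single_mult emb_mult_multiplier)

lemma lift_add: "a \<in> \<A> \<Longrightarrow> b \<in> \<A> \<Longrightarrow> lift a + lift b = lift (a \<oplus> b)"
  by (simp add: lift_def M.single_add emb_add)

lemma lift_minus: "a \<in> \<A> \<Longrightarrow> b \<in> \<A> \<Longrightarrow> lift a - lift b = lift (a \<ominus> b)"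
  by (simp add: lift_def M.single_minus emb_minus)

lemma star_lift: "a \<in> \<A> \<Longrightarrow> section_star (lift a) = lift a\<^sup>\<star>"
  by (simp add: lift_def M.section_star_single emb_star)

lemma lift_zero: "lift \<zero> = 0"
  by (simp add: lift_def emb_zero M.single_zero)

lemma section_nrm_lift: "a \<in> \<A> \<Longrightarrow> section_nrm (lift a) = \<parallel>a\<parallel>"
  by (simp add: section_nrm_def)

lemma star_ideal_lift: "star_ideal section_star section_scaleC section_nrm (lift ` \<A>)"
proof (intro star_ideal.intro star_ideal_axioms.intro)
  show "cstar_seminorm section_star section_scaleC section_nrm"
    using M.cstar_seminorm_component unfolding section_nrm_def .
  show "0 \<in> lift ` \<A>" using lift_zero zero_closed by (metis imageI)
qed (auto simp: mult_lift lift_mult lift_add star_lift)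

sublocale corona: strictly_complete_ideal section_star section_scaleC section_nrm "lift ` \<A>"
proof (intro strictly_complete_ideal.intro star_ideal_lift strictly_complete_ideal_axioms.intro)
  show "x = 0" if "x \<in> lift ` \<A>" "section_nrm x = 0" for x
    using that by (auto simp: section_nrm_lift nrm_eq_0_iff lift_zero)
next
  fix x C assume le: "\<And>y. y \<in> lift ` \<A> \<Longrightarrow> section_nrm y \<le> 1 \<Longrightarrow> section_nrm (x * y) \<le> C"
  show "section_nrm x \<le> C"
    unfolding section_nrm_def
  proof (rule nrm_M_least)
    fix a assume "a \<in> \<A>" "\<parallel>a\<parallel> \<le> 1"
    then show "\<parallel>fst (component x M) a\<parallel> \<le> C"
      using le[of "lift a"] by (simp add: section_nrm_lift mult_lift)
  qed
next
  interpret star_ideal section_star section_scaleC section_nrm "lift ` \<A>"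
    by (rule star_ideal_lift)
  fix X C assume bounded: "\<And>k. section_nrm (X k) \<le> C" and X: "strictly_Cauchy X"
  obtain s where s: "s \<in> \<M>" "\<And>a. a \<in> \<A> \<Longrightarrow> converges (\<lambda>k. fst (component (X k) M) a) (fst s a)"
    "\<And>a. a \<in> \<A> \<Longrightarrow> converges (\<lambda>k. snd (component (X k) M) a) (snd s a)"
  proof (rule multiplier_strict_limit_exists[of "\<lambda>k. component (X k) M" C])
    show "\<parallel>component (X k) M\<parallel>\<^sub>M \<le> C" for k using bounded by (simp add: section_nrm_def)
    fix a and \<epsilon> :: real assume a: "a \<in> \<A>" and "0 < \<epsilon>"
    then have "\<exists>N. \<forall>i\<ge>N. \<forall>j\<ge>N. section_nrm (X i * lift a - X j * lift a) < \<epsilon> \<and>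
        section_nrm (lift a * X i - lift a * X j) < \<epsilon>"
      using X unfolding strictly_Cauchy_def by blast
    then show "\<exists>N. \<forall>i\<ge>N. \<forall>j\<ge>N. \<parallel>fst (component (X i) M) a \<ominus> fst (component (X j) M) a\<parallel> < \<epsilon>"
      "\<exists>N. \<forall>i\<ge>N. \<forall>j\<ge>N. \<parallel>snd (component (X i) M) a \<ominus> snd (component (X j) M) a\<parallel> < \<epsilon>"
      using a by (simp_all add: mult_lift lift_mult lift_minus section_nrm_lift) blast+
  qed simp_all
  then have "strict_limit X (single M s)"
    by (auto simp: strict_limit_def mult_lift lift_mult lift_minus section_nrm_lift convergesD(3))
  then show "\<exists>s. strict_limit X s" by blast
qed

lemma quotient_nrm_eq_corona_nrm: "corona.quotient_nrm x = corona_nrm A (component x M)"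
proof -
  have "section_nrm (x - lift a) = \<parallel>cs_minus M (component x M) (\<iota> a)\<parallel>\<^sub>M" if "a \<in> \<A>" for a
    using that by (simp add: section_nrm_def)
  then show ?thesis
    unfolding corona.quotient_nrm_def corona_nrm_def
    by (simp add: Setcompr_eq_image image_image cong: image_cong)
qed

lemma component_eval:
  assumes "spoly_consts P \<subseteq> \<M>"
  shows "component (corona.eval b (map_spoly (single M) P)) M = spoly_eval M (\<lambda>k. component (b k) M) P"
  using assms by (induction P) auto

lemma projection_unit_lift:
  assumes e: "approx_unit A e" "\<And>k. cs_projection A (e k)"
  shows "projection_unit section_star section_scaleC section_nrm (lift ` \<A>) (\<lambda>k. lift (e k))"
proof (intro projection_unit.intro corona.strictly_complete_ideal_axioms projection_unit_axioms.intro)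
  have e_closed: "e k \<in> \<A>" and "(e k)\<^sup>\<star> = e k" and "e k \<otimes> e k = e k" for k
    using e(2)[of k] by (auto simp: cs_projection_def)
  then show "lift (e k) \<in> lift ` \<A>" "corona.projection (lift (e k))" for k
    by (auto intro!: corona.projectionI simp: star_lift mult_lift)
  show "\<exists>y. section_star y * y = lift (e (Suc k)) - lift (e k)" for k
  proof -
    have "cs_le A (e k) (e (Suc k))" using e(1) by (simp add: approx_unit_def)
    then obtain y where y: "y \<in> \<A>" "e (Suc k) \<ominus> e k = y\<^sup>\<star> \<otimes> y"
      by (auto simp: cs_le_def cs_positive_def)
    then have "section_star (lift y) * lift y = lift (e (Suc k)) - lift (e k)"
      by (simp add: star_lift mult_lift lift_minus e_closed)
    then show ?thesis by blast
  qed
  show "(\<lambda>k. section_nrm (lift (e k) * x - x)) \<longlonglongrightarrow> 0" if "x \<in> lift ` \<A>" for x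
    using that e(1) by (auto simp: mult_lift lift_minus section_nrm_lift e_closed approx_unit_def)
qed

definition quasicentral_projection_unit :: "'a mult set \<Rightarrow> (nat \<Rightarrow> 'a) \<Rightarrow> bool" where
  "quasicentral_projection_unit D e \<longleftrightarrow> approx_unit A e \<and> (\<forall>k. cs_projection A (e k)) \<and>
    (\<forall>d\<in>D. (\<lambda>k. \<parallel>cs_minus M (cs_mult M (\<iota> (e k)) d) (cs_mult M d (\<iota> (e k)))\<parallel>\<^sub>M) \<longlonglongrightarrow> 0)"

lemma quasicentral_projection_unit_lift:
  assumes "quasicentral_projection_unit ((\<lambda>d. component d M) ` D) e"
  shows "projection_unit section_star section_scaleC section_nrm (lift ` \<A>) (\<lambda>k. lift (e k))"
    and "\<forall>d\<in>D. (\<lambda>k. section_nrm (lift (e k) * d - d * lift (e k))) \<longlonglongrightarrow> 0"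
proof -
  have e: "approx_unit A e" "\<And>k. cs_projection A (e k)"
    using assms by (simp_all add: quasicentral_projection_unit_def)
  then show "projection_unit section_star section_scaleC section_nrm (lift ` \<A>) (\<lambda>k. lift (e k))"
    by (rule projection_unit_lift)
  have "e k \<in> \<A>" for k using e(2)[of k] by (simp add: cs_projection_def)
  then show "\<forall>d\<in>D. (\<lambda>k. section_nrm (lift (e k) * d - d * lift (e k))) \<longlonglongrightarrow> 0"
    using assms by (simp add: quasicentral_projection_unit_def section_nrm_def)
qed

lemma corona_solution_exists:
  fixes P :: "nat \<Rightarrow> 'a mult spoly" and K :: "nat \<Rightarrow> real set"
  assumes units: "\<And>D. countable D \<Longrightarrow> D \<subseteq> \<M> \<Longrightarrow> \<exists>e. quasicentral_projection_unit D e"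
    and P: "\<And>n. spoly_consts (P n) \<subseteq> \<M>" and K: "\<And>n. closed (K n)"
    and approx: "\<And>m. \<exists>b. (\<forall>k. b k \<in> \<M> \<and> corona_nrm A (b k) \<le> 1) \<and>
      (\<forall>n\<le>m. corona_nrm A (spoly_eval M b (P n)) \<in> thicken (K n) (1 / real (Suc m)))"
  shows "\<exists>b. (\<forall>k. b k \<in> \<M> \<and> corona_nrm A (b k) \<le> 1) \<and> (\<forall>n. corona_nrm A (spoly_eval M b (P n)) \<in> K n)"
proof -
  let ?P = "\<lambda>n. map_spoly (single M) (P n)"
  have nrm_eval: "corona.quotient_nrm (corona.eval b (?P n))
      = corona_nrm A (spoly_eval M (\<lambda>k. component (b k) M) (P n))" for b n
    using P by (simp add: quotient_nrm_eq_corona_nrm component_eval)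
  have "\<exists>b. (\<forall>k. corona.quotient_nrm (b k) \<le> 1) \<and> (\<forall>n. corona.quotient_nrm (corona.eval b (?P n)) \<in> K n)"
  proof (rule corona.saturation[OF _ K])
    show "\<exists>e. projection_unit section_star section_scaleC section_nrm (lift ` \<A>) e \<and>
        (\<forall>d\<in>D. (\<lambda>k. section_nrm (e k * d - d * e k)) \<longlonglongrightarrow> 0)" if D: "countable D" for D
    proof -
      have "(\<lambda>d. component d M) ` D \<subseteq> \<M>" by auto
      from units[OF countable_image[OF D] this]
      obtain e where "quasicentral_projection_unit ((\<lambda>d. component d M) ` D) e" by blast
      from quasicentral_projection_unit_lift[OF this] show ?thesis by blast
    qed
    fix m
    obtain b where "\<And>k. b k \<in> \<M>" "\<And>k. corona_nrm A (b k) \<le> 1"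
      "\<And>n. n \<le> m \<Longrightarrow> corona_nrm A (spoly_eval M b (P n)) \<in> thicken (K n) (1 / real (Suc m))"
      using approx[of m] by blast
    then show "\<exists>b. (\<forall>k. corona.quotient_nrm (b k) \<le> 1) \<and>
        (\<forall>n\<le>m. \<exists>y\<in>K n. \<bar>corona.quotient_nrm (corona.eval b (?P n)) - y\<bar> \<le> 1 / real (Suc m))"
      unfolding nrm_eval
      by (intro exI[of _ "\<lambda>k. single M (b k)"]) (auto simp: quotient_nrm_eq_corona_nrm thicken_def)
  qed
  then obtain b where "\<And>k. corona_nrm A (component (b k) M) \<le> 1"
    "\<And>n. corona_nrm A (spoly_eval M (\<lambda>k. component (b k) M) (P n)) \<in> K n"
    unfolding nrm_eval unfolding quotient_nrm_eq_corona_nrm by blast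
  then show ?thesis by (intro exI[of _ "\<lambda>k. component (b k) M"]) simp
qed

theorem corona_ctbl_qf_saturated_if_quasicentral:
  assumes "\<And>D. countable D \<Longrightarrow> D \<subseteq> \<M> \<Longrightarrow> \<exists>e. quasicentral_projection_unit D e"
  shows "corona_ctbl_qf_saturated A"
  unfolding corona_ctbl_qf_saturated_def
proof (intro allI impI iffI)
  fix P :: "nat \<Rightarrow> 'a mult spoly" and K :: "nat \<Rightarrow> real set" and m :: nat
  assume "\<exists>b. (\<forall>k. b k \<in> \<M> \<and> corona_nrm A (b k) \<le> 1) \<and> (\<forall>n. corona_nrm A (spoly_eval M b (P n)) \<in> K n)"
  moreover have "K n \<subseteq> thicken (K n) (1 / real m)" for n
    unfolding thicken_def by (auto intro!: bexI)
  ultimately show "\<exists>b. (\<forall>k. b k \<in> \<M> \<and> corona_nrm A (b k) \<le> 1) \<and>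
      (\<forall>n\<le>m. corona_nrm A (spoly_eval M b (P n)) \<in> thicken (K n) (1 / real m))"
    by blast
next
  fix P :: "nat \<Rightarrow> 'a mult spoly" and K :: "nat \<Rightarrow> real set"
  assume PK: "(\<forall>n. spoly_consts (P n) \<subseteq> \<M>) \<and> (\<forall>n. compact (K n))"
    and approx: "\<forall>m\<ge>1. \<exists>b. (\<forall>k. b k \<in> \<M> \<and> corona_nrm A (b k) \<le> 1) \<and>
      (\<forall>n\<le>m. corona_nrm A (spoly_eval M b (P n)) \<in> thicken (K n) (1 / real m))"
  show "\<exists>b. (\<forall>k. b k \<in> \<M> \<and> corona_nrm A (b k) \<le> 1) \<and> (\<forall>n. corona_nrm A (spoly_eval M b (P n)) \<in> K n)"
  proof (rule corona_solution_exists[OF assms])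
    show "spoly_consts (P n) \<subseteq> \<M>" "closed (K n)" for n using PK compact_imp_closed by blast+
    show "\<exists>b. (\<forall>k. b k \<in> \<M> \<and> corona_nrm A (b k) \<le> 1) \<and>
        (\<forall>n\<le>m. corona_nrm A (spoly_eval M b (P n)) \<in> thicken (K n) (1 / real (Suc m)))" for m
    proof -
      have "1 \<le> Suc m" by simp
      from approx[rule_format, OF this] obtain b where "\<And>k. b k \<in> \<M>" "\<And>k. corona_nrm A (b k) \<le> 1"
        "\<And>n. n \<le> Suc m \<Longrightarrow> corona_nrm A (spoly_eval M b (P n)) \<in> thicken (K n) (1 / real (Suc m))"
        by blast
      then show ?thesis by (intro exI[of _ b]) (simp del: of_nat_Suc)
    qed
  qed
qed

end

theorem theorem1p0:
  fixes A :: "'a cstar"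
  assumes "is_cstar A"
    and "sigma_unital A"
    and "\<forall>B. separable_subalg (mult_alg A) B \<longrightarrow>
           (\<exists>e. approx_unit A e \<and> (\<forall>k. cs_projection A (e k)) \<and>
                (\<forall>b\<in>B. (\<lambda>k. cs_nrm (mult_alg A)
                     (cs_minus (mult_alg A) (cs_mult (mult_alg A) (mult_emb A (e k)) b)
                                            (cs_mult (mult_alg A) b (mult_emb A (e k))))) \<longlonglongrightarrow> 0))"
  shows "corona_ctbl_qf_saturated A"
proof -
  interpret cstar_algebra A by unfold_locales (rule assms(1))
  interpret M: cstar_algebra "mult_alg A" by unfold_locales (rule is_cstar_mult_alg)
  show ?thesis
  proof (rule corona_ctbl_qf_saturated_if_quasicentral)
    fix D assume "countable D" "D \<subseteq> cs_carrier (mult_alg A)"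
    then obtain B where "separable_subalg (mult_alg A) B" "D \<subseteq> B"
      by (rule M.separable_subalg_exists)
    with assms(3) show "\<exists>e. quasicentral_projection_unit D e"
      unfolding quasicentral_projection_unit_def by (meson subsetD)
  qed
qed

end
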